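(* The following statements hold. (1) Let $(0,t)=(0,t_1x_1\wedge y_1+t_2x_2\wedge y_2)$ with $t_1\ge t_2>0$ and $x_1,y_1,x_2,y_2$ an orthonormal family in $\mathbb{R}^4$. Then all length-minimizers from $(0,0)$ reaching $(0,t)$ have the form $\gamma(\cdot,a,b,\phi)$ with $\phi_2=2\phi_1$ or $\phi_1=2\phi_2$. Moreover, for all $t_1\ge t_2>0$, $$d\big((0,0),(0,t_1x_1\wedge y_1+t_2x_2\wedge y_2)\big)=\sqrt{4\pi t_1+8\pi t_2}=\sqrt{4\pi\max\{|t_1|,|t_2|\}+8\pi\min\{|t_1|,|t_2|\}}.$$ (2) Let $0<\phi_2<\phi_1$ with $\phi_1$ and $\phi_2$ rationally dependent (i.e. $\phi_1/\phi_2\in\mathbb{Q}$), let $r_1,r_2>0$ and consider the extremal $\gamma=\gamma(\cdot,a,b,\phi)$ with $r_k=|a_k|=|b_k|$ for $k=1,2$. Then: (a) if $\phi_1=2\phi_2$ and $r_2^2\ge\frac{r_1^2}{2}$, then $t_{\mathrm{cut}}(\gamma)=\frac{\pi}{\phi_2}$ and $\gamma(t_{\mathrm{cut}})=\big(0,\ \frac{\pi}{8\phi_2^2}a_1\wedge b_1+\frac{\pi}{4\phi_2^2}a_2\wedge b_2\big)$; (b) if $\phi_1=2\phi_2$ and $r_2^2<\frac{r_1^2}{2}$, then $t_{\mathrm{cut}}(\gamma)<\frac{\pi}{\phi_2}$; (c) if $\frac{\phi_1}{\phi_2}=\frac pq\in\mathbb{Q}\cap(1,+\infty)\setminus\{2\}$,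 where the positive integers $p$ and $q$ have no common divisors, then $$t_{\mathrm{cut}}(\gamma)<\frac{\pi q}{\phi_2}=\min\{s>0:\ s\phi_1\equiv s\phi_2\equiv0\ (\mathrm{mod}\ \pi)\}.$$
   Context: A horizontal curve $\gamma=(x,t):[0,T]\to\mathbb{R}^4\times\Lambda^2\mathbb{R}^4$ is a Lipschitz curve satisfying, a.e., $\dot x=u$, $\dot t=\frac12x\wedge u$ for a control $u$; its length is $\int_0^T|u(s)|\,ds$ (Euclidean norm), and $d$ is the distance defined as the infimum of lengths of horizontal curves connecting two points. A horizontal curve is a length-minimizer on $[0,T]$ if its length equals the distance between its endpoints; length-minimizers are taken parametrized with constant speed $|u|$. For pairwise orthogonal $a_1,b_1,a_2,b_2\in\mathbb{R}^4$ with $|a_k|=|b_k|$ and $\phi_1,\phi_2\geq 0$, the extremal $\gamma(\cdot,a,b,\phi)$ is the horizontal curve with $\gamma(0)=(0,0)$ and control $u(s)=a_1\cos(2\phi_1s)+b_1\sin(2\phi_1s)+a_2\cos(2\phi_2s)+b_2\sin(2\phi_2s)$, $s\ge0$. The cut time is $t_{\mathrm{cut}}(\gamma)=\sup\{T>0:\gamma|_{[0,T]}\text{ is a length-minimizer between }\gamma(0)\text{ and }\gamma(T)\}$. *)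

theory Defs
  imports "HOL-Analysis.Analysis" "HOL-Library.Extended_Real" "HOL-Library.Real_Mod"
begin

text \<open>
  The space of bivectors \<open>\<Lambda>\<^sup>2\<real>\<^sup>4\<close> is realised as the space of skew-symmetric matrices, with
  \<open>x \<and> y\<close> corresponding to \<open>x y\<^sup>T - y x\<^sup>T\<close>. Points of the group are pairs \<open>(x, t)\<close>.
\<close>

definition Lambda2 :: "(real^4^4) set" where
  "Lambda2 = {A. transpose A = - A}"

definition wedge :: "real^4 \<Rightarrow> real^4 \<Rightarrow> real^4^4" where
  "wedge x y = (\<chi> i j. x $ i * y $ j - y $ i * x $ j)"

definition horizontal_curve ::
    "real \<Rightarrow> (real \<Rightarrow> (real^4) \<times> (real^4^4)) \<Rightarrow> (real \<Rightarrow> real^4) \<Rightarrow> bool" where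
  "horizontal_curve T \<gamma> u \<longleftrightarrow>
     0 < T \<and>
     \<gamma> ` {0..T} \<subseteq> UNIV \<times> Lambda2 \<and>
     (\<exists>L. L-lipschitz_on {0..T} \<gamma>) \<and>
     (AE s in lebesgue. s \<in> {0..T} \<longrightarrow>
        ((\<lambda>r. fst (\<gamma> r)) has_vector_derivative u s) (at s within {0..T}) \<and>
        ((\<lambda>r. snd (\<gamma> r)) has_vector_derivative (1/2) *\<^sub>R wedge (fst (\<gamma> s)) (u s))
          (at s within {0..T}))"

text \<open>
  The control of a horizontal curve is a.e. the derivative of a Lipschitz map, hence it is
  measurable and essentially bounded, and the following integral exists.
\<close>

definition control_length :: "real \<Rightarrow> (real \<Rightarrow> real^4) \<Rightarrow> real" where
  "control_length T u = integral {0..T} (\<lambda>s. norm (u s))"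

text \<open>
  Only meaningful for points of \<open>UNIV \<times> Lambda2\<close>; any two of these are joined by a horizontal curve,
  so that the infimum is taken over a nonempty set.
\<close>

definition cc_dist :: "(real^4) \<times> (real^4^4) \<Rightarrow> (real^4) \<times> (real^4^4) \<Rightarrow> real" where
  "cc_dist p q =
     Inf {control_length T u | T \<gamma> u. horizontal_curve T \<gamma> u \<and> \<gamma> 0 = p \<and> \<gamma> T = q}"

definition length_minimizer ::
    "real \<Rightarrow> (real \<Rightarrow> (real^4) \<times> (real^4^4)) \<Rightarrow> (real \<Rightarrow> real^4) \<Rightarrow> bool" where
  "length_minimizer T \<gamma> u \<longleftrightarrow>
     horizontal_curve T \<gamma> u \<and> control_length T u = cc_dist (\<gamma> 0) (\<gamma> T)"

definition constant_speed :: "real \<Rightarrow> (real \<Rightarrow> real^4) \<Rightarrow> bool" where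
  "constant_speed T u \<longleftrightarrow> (\<exists>c. AE s in lebesgue. s \<in> {0..T} \<longrightarrow> norm (u s) = c)"

definition cut_time :: "(real \<Rightarrow> (real^4) \<times> (real^4^4)) \<Rightarrow> ereal" where
  "cut_time \<gamma> = Sup {ereal T | T. 0 < T \<and> (\<exists>u. length_minimizer T \<gamma> u)}"

definition orthogonal4 :: "real^4 \<Rightarrow> real^4 \<Rightarrow> real^4 \<Rightarrow> real^4 \<Rightarrow> bool" where
  "orthogonal4 v1 v2 v3 v4 \<longleftrightarrow>
     orthogonal v1 v2 \<and> orthogonal v1 v3 \<and> orthogonal v1 v4 \<and>
     orthogonal v2 v3 \<and> orthogonal v2 v4 \<and> orthogonal v3 v4"

definition orthonormal4 :: "real^4 \<Rightarrow> real^4 \<Rightarrow> real^4 \<Rightarrow> real^4 \<Rightarrow> bool" where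
  "orthonormal4 v1 v2 v3 v4 \<longleftrightarrow>
     orthogonal4 v1 v2 v3 v4 \<and> norm v1 = 1 \<and> norm v2 = 1 \<and> norm v3 = 1 \<and> norm v4 = 1"

definition extremal_params ::
    "real^4 \<Rightarrow> real^4 \<Rightarrow> real^4 \<Rightarrow> real^4 \<Rightarrow> real \<Rightarrow> real \<Rightarrow> bool" where
  "extremal_params a1 b1 a2 b2 \<phi>1 \<phi>2 \<longleftrightarrow>
     orthogonal4 a1 b1 a2 b2 \<and> norm a1 = norm b1 \<and> norm a2 = norm b2 \<and> 0 \<le> \<phi>1 \<and> 0 \<le> \<phi>2"

definition extremal_control ::
    "real^4 \<Rightarrow> real^4 \<Rightarrow> real^4 \<Rightarrow> real^4 \<Rightarrow> real \<Rightarrow> real \<Rightarrow> real \<Rightarrow> real^4" where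
  "extremal_control a1 b1 a2 b2 \<phi>1 \<phi>2 s =
     cos (2 * \<phi>1 * s) *\<^sub>R a1 + sin (2 * \<phi>1 * s) *\<^sub>R b1 +
     cos (2 * \<phi>2 * s) *\<^sub>R a2 + sin (2 * \<phi>2 * s) *\<^sub>R b2"

text \<open>
  The horizontal curve issued from \<open>(0, 0)\<close> with a continuous control \<open>u\<close>, obtained by
  integrating \<open>x' = u\<close> and then \<open>t' = (1/2) x \<and> u\<close>; only its values for \<open>s \<ge> 0\<close> matter.
\<close>

definition curve_of_control ::
    "(real \<Rightarrow> real^4) \<Rightarrow> real \<Rightarrow> (real^4) \<times> (real^4^4)" where
  "curve_of_control u s =
     (integral {0..s} u,
      integral {0..s} (\<lambda>r. (1/2) *\<^sub>R wedge (integral {0..r} u) (u r)))"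

definition extremal ::
    "real^4 \<Rightarrow> real^4 \<Rightarrow> real^4 \<Rightarrow> real^4 \<Rightarrow> real \<Rightarrow> real \<Rightarrow> real \<Rightarrow> (real^4) \<times> (real^4^4)" where
  "extremal a1 b1 a2 b2 \<phi>1 \<phi>2 = curve_of_control (extremal_control a1 b1 a2 b2 \<phi>1 \<phi>2)"

lemma curve_of_control_0: "curve_of_control u 0 = (0, 0)"
  by (simp add: curve_of_control_def)

lemma continuous_on_wedge:
  assumes "continuous_on S f" "continuous_on S g"
  shows "continuous_on S (\<lambda>s. wedge (f s) (g s))"
  unfolding wedge_def using assms by (intro continuous_intros)

lemma horizontal_curve_of_control:
  assumes u: "continuous_on UNIV u" and T: "0 < T"
  shows "horizontal_curve T (curve_of_control u) u"
proof -
  let ?x = "\<lambda>s. integral {0..s} u"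
  let ?w = "\<lambda>r. (1/2) *\<^sub>R wedge (?x r) (u r)"
  have u': "continuous_on {0..T} u"
    using u continuous_on_subset by blast
  have dx: "(?x has_vector_derivative u s) (at s within {0..T})" if "s \<in> {0..T}" for s
    using integral_has_vector_derivative[OF u' that] .
  have cx: "continuous_on {0..T} ?x"
    using dx by (meson continuous_on_eq_continuous_within has_vector_derivative_continuous)
  have cw: "continuous_on {0..T} ?w"
    by (intro continuous_intros continuous_on_wedge cx u')
  have dt: "((\<lambda>s. integral {0..s} ?w) has_vector_derivative ?w s) (at s within {0..T})"
    if "s \<in> {0..T}" for s
    using integral_has_vector_derivative[OF cw that] .
  have d: "(curve_of_control u has_vector_derivative (u s, ?w s)) (at s within {0..T})"
    if "s \<in> {0..T}" for s
    using has_vector_derivative_Pair[OF dx[OF that] dt[OF that]]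
    unfolding curve_of_control_def[abs_def] .
  have "continuous_on {0..T} (\<lambda>s. (u s, ?w s))"
    by (intro continuous_on_Pair u' cw)
  then have "bounded ((\<lambda>s. (u s, ?w s)) ` {0..T})"
    by (intro compact_imp_bounded compact_continuous_image) auto
  then obtain B where B: "B > 0" "\<And>s. s \<in> {0..T} \<Longrightarrow> norm (u s, ?w s) \<le> B"
    unfolding bounded_pos by blast
  have lip: "B-lipschitz_on {0..T} (curve_of_control u)"
  proof (rule bounded_derivative_imp_lipschitz)
    show "(curve_of_control u has_derivative (\<lambda>h. h *\<^sub>R (u s, ?w s))) (at s within {0..T})"
      if "s \<in> {0..T}" for s
      using d[OF that] unfolding has_vector_derivative_def .
    show "onorm (\<lambda>h. h *\<^sub>R (u s, ?w s)) \<le> B" if "s \<in> {0..T}" for s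
    proof (rule onorm_le)
      fix h :: real
      have "norm (h *\<^sub>R (u s, ?w s)) = norm (u s, ?w s) * norm h"
        by (simp only: norm_scaleR real_norm_def mult.commute)
      also have "\<dots> \<le> B * norm h"
        by (rule mult_right_mono[OF B(2)[OF that]]) simp
      finally show "norm (h *\<^sub>R (u s, ?w s)) \<le> B * norm h" .
    qed
  qed (use B in auto)
  have skew: "integral {0..s} ?w \<in> Lambda2" if "s \<in> {0..T}" for s
  proof -
    have i: "?w integrable_on {0..s}"
      by (rule integrable_continuous_real) (use cw that in \<open>auto intro: continuous_on_subset\<close>)
    have bl: "bounded_linear (transpose :: real^4^4 \<Rightarrow> real^4^4)"
      by (rule linear_conv_bounded_linear[THEN iffD1], rule linearI)
         (auto simp: transpose_def vec_eq_iff)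
    have "transpose (integral {0..s} ?w) = integral {0..s} (transpose \<circ> ?w)"
      using integral_linear[OF i bl] by simp
    also have "transpose \<circ> ?w = (\<lambda>r. - ?w r)"
      by (auto simp: fun_eq_iff transpose_def wedge_def vec_eq_iff algebra_simps)
    finally show ?thesis by (simp add: Lambda2_def)
  qed
  show ?thesis
    unfolding horizontal_curve_def
    using T lip skew dx dt by (auto simp: curve_of_control_def)
qed

lemma horizontal_curve_extremal:
  assumes "0 < T"
  shows "horizontal_curve T (extremal a1 b1 a2 b2 \<phi>1 \<phi>2) (extremal_control a1 b1 a2 b2 \<phi>1 \<phi>2)"
  unfolding extremal_def
  by (rule horizontal_curve_of_control[OF _ assms])
     (auto simp: extremal_control_def[abs_def] intro!: continuous_intros)

end

theory Submission
  imports Defs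
begin

text \<open>
  A horizontal curve from \<open>(0, 0)\<close> to \<open>(0, t)\<close> is a closed curve \<open>x\<close> in \<open>\<real>\<^sup>4\<close> whose area bivector
  \<open>1/2 \<integral> x \<and> u\<close> is \<open>t\<close>. Reparametrise \<open>x\<close> over \<open>[0, 2\<pi>]\<close> and split it into its mean, its first Fourier
  mode \<open>cos s c + sin s d\<close> and a rest \<open>y\<close>. The first mode contributes the simple bivector
  \<open>W = \<pi> c \<and> d\<close> to the area, and its share \<open>2m = \<pi> (|c|\<^sup>2 + |d|\<^sup>2)\<close> of the energy is at least \<open>2 |W|\<close>.
  The rest has frequencies at least 2, so by the Poincare inequality (\<open>poincare\<close>) it costs four units
  of energy per unit of area, measured by any linear functional bounded by 1 on unit
  simple bivectors (\<open>area_functional_le\<close>). Two such functionals suffice. The first is pairing with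
  \<open>x1 \<and> y1 + x2 \<and> y2\<close>: it takes the value \<open>t1 + t2\<close> on \<open>t\<close>, so the rest costs at least
  \<open>4 (t1 + t2 - m)\<close>. The second evaluates a bivector, as a skew matrix, on a unit vector
  orthogonal to \<open>c\<close> and \<open>d\<close>; it annihilates \<open>W\<close> and can be aligned with the image of that vector under
  \<open>t\<close>, so the rest costs at least \<open>4 t2\<close>. Together with the first mode this gives the energy
  bound \<open>2 t1 + 4 t2\<close> of \<open>energy_analysis\<close>. Equality forces \<open>m = t1\<close>, forces \<open>y\<close> to be a pure second
  mode, and forces both modes to be circles in orthogonal planes; this is the extremal with
  frequency ratio 2.

  The energy bound becomes a bound for the length of an arbitrary curve by reparametrising with
  densities that converge to the speed (\<open>length_bound\<close>). Since the extremals with frequency ratio 2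
  attain it, the formula for the distance follows (\<open>cc_dist_center\<close>).

  An extremal with rationally dependent frequencies, \<open>\<phi>1 : \<phi>2 = p : q\<close>, comes back to \<open>x = 0\<close> at the
  common period \<open>\<pi> q / \<phi>2\<close>, over a point of the same form. If \<open>t1\<close> and \<open>t2\<close> denote the total areas swept
  out in its two planes, the square of its length there is \<open>4 \<pi> p t1 + 4 \<pi> q t2\<close>. This exceeds the
  square of the distance, unless \<open>p : q = 2 : 1\<close> and \<open>t1 \<le> t2\<close>, when the two agree. A strict shortcut
  at one time excludes minimality at all later times and, by travelling backwards along the extremal,
  also at slightly earlier times (\<open>cut_time_less_of_shortcut\<close>), so the cut time is then strictly
  smaller than the common period. In the remaining case the extremal minimizes up to its common period.
  It does not minimize beyond a time \<open>r\<close> with \<open>x(r) = 0\<close>: replacing \<open>x\<close> by \<open>- x\<close> on \<open>[0, r]\<close> does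
  not change \<open>x \<and> u\<close>, hence gives a curve with the same end points and the same length, but with a
  corner at \<open>r\<close>, and corners are excluded by the first variation (\<open>not_minimizing_beyond_return\<close>).
\<close>

section \<open>Lipschitz functions and their almost everywhere derivatives\<close>

text \<open>
  Horizontal curves are merely Lipschitz, so the calculus below is done for pairs of a Lipschitz
  function and a representative of its almost everywhere derivative. The representative is bounded
  at every point of the interval: this makes the class closed under products, which is how
  integration by parts is obtained.
\<close>

definition lip_deriv :: "real \<Rightarrow> (real \<Rightarrow> 'a::euclidean_space) \<Rightarrow> (real \<Rightarrow> 'a) \<Rightarrow> bool" where
  "lip_deriv T f u \<longleftrightarrow>
     0 < T \<and> (\<exists>L. L-lipschitz_on {0..T} f) \<and> bounded (u ` {0..T}) \<and>
     (\<exists>N. negligible N \<and> (\<forall>s\<in>{0..T} - N. (f has_vector_derivative u s) (at s within {0..T})))"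

lemma lip_derivI:
  assumes "0 < T" "L-lipschitz_on {0..T} f" "\<And>s. s \<in> {0..T} \<Longrightarrow> norm (u s) \<le> B" "negligible N"
    "\<And>s. s \<in> {0..T} - N \<Longrightarrow> (f has_vector_derivative u s) (at s within {0..T})"
  shows "lip_deriv T f u"
  using assms unfolding lip_deriv_def bounded_iff by blast

lemma lip_derivE:
  assumes "lip_deriv T f u"
  obtains L B N where "0 < T" "L-lipschitz_on {0..T} f" "0 < B"
    "\<And>s. s \<in> {0..T} \<Longrightarrow> norm (u s) \<le> B" "negligible N"
    "\<And>s. s \<in> {0..T} - N \<Longrightarrow> (f has_vector_derivative u s) (at s within {0..T})"
proof -
  from assms obtain L N where *: "0 < T" "L-lipschitz_on {0..T} f" "bounded (u ` {0..T})" "negligible N"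
    "\<And>s. s \<in> {0..T} - N \<Longrightarrow> (f has_vector_derivative u s) (at s within {0..T})"
    unfolding lip_deriv_def by blast
  from *(3) obtain B where "B > 0" "\<And>s. s \<in> {0..T} \<Longrightarrow> norm (u s) \<le> B"
    unfolding bounded_pos by auto
  then show thesis using * that by blast
qed

lemma lip_deriv_continuous: "lip_deriv T f u \<Longrightarrow> continuous_on {0..T} f"
  by (meson lip_derivE lipschitz_on_continuous_on)

lemma lip_deriv_restrict:
  assumes "lip_deriv T f u" "0 < S" "S \<le> T"
  shows "lip_deriv S f u"
proof -
  from assms(1) obtain L B N where *: "L-lipschitz_on {0..T} f"
    "\<And>s. s \<in> {0..T} \<Longrightarrow> norm (u s) \<le> B" "negligible N"
    "\<And>s. s \<in> {0..T} - N \<Longrightarrow> (f has_vector_derivative u s) (at s within {0..T})"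
    by (elim lip_derivE) blast
  have sub: "{0..S} \<subseteq> {0..T}" using assms by auto
  show ?thesis
  proof (rule lip_derivI)
    show "L-lipschitz_on {0..S} f" using *(1) sub by (rule lipschitz_on_subset)
    show "negligible N" by fact
    show "norm (u s) \<le> B" if "s \<in> {0..S}" for s using *(2) sub that by blast
    show "(f has_vector_derivative u s) (at s within {0..S})" if "s \<in> {0..S} - N" for s
      using *(4)[of s] sub that has_vector_derivative_within_subset by blast
  qed fact
qed

lemma lip_deriv_bilinear:
  assumes h: "bounded_bilinear h" and f: "lip_deriv T f u" and g: "lip_deriv T g v"
  shows "lip_deriv T (\<lambda>s. h (f s) (g s)) (\<lambda>s. h (f s) (v s) + h (u s) (g s))"
proof -
  interpret bounded_bilinear h by fact
  from f obtain L B N where F: "0 < T" "L-lipschitz_on {0..T} f" "B > 0"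
    "\<And>s. s \<in> {0..T} \<Longrightarrow> norm (u s) \<le> B" "negligible N"
    "\<And>s. s \<in> {0..T} - N \<Longrightarrow> (f has_vector_derivative u s) (at s within {0..T})"
    by (elim lip_derivE) blast
  from g obtain L' B' N' where G: "L'-lipschitz_on {0..T} g" "B' > 0"
    "\<And>s. s \<in> {0..T} \<Longrightarrow> norm (v s) \<le> B'" "negligible N'"
    "\<And>s. s \<in> {0..T} - N' \<Longrightarrow> (g has_vector_derivative v s) (at s within {0..T})"
    by (elim lip_derivE) blast
  have "bounded (f ` {0..T})" "bounded (g ` {0..T})"
    using lip_deriv_continuous[OF f] lip_deriv_continuous[OF g]
    by (simp_all add: compact_continuous_image compact_imp_bounded)
  then obtain C C' where C: "C > 0" "\<And>s. s \<in> {0..T} \<Longrightarrow> norm (f s) \<le> C"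
     and C': "C' > 0" "\<And>s. s \<in> {0..T} \<Longrightarrow> norm (g s) \<le> C'"
    unfolding bounded_pos by auto
  obtain K where K: "K > 0" "\<And>a b. norm (h a b) \<le> norm a * norm b * K"
    using pos_bounded by blast
  have L0: "L \<ge> 0" "L' \<ge> 0" using F(2) G(1) by (auto simp: lipschitz_on_def)
  show ?thesis
  proof (rule lip_derivI)
    show "(K * (C * L' + L * C'))-lipschitz_on {0..T} (\<lambda>s. h (f s) (g s))"
    proof (rule lipschitz_onI)
      fix s r assume sr: "s \<in> {0..T}" "r \<in> {0..T}"
      have "h (f s) (g s) - h (f r) (g r) = h (f s) (g s - g r) + h (f s - f r) (g r)"
        by (simp add: diff_left diff_right)
      also have "norm \<dots> \<le> norm (h (f s) (g s - g r)) + norm (h (f s - f r) (g r))"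
        by (rule norm_triangle_ineq)
      also have "\<dots> \<le> norm (f s) * norm (g s - g r) * K + norm (f s - f r) * norm (g r) * K"
        by (intro add_mono K)
      also have "\<dots> \<le> C * (L' * dist s r) * K + (L * dist s r) * C' * K"
        using sr C C' F(2) G(1) K(1) L0
        by (intro add_mono mult_right_mono mult_mono) (auto simp: lipschitz_on_def dist_norm)
      finally show "dist (h (f s) (g s)) (h (f r) (g r)) \<le> K * (C * L' + L * C') * dist s r"
        by (simp add: dist_norm algebra_simps)
    qed (use K C C' L0 in auto)
    show "norm (h (f s) (v s) + h (u s) (g s)) \<le> C * B' * K + B * C' * K" if "s \<in> {0..T}" for s
    proof -
      have "norm (h (f s) (v s) + h (u s) (g s)) \<le> norm (f s) * norm (v s) * K + norm (u s) * norm (g s) * K"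
        by (intro norm_triangle_le add_mono K)
      also have "\<dots> \<le> C * B' * K + B * C' * K"
        using that C C' F(3,4) G(2,3) K(1)
        by (intro add_mono mult_right_mono mult_mono) (auto intro: less_imp_le)
      finally show ?thesis .
    qed
    show "negligible (N \<union> N')" using F G by simp
    show "((\<lambda>s. h (f s) (g s)) has_vector_derivative h (f s) (v s) + h (u s) (g s)) (at s within {0..T})"
      if "s \<in> {0..T} - (N \<union> N')" for s
      using F(6)[of s] G(5)[of s] that
      by (intro has_vector_derivative) auto
  qed fact
qed

lemma lip_deriv_add:
  assumes f: "lip_deriv T f u" and g: "lip_deriv T g v"
  shows "lip_deriv T (\<lambda>s. f s + g s) (\<lambda>s. u s + v s)"
proof -
  from f obtain L B N where F: "0 < T" "L-lipschitz_on {0..T} f"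
    "\<And>s. s \<in> {0..T} \<Longrightarrow> norm (u s) \<le> B" "negligible N"
    "\<And>s. s \<in> {0..T} - N \<Longrightarrow> (f has_vector_derivative u s) (at s within {0..T})"
    by (elim lip_derivE) blast
  from g obtain L' B' N' where G: "L'-lipschitz_on {0..T} g"
    "\<And>s. s \<in> {0..T} \<Longrightarrow> norm (v s) \<le> B'" "negligible N'"
    "\<And>s. s \<in> {0..T} - N' \<Longrightarrow> (g has_vector_derivative v s) (at s within {0..T})"
    by (elim lip_derivE) blast
  show ?thesis
  proof (rule lip_derivI)
    show "(L + L')-lipschitz_on {0..T} (\<lambda>s. f s + g s)" using F(2) G(1) by (rule lipschitz_on_add)
    show "negligible (N \<union> N')" using F G by simp
    show "norm (u s + v s) \<le> B + B'" if "s \<in> {0..T}" for s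
      using F(3)[OF that] G(2)[OF that] norm_triangle_ineq[of "u s" "v s"] by linarith
    show "((\<lambda>s. f s + g s) has_vector_derivative u s + v s) (at s within {0..T})"
      if "s \<in> {0..T} - (N \<union> N')" for s
      using F(5)[of s] G(4)[of s] that by (intro has_vector_derivative_add) auto
  qed fact
qed

lemma lip_deriv_C1:
  assumes T: "0 < T" and d: "\<And>s. s \<in> {0..T} \<Longrightarrow> (f has_vector_derivative f' s) (at s within {0..T})"
    and c: "continuous_on {0..T} f'"
  shows "lip_deriv T f f'"
proof -
  have "bounded (f' ` {0..T})" using c by (simp add: compact_continuous_image compact_imp_bounded)
  then obtain B where B: "B > 0" "\<And>s. s \<in> {0..T} \<Longrightarrow> norm (f' s) \<le> B"
    unfolding bounded_pos by auto
  show ?thesis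
  proof (rule lip_derivI)
    show "B-lipschitz_on {0..T} f"
    proof (rule bounded_derivative_imp_lipschitz)
      show "(f has_derivative (\<lambda>h. h *\<^sub>R f' s)) (at s within {0..T})" if "s \<in> {0..T}" for s
        using d[OF that] unfolding has_vector_derivative_def .
      show "onorm (\<lambda>h. h *\<^sub>R f' s) \<le> B" if "s \<in> {0..T}" for s
        using B(2)[OF that] by (intro onorm_le) (simp add: mult.commute[of B] mult_left_mono)
    qed (use B in auto)
    show "negligible {}" by simp
  qed (use T B d in auto)
qed

lemma lip_deriv_const: "0 < T \<Longrightarrow> lip_deriv T (\<lambda>s. c) (\<lambda>s. 0)"
  by (rule lip_deriv_C1) (auto intro: has_vector_derivative_const)

lemma lip_deriv_linear:
  assumes "bounded_linear h" "lip_deriv T f u"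
  shows "lip_deriv T (\<lambda>s. h (f s)) (\<lambda>s. h (u s))"
proof -
  have T: "0 < T" using assms(2) by (simp add: lip_deriv_def)
  have bb: "bounded_bilinear (\<lambda>(a::real) b. a *\<^sub>R h b)"
    by (rule bounded_bilinear.comp[OF bounded_bilinear_scaleR bounded_linear_ident assms(1)])
  show ?thesis
    using lip_deriv_bilinear[OF bb lip_deriv_const[OF T, of 1] assms(2)] by simp
qed

lemma lip_deriv_diff:
  assumes f: "lip_deriv T f u" and g: "lip_deriv T g v"
  shows "lip_deriv T (\<lambda>s. f s - g s) (\<lambda>s. u s - v s)"
  using lip_deriv_add[OF f lip_deriv_linear[OF bounded_linear_minus[OF bounded_linear_ident] g]] by simp

text \<open>
  Dominated convergence with a constant majorant, in the form in which the limit is only known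
  outside a null set.
\<close>

lemma bounded_convergence_interval:
  fixes q :: "nat \<Rightarrow> real \<Rightarrow> 'a::euclidean_space"
  assumes M: "negligible M" and int: "\<And>n. q n integrable_on {a..b}"
    and bd: "\<And>n s. s \<in> {a..b} \<Longrightarrow> norm (q n s) \<le> B"
    and lim: "\<And>s. s \<in> {a..b} - M \<Longrightarrow> (\<lambda>n. q n s) \<longlonglongrightarrow> v s"
  shows "v integrable_on {a..b}" "(\<lambda>n. integral {a..b} (q n)) \<longlonglongrightarrow> integral {a..b} v"
proof -
  define q' where "q' n s = (if s \<in> M then 0 else q n s)" for n s
  define v' where "v' s = (if s \<in> M then 0 else v s)" for s
  have 1: "q' n integrable_on {a..b}" for n
    by (rule integrable_spike[OF int M]) (simp add: q'_def)
  have 2: "norm (q' n s) \<le> \<bar>B\<bar>" if "s \<in> {a..b}" for n s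
    using order_trans[OF bd[OF that] abs_ge_self] by (simp add: q'_def)
  have 3: "(\<lambda>n. q' n s) \<longlonglongrightarrow> v' s" if "s \<in> {a..b}" for s
    using lim[of s] that by (simp add: q'_def v'_def)
  note dc = dominated_convergence[OF 1 integrable_const_ivl 2 3]
  show "v integrable_on {a..b}" using integrable_spike[OF dc(1) M, of v] by (simp add: v'_def)
  have "integral {a..b} (q' n) = integral {a..b} (q n)" for n
    by (rule integral_spike[OF M]) (simp add: q'_def)
  moreover have "integral {a..b} v' = integral {a..b} v"
    by (rule integral_spike[OF M]) (simp add: v'_def)
  ultimately show "(\<lambda>n. integral {a..b} (q n)) \<longlonglongrightarrow> integral {a..b} v" using dc(2) by simp
qed

text \<open>
  The forward difference quotient with step \<open>1/(n+1)\<close>. Clamping the argument at \<open>T\<close> keeps it defined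
  and continuous on all of \<open>[0, T]\<close>, so that it can be integrated over the whole interval.
\<close>

definition clamped_quotient :: "real \<Rightarrow> (real \<Rightarrow> 'a::euclidean_space) \<Rightarrow> nat \<Rightarrow> real \<Rightarrow> 'a" where
  "clamped_quotient T f n s = real (Suc n) *\<^sub>R (f (min T (s + 1 / real (Suc n))) - f s)"

lemma clamped_quotient_le:
  assumes "L-lipschitz_on {0..T} f" "s \<in> {0..T}"
  shows "norm (clamped_quotient T f n s) \<le> L"
proof -
  let ?d = "1 / real (Suc n)"
  have L: "L \<ge> 0" using assms(1) by (simp add: lipschitz_on_def)
  have "min T (s + ?d) \<in> {0..T}" using assms(2) by auto
  then have "norm (f (min T (s + ?d)) - f s) \<le> L * \<bar>min T (s + ?d) - s\<bar>"
    using assms unfolding lipschitz_on_def dist_norm real_norm_def by blast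
  also have "\<bar>min T (s + ?d) - s\<bar> \<le> ?d" using assms(2) by auto
  finally have "norm (f (min T (s + ?d)) - f s) \<le> L * ?d" using L by (simp add: mult_left_mono)
  then have "real (Suc n) * norm (f (min T (s + ?d)) - f s) \<le> real (Suc n) * (L * ?d)"
    by (intro mult_left_mono) auto
  then show ?thesis unfolding clamped_quotient_def norm_scaleR by simp
qed

lemma clamped_quotient_tendsto:
  assumes d: "(f has_vector_derivative u) (at s within {0..T})" and s: "0 \<le> s" "s < T"
  shows "(\<lambda>n. clamped_quotient T f n s) \<longlonglongrightarrow> u"
proof -
  have "(\<lambda>n. 1 / real (Suc n)) \<longlonglongrightarrow> 0" by (rule LIMSEQ_inverse_real_of_nat[unfolded inverse_eq_divide])
  then have ev: "\<forall>\<^sub>F n in sequentially. 1 / real (Suc n) < T - s"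
    by (rule order_tendstoD) (use s in simp)
  have y: "filterlim (\<lambda>n. s + 1 / real (Suc n)) (at s within {0..T}) sequentially"
    unfolding filterlim_at
  proof
    show "\<forall>\<^sub>F n in sequentially. s + 1 / real (Suc n) \<in> {0..T} \<and> s + 1 / real (Suc n) \<noteq> s"
      using ev by eventually_elim (use s in auto)
    show "(\<lambda>n. s + 1 / real (Suc n)) \<longlonglongrightarrow> s"
      using tendsto_add[OF tendsto_const \<open>(\<lambda>n. 1 / real (Suc n)) \<longlonglongrightarrow> 0\<close>, of s] by simp
  qed
  have "((\<lambda>y. norm (f y - f s - (y - s) *\<^sub>R u) / norm (y - s)) \<longlongrightarrow> 0) (at s within {0..T})"
    using d unfolding has_vector_derivative_def has_derivative_iff_norm by simp
  from filterlim_compose[OF this y]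
  have l: "(\<lambda>n. norm (f (s + 1 / real (Suc n)) - f s - (1 / real (Suc n)) *\<^sub>R u) / (1 / real (Suc n))) \<longlonglongrightarrow> 0"
    by simp
  have "(\<lambda>n. clamped_quotient T f n s - u) \<longlonglongrightarrow> 0"
  proof (rule tendsto_norm_zero_cancel, rule Lim_transform_eventually[OF l])
    show "\<forall>\<^sub>F n in sequentially. norm (f (s + 1 / real (Suc n)) - f s - (1 / real (Suc n)) *\<^sub>R u) / (1 / real (Suc n))
        = norm (clamped_quotient T f n s - u)"
      using ev
    proof eventually_elim
      case (elim n)
      have "clamped_quotient T f n s - u
          = real (Suc n) *\<^sub>R (f (s + 1 / real (Suc n)) - f s - (1 / real (Suc n)) *\<^sub>R u)"
        unfolding clamped_quotient_def using elim by (simp add: min_def scaleR_right_diff_distrib)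
      then show ?case by (simp only: norm_scaleR) simp
    qed
  qed
  then show ?thesis by (simp add: LIM_zero_iff)
qed

lemma clamped_quotient_continuous:
  assumes "continuous_on {0..T} f"
  shows "continuous_on {0..T} (clamped_quotient T f n)"
  unfolding clamped_quotient_def[abs_def]
  by (intro continuous_intros assms continuous_on_compose2[OF assms]) auto

text \<open>
  The integral telescopes: up to the factor \<open>n+1\<close> it is the difference of the integrals of \<open>f\<close> over
  two intervals of length \<open>1/(n+1)\<close>, one at each end, and on the one beyond \<open>T\<close> the clamped function is
  constant.
\<close>

lemma clamped_quotient_integral_tendsto:
  assumes f: "L-lipschitz_on {0..T} f" and T: "0 < T"
  shows "(\<lambda>n. integral {0..T} (clamped_quotient T f n)) \<longlonglongrightarrow> f T - f 0"
proof -
  define F where "F s = f (max 0 (min T s))" for s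
  have cf: "continuous_on {0..T} f" using f by (rule lipschitz_on_continuous_on)
  have cF: "continuous_on S F" for S
    unfolding F_def[abs_def] by (intro continuous_on_compose2[OF cf] continuous_intros) (use T in auto)
  have iF: "F integrable_on {a..b}" for a b by (rule integrable_continuous_real[OF cF])
  have *: "integral {0..T} (clamped_quotient T f n) - (f T - f 0) =
      - (real (Suc n) *\<^sub>R integral {0..1 / real (Suc n)} (\<lambda>s. F s - f 0))" for n
  proof -
    let ?d = "1 / real (Suc n)"
    have "integral {0..T} (clamped_quotient T f n) =
       integral {0..T} (\<lambda>s. real (Suc n) *\<^sub>R ((F \<circ> (+) ?d) s - F s))"
      by (rule integral_cong) (auto simp: clamped_quotient_def F_def max_def min_def add.commute)
    also have "\<dots> = real (Suc n) *\<^sub>R (integral {0..T} (F \<circ> (+) ?d) - integral {0..T} F)"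
      using iF[of 0 T] by (subst integral_diff[symmetric])
        (auto intro!: integrable_continuous_real continuous_on_compose continuous_intros cF)
    also have "integral {0..T} (F \<circ> (+) ?d) = integral {?d..T + ?d} F"
      by (simp add: integral_shift_Icc_real)
    also have "\<dots> = integral {0..T + ?d} F - integral {0..?d} F"
      using Henstock_Kurzweil_Integration.integral_combine[where f=F and a=0 and c="?d" and b="T + ?d"] iF T by (simp add: algebra_simps)
    also have "integral {0..T + ?d} F = integral {0..T} F + integral {T..T + ?d} F"
      using Henstock_Kurzweil_Integration.integral_combine[where f=F and a=0 and c=T and b="T + ?d"] iF T by simp
    also have "integral {T..T + ?d} F = integral {T..T + ?d} (\<lambda>s. f T)"
      by (rule integral_cong) (use T in \<open>auto simp: F_def\<close>)
    also have "\<dots> = ?d *\<^sub>R f T" by simp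
    finally have 1: "integral {0..T} (clamped_quotient T f n) = f T - real (Suc n) *\<^sub>R integral {0..?d} F"
      by (simp add: algebra_simps)
    have 2: "integral {0..?d} (\<lambda>s. F s - f 0) = integral {0..?d} F - ?d *\<^sub>R f 0"
      using iF by (subst integral_diff) auto
    have 3: "real (Suc n) *\<^sub>R (?d *\<^sub>R f 0) = f 0"
      unfolding scaleR_scaleR by (simp del: of_nat_Suc)
    have h: "(x - y) - (x - z) = - (y - z)" for x y z :: 'a by simp
    show ?thesis unfolding 1 2 scaleR_right_diff_distrib 3 by (rule h)
  qed
  have bd: "norm (integral {0..T} (clamped_quotient T f n) - (f T - f 0)) \<le> L * (1 / real (Suc n))" for n
  proof -
    let ?d = "1 / real (Suc n)"
    have L: "L \<ge> 0" using f by (simp add: lipschitz_on_def)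
    have "norm (F s - f 0) \<le> L * ?d" if "s \<in> {0..?d}" for s
    proof -
      have m: "max 0 (min T s) \<in> {0..T}" "0 \<in> {0..T}" using T by auto
      have "norm (F s - f 0) \<le> L * \<bar>max 0 (min T s) - 0\<bar>"
        using lipschitz_onD[OF f m] unfolding F_def dist_norm real_norm_def .
      also have "\<dots> \<le> L * ?d" using that L T by (intro mult_left_mono) auto
      finally show ?thesis .
    qed
    moreover have "continuous_on {0..?d} (\<lambda>s. F s - f 0)"
      by (intro continuous_on_diff cF continuous_on_const)
    ultimately have "norm (integral {0..?d} (\<lambda>s. F s - f 0)) \<le> L * ?d * (?d - 0)"
      using integral_bound[of 0 ?d "\<lambda>s. F s - f 0" "L * ?d"] by simp
    then have "real (Suc n) * norm (integral {0..?d} (\<lambda>s. F s - f 0)) \<le> real (Suc n) * (L * ?d * (?d - 0))"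
      by (intro mult_left_mono) auto
    then show ?thesis unfolding * norm_minus_cancel norm_scaleR by simp
  qed
  have l: "(\<lambda>n. L * (1 / real (Suc n))) \<longlonglongrightarrow> 0"
    using tendsto_mult[OF tendsto_const[of L] LIMSEQ_inverse_real_of_nat] by (simp add: inverse_eq_divide)
  have "(\<lambda>n. integral {0..T} (clamped_quotient T f n) - (f T - f 0)) \<longlonglongrightarrow> 0"
    by (rule Lim_null_comparison[OF _ l]) (use bd in auto)
  then show ?thesis by (simp add: LIM_zero_iff)
qed

text \<open>
  The fundamental theorem of calculus for Lipschitz functions: the difference quotients are bounded
  by the Lipschitz constant and converge almost everywhere to the derivative, while their integrals
  converge to \<open>f T - f 0\<close>.
\<close>

lemma lip_deriv_has_integral:
  assumes f: "lip_deriv T f u"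
  shows "(u has_integral f T - f 0) {0..T}"
proof -
  from f obtain L B N where F: "0 < T" "L-lipschitz_on {0..T} f" "negligible N"
    "\<And>s. s \<in> {0..T} - N \<Longrightarrow> (f has_vector_derivative u s) (at s within {0..T})"
    by (elim lip_derivE) blast
  have M: "negligible (insert T N)" using F(3) by simp
  have lim: "(\<lambda>n. clamped_quotient T f n s) \<longlonglongrightarrow> u s" if "s \<in> {0..T} - insert T N" for s
    using clamped_quotient_tendsto[OF F(4)[of s]] that by auto
  note conv = bounded_convergence_interval[OF M
      integrable_continuous_real[OF clamped_quotient_continuous[OF lip_deriv_continuous[OF f]]]
      clamped_quotient_le[OF F(2)] lim]
  have "integral {0..T} u = f T - f 0"
    using LIMSEQ_unique[OF conv(2) clamped_quotient_integral_tendsto[OF F(2,1)]] .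
  with conv(1) show ?thesis by (simp add: has_integral_iff)
qed

lemma lip_deriv_absolutely_integrable:
  assumes f: "lip_deriv T f u"
  shows "u absolutely_integrable_on {0..T}"
proof -
  from f obtain B where B: "\<And>s. s \<in> {0..T} \<Longrightarrow> norm (u s) \<le> B" by (elim lip_derivE) blast
  show ?thesis
    by (rule absolutely_integrable_integrable_bound[OF _ _ integrable_const_ivl])
       (use B lip_deriv_has_integral[OF f] in auto)
qed

lemma lip_deriv_bilinear_absolutely_integrable:
  fixes h :: "'a::euclidean_space \<Rightarrow> 'b::euclidean_space \<Rightarrow> 'c::euclidean_space"
  assumes h: "bounded_bilinear h" and f: "lip_deriv T f u" and g: "lip_deriv T g v"
  shows "(\<lambda>s. h (u s) (v s)) absolutely_integrable_on {0..T}"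
proof (rule absolutely_integrable_bounded_measurable_product[where h=h and f=u and g=v])
  show "bilinear h" using h by (simp add: bilinear_conv_bounded_bilinear)
  show "u \<in> borel_measurable (lebesgue_on {0..T})"
    using lip_deriv_absolutely_integrable[OF f] by (simp add: absolutely_integrable_measurable)
  show "bounded (u ` {0..T})" using f by (simp add: lip_deriv_def)
  show "v absolutely_integrable_on {0..T}" by (rule lip_deriv_absolutely_integrable[OF g])
qed simp

lemma lip_deriv_continuous_bilinear_absolutely_integrable:
  fixes h :: "'a::euclidean_space \<Rightarrow> 'b::euclidean_space \<Rightarrow> 'c::euclidean_space"
  assumes h: "bounded_bilinear h" and c: "continuous_on {0..T} c" and f: "lip_deriv T f u"
  shows "(\<lambda>s. h (c s) (u s)) absolutely_integrable_on {0..T}"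
proof (rule absolutely_integrable_bounded_measurable_product[where h=h and f=c and g=u])
  show "bilinear h" using h by (simp add: bilinear_conv_bounded_bilinear)
  show "c \<in> borel_measurable (lebesgue_on {0..T})"
    using c by (intro continuous_imp_measurable_on_sets_lebesgue) auto
  show "bounded (c ` {0..T})" using c by (simp add: compact_continuous_image compact_imp_bounded)
  show "u absolutely_integrable_on {0..T}" by (rule lip_deriv_absolutely_integrable[OF f])
qed simp

section \<open>The Poincare inequality on the circle for high frequencies\<close>

lemma cis_has_vector_derivative:
  "((\<lambda>s. cis (c * s)) has_vector_derivative \<i> * of_real c * cis (c * s)) (at s within S)"
proof -
  have "((\<lambda>z. exp (\<i> * of_real c * z)) has_field_derivative \<i> * of_real c * exp (\<i> * of_real c * of_real s))
      (at (of_real s))"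
    by (auto intro!: derivative_eq_intros)
  from has_vector_derivative_real_field[OF this] show ?thesis
    by (simp add: cis_conv_exp mult.assoc)
qed

lemma has_integral_cis:
  "((\<lambda>s. cis (real_of_int k * s)) has_integral (if k = 0 then complex_of_real (2 * pi) else 0)) {0..2*pi}"
proof (cases "k = 0")
  case True
  then show ?thesis using has_integral_const_real[of "1::complex" 0 "2*pi"] by (simp add: scaleR_conv_of_real)
next
  case False
  have "((\<lambda>s. cis (real_of_int k * s)) has_integral
      cis (real_of_int k * (2*pi)) / (\<i> * of_int k) - cis (real_of_int k * 0) / (\<i> * of_int k)) {0..2*pi}"
  proof (rule fundamental_theorem_of_calculus)
    fix s :: real
    show "((\<lambda>x. cis (real_of_int k * x) / (\<i> * of_int k)) has_vector_derivative
       cis (real_of_int k * s)) (at s within {0..2*pi})"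
      using has_vector_derivative_divide[OF cis_has_vector_derivative[of "real_of_int k" s "{0..2*pi}"], of "\<i> * of_int k"] False by simp
  qed simp
  moreover have "cis (real_of_int k * (2*pi)) = 1"
    using cis_multiple_2pi[of "real_of_int k"] by (simp add: mult_ac)
  ultimately show ?thesis using False by simp
qed

text \<open>
  Adding one monomial at a time makes closure under sums and products a matter of induction;
  repeated frequencies are merged only in \<open>trig_poly_sum_form\<close>.
\<close>

inductive trig_poly :: "(real \<Rightarrow> complex) \<Rightarrow> bool" where
  zero: "trig_poly (\<lambda>s. 0)"
| add_monomial: "trig_poly p \<Longrightarrow> trig_poly (\<lambda>s. p s + c * cis (real_of_int k * s))"

lemma trig_poly_sum_form:
  assumes "trig_poly p"
  shows "\<exists>K a. finite K \<and> p = (\<lambda>s. \<Sum>k\<in>K. a k * cis (real_of_int k * s))"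
  using assms
proof induction
  case zero
  show ?case by (intro exI[of _ "{}"]) auto
next
  case (add_monomial p c k)
  then obtain K a where K: "finite K" "p = (\<lambda>s. \<Sum>k\<in>K. a k * cis (real_of_int k * s))" by blast
  define a' where "a' j = (if j \<in> K then a j else 0) + (if j = k then c else 0)" for j
  have "p s + c * cis (real_of_int k * s) = (\<Sum>j\<in>insert k K. a' j * cis (real_of_int j * s))" for s
  proof -
    have "(\<Sum>j\<in>insert k K. a' j * cis (real_of_int j * s)) =
      (\<Sum>j\<in>insert k K. (if j \<in> K then a j * cis (real_of_int j * s) else 0)) +
      (\<Sum>j\<in>insert k K. (if j = k then c * cis (real_of_int j * s) else 0))"
      unfolding sum.distrib[symmetric] by (rule sum.cong) (auto simp: a'_def distrib_right)
    also have "(\<Sum>j\<in>insert k K. (if j \<in> K then a j * cis (real_of_int j * s) else 0)) = p s"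
      unfolding K(2) using K(1) by (subst sum.mono_neutral_right[of "insert k K" K]) auto
    also have "(\<Sum>j\<in>insert k K. (if j = k then c * cis (real_of_int j * s) else 0)) = c * cis (real_of_int k * s)"
      using K(1) by (subst sum.delta) auto
    finally show ?thesis by simp
  qed
  then show ?case using K(1) by blast
qed

lemma trig_poly_add: "trig_poly q \<Longrightarrow> trig_poly p \<Longrightarrow> trig_poly (\<lambda>s. p s + q s)"
proof (induction rule: trig_poly.induct)
  case (add_monomial q c k)
  then have "trig_poly (\<lambda>s. (p s + q s) + c * cis (real_of_int k * s))"
    by (intro trig_poly.add_monomial)
  then show ?case by (simp add: add.assoc)
qed simp

lemma trig_poly_monomial: "trig_poly (\<lambda>s. c * cis (real_of_int k * s))"
  using trig_poly.add_monomial[OF trig_poly.zero, of c k] by simp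

lemma trig_poly_mult_monomial: "trig_poly p \<Longrightarrow> trig_poly (\<lambda>s. p s * (c * cis (real_of_int k * s)))"
proof (induction rule: trig_poly.induct)
  case (add_monomial p b j)
  have "trig_poly (\<lambda>s. p s * (c * cis (real_of_int k * s)) + (b * c) * cis (real_of_int (j + k) * s))"
    by (intro trig_poly.add_monomial add_monomial.IH)
  moreover have "p s * (c * cis (real_of_int k * s)) + (b * c) * cis (real_of_int (j + k) * s)
    = (p s + b * cis (real_of_int j * s)) * (c * cis (real_of_int k * s))" for s
  proof -
    have "cis (real_of_int (j + k) * s) = cis (real_of_int j * s) * cis (real_of_int k * s)"
      by (simp add: cis_mult distrib_right)
    then show ?thesis by (simp add: algebra_simps)
  qed
  ultimately show ?case by simp
qed (simp add: trig_poly.zero)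

lemma trig_poly_mult: "trig_poly q \<Longrightarrow> trig_poly p \<Longrightarrow> trig_poly (\<lambda>s. p s * q s)"
proof (induction rule: trig_poly.induct)
  case (add_monomial q c k)
  then have "trig_poly (\<lambda>s. p s * (c * cis (real_of_int k * s)) + p s * q s)"
    by (intro trig_poly_add trig_poly_mult_monomial)
  then show ?case by (simp add: distrib_left add.commute)
qed (simp add: trig_poly.zero)

lemma trig_poly_polynomial_function:
  "real_polynomial_function g \<Longrightarrow> trig_poly (\<lambda>s. of_real (g (cis s)))"
proof (induction rule: real_polynomial_function.induct)
  case (linear f)
  interpret bounded_linear f by fact
  let ?a = "complex_of_real (f 1)" and ?b = "complex_of_real (f \<i>)"
  have "complex_of_real (f (cis s)) = (?a - \<i> * ?b) / 2 * cis (real_of_int 1 * s) + (?a + \<i> * ?b) / 2 * cis (real_of_int (-1) * s)"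
    for s
  proof -
    have "cis s = cos s *\<^sub>R 1 + sin s *\<^sub>R \<i>" by (simp add: complex_eq_iff)
    then have "f (cis s) = cos s * f 1 + sin s * f \<i>" by (simp add: add scaleR)
    then show ?thesis by (simp add: complex_eq_iff field_simps)
  qed
  then show ?case
    using trig_poly_add[OF trig_poly_monomial trig_poly_monomial, of "(?a - \<i> * ?b) / 2" 1 "(?a + \<i> * ?b) / 2" "-1"]
    by simp
next
  case (const c)
  show ?case using trig_poly_monomial[of "complex_of_real c" 0] by simp
next
  case (add f g) then show ?case using trig_poly_add by auto
next
  case (mult f g) then show ?case using trig_poly_mult by auto
qed

text \<open>
  The function is transported to the unit circle, where it is continuous because the circle carries
  the quotient topology of the closed interval. There Stone--Weierstrass provides a polynomial in
  the coordinates, which is a trigonometric polynomial in the angle.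
\<close>

lemma trig_poly_dense:
  assumes f: "continuous_on {0..2*pi} f" and per: "f 0 = f (2*pi)" and e: "e > 0"
  obtains K a where "finite K"
    "\<And>s. s \<in> {0..2*pi} \<Longrightarrow> norm (complex_of_real (f s) - (\<Sum>k\<in>K. a k * cis (real_of_int k * s))) < e"
proof -
  define F where "F z = f (Arg2pi z)" for z
  have Fcis: "F (cis s) = f s" if "s \<in> {0..2*pi}" for s
  proof (cases "s = 2*pi")
    case True
    then show ?thesis using per Arg2pi_of_real[of 1] by (simp add: F_def)
  next
    case False
    then have "Arg2pi (cis s) = s" using that by (intro Arg2pi_unique[of 1]) (auto simp: cis_conv_exp)
    then show ?thesis by (simp add: F_def)
  qed
  have S: "sphere (0::complex) 1 = cis ` {0..2*pi}"
  proof
    show "sphere 0 1 \<subseteq> cis ` {0..2*pi}"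
    proof
      fix z :: complex assume "z \<in> sphere 0 1"
      then have "z = cis (Arg2pi z)" using Arg2pi_eq[of z] by (simp add: cis_conv_exp)
      then show "z \<in> cis ` {0..2*pi}" using Arg2pi_ge_0[of z] Arg2pi_lt_2pi[of z]
        by (intro image_eqI[of _ _ "Arg2pi z"]) auto
    qed
  qed auto
  have "continuous_on (sphere 0 1) F"
  proof (subst continuous_on_closed_vimage)
    show "closed (sphere (0::complex) 1)" by simp
    show "\<forall>B. closed B \<longrightarrow> closed (F -` B \<inter> sphere 0 1)"
    proof (intro allI impI)
      fix B :: "real set" assume "closed B"
      then have "closed (f -` B \<inter> {0..2*pi})"
        using f by (simp add: continuous_on_closed_vimage)
      then have "compact (f -` B \<inter> {0..2*pi})"
        by (metis Int_commute Int_left_absorb compact_Icc compact_Int_closed)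
      then have "compact (cis ` (f -` B \<inter> {0..2*pi}))"
        by (intro compact_continuous_image continuous_intros)
      moreover have "cis ` (f -` B \<inter> {0..2*pi}) = F -` B \<inter> sphere 0 1"
        unfolding S using Fcis by auto
      ultimately show "closed (F -` B \<inter> sphere 0 1)" by (simp add: compact_imp_closed)
    qed
  qed
  then obtain g where g: "real_polynomial_function g" "\<And>z. z \<in> sphere 0 1 \<Longrightarrow> \<bar>F z - g z\<bar> < e"
    using Stone_Weierstrass_real_polynomial_function[of "sphere 0 1" F e] e by auto
  obtain K a where K: "finite K" "(\<lambda>s. complex_of_real (g (cis s))) = (\<lambda>s. \<Sum>k\<in>K. a k * cis (real_of_int k * s))"
    using trig_poly_sum_form[OF trig_poly_polynomial_function[OF g(1)]] by blast
  have "norm (complex_of_real (f s) - (\<Sum>k\<in>K. a k * cis (real_of_int k * s))) < e" if "s \<in> {0..2*pi}" for s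
  proof -
    have "(\<Sum>k\<in>K. a k * cis (real_of_int k * s)) = complex_of_real (g (cis s))"
      using fun_cong[OF K(2), of s] by simp
    moreover have "\<bar>f s - g (cis s)\<bar> < e" using g(2)[of "cis s"] Fcis[OF that] by simp
    ultimately show ?thesis by (metis norm_of_real of_real_diff)
  qed
  then show thesis using that K(1) by blast
qed

definition fourier_coeff :: "(real \<Rightarrow> real) \<Rightarrow> int \<Rightarrow> complex" where
  "fourier_coeff f k = integral {0..2*pi} (\<lambda>s. complex_of_real (f s) * cis (- real_of_int k * s))"

lemma fourier_coeff_has_integral:
  assumes "f absolutely_integrable_on {0..2*pi}"
  shows "((\<lambda>s. complex_of_real (f s) * cis (- real_of_int k * s)) has_integral fourier_coeff f k) {0..2*pi}"
proof -
  have "(\<lambda>s. cis (- real_of_int k * s) * complex_of_real (f s)) absolutely_integrable_on {0..2*pi}"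
  proof (rule absolutely_integrable_bounded_measurable_product[where h="(*)"])
    show "bilinear ((*) :: complex \<Rightarrow> complex \<Rightarrow> complex)"
      by (simp add: bilinear_conv_bounded_bilinear bounded_bilinear_mult)
    show "(\<lambda>s. cis (- real_of_int k * s)) \<in> borel_measurable (lebesgue_on {0..2*pi})"
      by (intro continuous_imp_measurable_on_sets_lebesgue continuous_intros) auto
    show "bounded ((\<lambda>s. cis (- real_of_int k * s)) ` {0..2*pi})"
      by (auto simp: bounded_iff intro!: exI[of _ 1])
    show "(\<lambda>s. complex_of_real (f s)) absolutely_integrable_on {0..2*pi}"
      using absolutely_integrable_linear[OF assms bounded_linear_of_real] by (simp add: o_def)
  qed simp
  then show ?thesis
    unfolding fourier_coeff_def by (simp add: mult.commute set_lebesgue_integral_eq_integral(1) integrable_integral)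
qed

text \<open>
  Completing the square in the coefficients. With the Fourier coefficients for \<open>a\<close> it yields Bessel's
  inequality; for other \<open>a\<close> it shows that no trigonometric polynomial with the same frequencies is
  closer to \<open>f\<close> than the partial Fourier sum.
\<close>

lemma fourier_distance:
  assumes f: "f absolutely_integrable_on {0..2*pi}" and f2: "(\<lambda>s. (f s)\<^sup>2) integrable_on {0..2*pi}"
    and K: "finite K"
  shows "((\<lambda>s. (norm (complex_of_real (f s) - (\<Sum>k\<in>K. a k * cis (real_of_int k * s))))\<^sup>2) has_integral
     integral {0..2*pi} (\<lambda>s. (f s)\<^sup>2) - (\<Sum>k\<in>K. (norm (fourier_coeff f k))\<^sup>2) / (2 * pi)
       + 2 * pi * (\<Sum>k\<in>K. (norm (a k - fourier_coeff f k / (2 * pi)))\<^sup>2)) {0..2*pi}"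
proof -
  define p where "p s = (\<Sum>k\<in>K. a k * cis (real_of_int k * s))" for s
  let ?c = "fourier_coeff f"
  have cnj_p: "cnj (p s) = (\<Sum>k\<in>K. cnj (a k) * cis (- real_of_int k * s))" for s
    by (simp add: p_def cis_cnj)
  have 1: "((\<lambda>s. complex_of_real (f s) * cnj (p s)) has_integral (\<Sum>k\<in>K. cnj (a k) * ?c k)) {0..2*pi}"
  proof -
    have "((\<lambda>s. \<Sum>k\<in>K. cnj (a k) * (complex_of_real (f s) * cis (- real_of_int k * s))) has_integral
       (\<Sum>k\<in>K. cnj (a k) * ?c k)) {0..2*pi}"
      by (intro has_integral_sum K has_integral_mult_right fourier_coeff_has_integral f)
    then show ?thesis unfolding cnj_p sum_distrib_left by (simp add: mult_ac)
  qed
  have 2: "((\<lambda>s. p s * cnj (p s)) has_integral (\<Sum>k\<in>K. complex_of_real (2*pi) * (a k * cnj (a k)))) {0..2*pi}"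
  proof -
    have "((\<lambda>s. \<Sum>k\<in>K. \<Sum>l\<in>K. (a k * cnj (a l)) * cis (real_of_int (k - l) * s)) has_integral
       (\<Sum>k\<in>K. \<Sum>l\<in>K. (a k * cnj (a l)) * (if k - l = 0 then complex_of_real (2*pi) else 0))) {0..2*pi}"
      by (intro has_integral_sum K has_integral_mult_right has_integral_cis)
    moreover have "(\<Sum>k\<in>K. \<Sum>l\<in>K. (a k * cnj (a l)) * cis (real_of_int (k - l) * s)) = p s * cnj (p s)" for s
    proof -
      have "cis (real_of_int (k - l) * s) = cis (real_of_int k * s) * cis (- real_of_int l * s)" for k l
        by (simp add: cis_mult left_diff_distrib)
      then show ?thesis
        unfolding cnj_p unfolding p_def sum_product by (intro sum.cong refl) (simp add: mult_ac)
    qed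
    moreover have "(\<Sum>k\<in>K. \<Sum>l\<in>K. (a k * cnj (a l)) * (if k - l = 0 then complex_of_real (2*pi) else 0))
      = (\<Sum>k\<in>K. complex_of_real (2*pi) * (a k * cnj (a k)))"
    proof (rule sum.cong[OF refl])
      fix k assume k: "k \<in> K"
      have "(\<Sum>l\<in>K. (a k * cnj (a l)) * (if k - l = 0 then complex_of_real (2*pi) else 0))
        = (\<Sum>l\<in>K. if k = l then complex_of_real (2*pi) * (a k * cnj (a l)) else 0)"
        by (intro sum.cong) auto
      then show "(\<Sum>l\<in>K. (a k * cnj (a l)) * (if k - l = 0 then complex_of_real (2*pi) else 0)) = complex_of_real (2*pi) * (a k * cnj (a k))"
        using K k by (simp add: sum.delta)
    qed
    ultimately show ?thesis by simp
  qed
  have 3: "((\<lambda>s. (f s)\<^sup>2 - 2 * Re (complex_of_real (f s) * cnj (p s)) + Re (p s * cnj (p s))) has_integral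
    integral {0..2*pi} (\<lambda>s. (f s)\<^sup>2) - 2 * Re (\<Sum>k\<in>K. cnj (a k) * ?c k)
      + Re (\<Sum>k\<in>K. complex_of_real (2*pi) * (a k * cnj (a k)))) {0..2*pi}"
    using has_integral_linear[OF 1 bounded_linear_Re] has_integral_linear[OF 2 bounded_linear_Re]
      integrable_integral[OF f2]
    by (intro has_integral_add has_integral_diff has_integral_mult_right) (auto simp: o_def)
  have 4: "(norm (complex_of_real (f s) - p s))\<^sup>2 = (f s)\<^sup>2 - 2 * Re (complex_of_real (f s) * cnj (p s)) + Re (p s * cnj (p s))"
    for s unfolding cmod_power2 by (simp add: power2_eq_square algebra_simps)
  have 5: "(\<Sum>k\<in>K. 2 * Re (cnj (a k) * ?c k)) =
      (\<Sum>k\<in>K. 2 * pi * (norm (a k))\<^sup>2) + (\<Sum>k\<in>K. (norm (?c k))\<^sup>2 / (2 * pi))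
       - (\<Sum>k\<in>K. 2 * pi * (norm (a k - ?c k / (2 * pi)))\<^sup>2)"
    unfolding sum.distrib[symmetric] sum_subtractf[symmetric]
    unfolding cmod_power2 by (intro sum.cong refl) (simp add: power2_eq_square field_simps)
  have 6: "Re (complex_of_real (2*pi) * (a k * cnj (a k))) = 2 * pi * (norm (a k))\<^sup>2" for k
    unfolding cmod_power2 by (simp add: power2_eq_square algebra_simps)
  have 7: "integral {0..2*pi} (\<lambda>s. (f s)\<^sup>2) - 2 * Re (\<Sum>k\<in>K. cnj (a k) * ?c k)
      + Re (\<Sum>k\<in>K. complex_of_real (2*pi) * (a k * cnj (a k))) =
    integral {0..2*pi} (\<lambda>s. (f s)\<^sup>2) - (\<Sum>k\<in>K. (norm (fourier_coeff f k))\<^sup>2) / (2 * pi)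
       + 2 * pi * (\<Sum>k\<in>K. (norm (a k - fourier_coeff f k / (2 * pi)))\<^sup>2)"
    using 5 unfolding Re_sum 6 sum_distrib_left sum_divide_distrib by simp
  show ?thesis using 3 unfolding 4[symmetric] 7 unfolding p_def .
qed

lemma bessel_inequality:
  assumes "f absolutely_integrable_on {0..2*pi}" "(\<lambda>s. (f s)\<^sup>2) integrable_on {0..2*pi}" "finite K"
  shows "(\<Sum>k\<in>K. (norm (fourier_coeff f k))\<^sup>2) \<le> 2 * pi * integral {0..2*pi} (\<lambda>s. (f s)\<^sup>2)"
  using has_integral_nonneg[OF fourier_distance[OF assms, of "\<lambda>k. fourier_coeff f k / (2*pi)"]]
  by (simp add: field_simps)

lemma fourier_coeff_derivative:
  assumes f: "lip_deriv (2*pi) f h" and per: "f 0 = f (2*pi)"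
  shows "fourier_coeff h k = \<i> * of_int k * fourier_coeff f k"
proof -
  have c: "continuous_on {0..2*pi} f" using lip_deriv_continuous[OF f] .
  have fa: "f absolutely_integrable_on {0..2*pi}" by (rule absolutely_integrable_continuous_real[OF c])
  have ha: "h absolutely_integrable_on {0..2*pi}" by (rule lip_deriv_absolutely_integrable[OF f])
  have l1: "lip_deriv (2*pi) (\<lambda>s. complex_of_real (f s)) (\<lambda>s. complex_of_real (h s))"
    by (rule lip_deriv_linear[OF bounded_linear_of_real f])
  have d: "((\<lambda>s. cis (- real_of_int k * s)) has_vector_derivative - (\<i> * of_int k) * cis (- real_of_int k * s)) (at s within S)" for s S
    using cis_has_vector_derivative[of "- real_of_int k" s S] by simp
  have l2: "lip_deriv (2*pi) (\<lambda>s. cis (- real_of_int k * s)) (\<lambda>s. - (\<i> * of_int k) * cis (- real_of_int k * s))"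
    by (rule lip_deriv_C1[OF _ d], simp) (intro continuous_on_mult continuous_on_cis continuous_on_const continuous_on_id)
  have "((\<lambda>s. complex_of_real (f s) * (- (\<i> * of_int k) * cis (- real_of_int k * s)) + complex_of_real (h s) * cis (- real_of_int k * s))
    has_integral complex_of_real (f (2*pi)) * cis (- real_of_int k * (2*pi)) - complex_of_real (f 0) * cis (- real_of_int k * 0)) {0..2*pi}"
    by (rule lip_deriv_has_integral[OF lip_deriv_bilinear[OF bounded_bilinear_mult l1 l2]])
  moreover have "cis (- real_of_int k * (2*pi)) = 1"
    using cis_multiple_2pi[of "- real_of_int k"] by (simp add: mult_ac)
  ultimately have A: "((\<lambda>s. complex_of_real (f s) * (- (\<i> * of_int k) * cis (- real_of_int k * s)) + complex_of_real (h s) * cis (- real_of_int k * s))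
    has_integral 0) {0..2*pi}" using per by simp
  have B: "((\<lambda>s. (- (\<i> * of_int k)) * (complex_of_real (f s) * cis (- real_of_int k * s)) + complex_of_real (h s) * cis (- real_of_int k * s))
    has_integral (- (\<i> * of_int k)) * fourier_coeff f k + fourier_coeff h k) {0..2*pi}"
    by (intro has_integral_add has_integral_mult_right fourier_coeff_has_integral fa ha)
  have E: "(\<lambda>s. complex_of_real (f s) * (- (\<i> * of_int k) * cis (- real_of_int k * s)) + complex_of_real (h s) * cis (- real_of_int k * s))
    = (\<lambda>s. (- (\<i> * of_int k)) * (complex_of_real (f s) * cis (- real_of_int k * s)) + complex_of_real (h s) * cis (- real_of_int k * s))"
    by (simp add: fun_eq_iff mult_ac)
  have "(- (\<i> * of_int k)) * fourier_coeff f k + fourier_coeff h k = 0"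
    using has_integral_unique[OF B A[unfolded E]] .
  then show ?thesis by (simp add: algebra_simps)
qed

text \<open>
  Differentiation multiplies the \<open>k\<close>-th Fourier coefficient by \<open>i k\<close>, and all frequencies that occur
  have modulus at least \<open>n\<close>. Only finitely many coefficients are used at a time: a trigonometric
  polynomial close to \<open>f\<close> bounds the norm of \<open>f\<close> by a finite sum of coefficients, and Bessel's
  inequality bounds the corresponding sum for the derivative.
\<close>

lemma poincare_scalar:
  assumes f: "lip_deriv (2*pi) f h" and per: "f 0 = f (2*pi)"
    and low: "\<And>k. \<bar>k\<bar> < int n \<Longrightarrow> fourier_coeff f k = 0"
  shows "(real n)\<^sup>2 * integral {0..2*pi} (\<lambda>s. (f s)\<^sup>2) \<le> integral {0..2*pi} (\<lambda>s. (h s)\<^sup>2)"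
proof -
  have c: "continuous_on {0..2*pi} f" using lip_deriv_continuous[OF f] .
  have fa: "f absolutely_integrable_on {0..2*pi}" by (rule absolutely_integrable_continuous_real[OF c])
  have f2: "(\<lambda>s. (f s)\<^sup>2) integrable_on {0..2*pi}"
    by (intro integrable_continuous_real continuous_intros c)
  have ha: "h absolutely_integrable_on {0..2*pi}" by (rule lip_deriv_absolutely_integrable[OF f])
  have h2: "(\<lambda>s. (h s)\<^sup>2) integrable_on {0..2*pi}"
    using lip_deriv_bilinear_absolutely_integrable[OF bounded_bilinear_mult f f]
    by (simp add: power2_eq_square set_lebesgue_integral_eq_integral(1))
  let ?I = "integral {0..2*pi} (\<lambda>s. (f s)\<^sup>2)" and ?J = "integral {0..2*pi} (\<lambda>s. (h s)\<^sup>2)"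
  have main: "(real n)\<^sup>2 * (?I - 2 * pi * e\<^sup>2) \<le> ?J" if e: "e > 0" for e
  proof -
    obtain K a where K: "finite K"
      "\<And>s. s \<in> {0..2*pi} \<Longrightarrow> norm (complex_of_real (f s) - (\<Sum>k\<in>K. a k * cis (real_of_int k * s))) < e"
      using trig_poly_dense[OF c per e] by blast
    let ?S = "\<Sum>k\<in>K. (norm (fourier_coeff f k))\<^sup>2"
    have "?I - ?S / (2 * pi) \<le> ?I - ?S / (2 * pi) + 2 * pi * (\<Sum>k\<in>K. (norm (a k - fourier_coeff f k / (2 * pi)))\<^sup>2)"
      by (simp add: sum_nonneg)
    also have "\<dots> \<le> e\<^sup>2 * (2 * pi)"
    proof (rule has_integral_le[OF fourier_distance[OF fa f2 K(1), of a]])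
      show "((\<lambda>s. e\<^sup>2) has_integral e\<^sup>2 * (2 * pi)) {0..2*pi}"
        using has_integral_const_real[of "e\<^sup>2" 0 "2*pi"] by (simp add: mult.commute)
      show "(norm (complex_of_real (f s) - (\<Sum>k\<in>K. a k * cis (real_of_int k * s))))\<^sup>2 \<le> e\<^sup>2"
        if "s \<in> {0..2*pi}" for s
        by (rule power_mono[OF less_imp_le[OF K(2)[OF that]]]) simp
    qed
    finally have 1: "?I - 2 * pi * e\<^sup>2 \<le> ?S / (2 * pi)" by (simp add: mult_ac)
    have "(real n)\<^sup>2 * ?S \<le> (\<Sum>k\<in>K. (norm (fourier_coeff h k))\<^sup>2)"
      unfolding sum_distrib_left
    proof (rule sum_mono)
      fix k assume "k \<in> K"
      show "(real n)\<^sup>2 * (norm (fourier_coeff f k))\<^sup>2 \<le> (norm (fourier_coeff h k))\<^sup>2"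
      proof (cases "\<bar>k\<bar> < int n")
        case True then show ?thesis using low by simp
      next
        case False
        then have "real n \<le> \<bar>real_of_int k\<bar>" by linarith
        then have "real n * norm (fourier_coeff f k) \<le> \<bar>real_of_int k\<bar> * norm (fourier_coeff f k)"
          by (intro mult_right_mono) auto
        then show ?thesis unfolding fourier_coeff_derivative[OF f per] norm_mult
          by (simp add: power_mult_distrib[symmetric] power_mono)
      qed
    qed
    also have "\<dots> \<le> 2 * pi * ?J" by (rule bessel_inequality[OF ha h2 K(1)])
    finally have "(real n)\<^sup>2 * ?S / (2 * pi) \<le> ?J" by (simp add: field_simps)
    moreover have "(real n)\<^sup>2 * (?I - 2 * pi * e\<^sup>2) \<le> (real n)\<^sup>2 * (?S / (2 * pi))"
      by (intro mult_left_mono 1) auto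
    ultimately show ?thesis by simp
  qed
  have "((\<lambda>e. (real n)\<^sup>2 * (?I - 2 * pi * e\<^sup>2)) \<longlongrightarrow> (real n)\<^sup>2 * (?I - 2 * pi * 0\<^sup>2)) (at_right 0)"
    by (intro tendsto_intros)
  then have "(real n)\<^sup>2 * (?I - 2 * pi * 0\<^sup>2) \<le> ?J"
    by (rule tendsto_upperbound) (auto simp: eventually_at_right_less intro!: eventually_mono[OF eventually_at_right_less[of 0]] main)
  then show ?thesis by simp
qed

text \<open>
  The vector-valued form, with the vanishing of the low frequencies expressed by sines and cosines.
\<close>

lemma poincare:
  fixes f :: "real \<Rightarrow> 'a::euclidean_space"
  assumes f: "lip_deriv (2*pi) f h" and per: "f 0 = f (2*pi)"
    and low: "\<And>k. k < n \<Longrightarrow> ((\<lambda>s. cos (real k * s) *\<^sub>R f s) has_integral 0) {0..2*pi}"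
             "\<And>k. k < n \<Longrightarrow> ((\<lambda>s. sin (real k * s) *\<^sub>R f s) has_integral 0) {0..2*pi}"
  shows "(real n)\<^sup>2 * integral {0..2*pi} (\<lambda>s. (norm (f s))\<^sup>2) \<le> integral {0..2*pi} (\<lambda>s. (norm (h s))\<^sup>2)"
proof -
  have c: "continuous_on {0..2*pi} f" using lip_deriv_continuous[OF f] .
  have lb: "lip_deriv (2*pi) (\<lambda>s. f s \<bullet> b) (\<lambda>s. h s \<bullet> b)" for b
    by (rule lip_deriv_linear[OF bounded_linear_inner_left f])
  have h2: "(\<lambda>s. (h s \<bullet> b)\<^sup>2) integrable_on {0..2*pi}" for b
    using lip_deriv_bilinear_absolutely_integrable[OF bounded_bilinear_mult lb lb]
    by (simp add: power2_eq_square set_lebesgue_integral_eq_integral(1))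
  have f2: "(\<lambda>s. (f s \<bullet> b)\<^sup>2) integrable_on {0..2*pi}" for b
    by (intro integrable_continuous_real continuous_intros c)
  have sq: "(norm x)\<^sup>2 = (\<Sum>b\<in>Basis. (x \<bullet> b)\<^sup>2)" for x :: 'a
    unfolding power2_norm_eq_inner by (subst euclidean_inner) (simp add: power2_eq_square)
  have "(real n)\<^sup>2 * integral {0..2*pi} (\<lambda>s. (f s \<bullet> b)\<^sup>2) \<le> integral {0..2*pi} (\<lambda>s. (h s \<bullet> b)\<^sup>2)" for b
  proof (rule poincare_scalar[OF lb])
    show "f 0 \<bullet> b = f (2*pi) \<bullet> b" using per by simp
    fix k :: int assume k: "\<bar>k\<bar> < int n"
    have "nat \<bar>k\<bar> < n" using k by linarith
    note l = has_integral_linear[OF low(1)[OF this] bounded_linear_inner_left[of b]]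
             has_integral_linear[OF low(2)[OF this] bounded_linear_inner_left[of b]]
    have "((\<lambda>s. (cos (real (nat \<bar>k\<bar>) * s) *\<^sub>R f s) \<bullet> b - complex_of_real (of_int (sgn k)) * \<i> * of_real ((sin (real (nat \<bar>k\<bar>) * s) *\<^sub>R f s) \<bullet> b)) has_integral
       of_real (0 \<bullet> b) - complex_of_real (of_int (sgn k)) * \<i> * of_real (0 \<bullet> b)) {0..2*pi}"
      by (intro has_integral_diff has_integral_mult_right has_integral_of_real l[unfolded o_def])
    moreover have "(cos (real (nat \<bar>k\<bar>) * s) *\<^sub>R f s) \<bullet> b - complex_of_real (of_int (sgn k)) * \<i> * of_real ((sin (real (nat \<bar>k\<bar>) * s) *\<^sub>R f s) \<bullet> b)
       = complex_of_real (f s \<bullet> b) * cis (- real_of_int k * s)" for s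
      by (cases k "0::int" rule: linorder_cases) (auto simp: complex_eq_iff)
    ultimately show "fourier_coeff (\<lambda>s. f s \<bullet> b) k = 0"
      unfolding fourier_coeff_def by (intro integral_unique) simp
  qed
  then have "(\<Sum>b\<in>Basis. (real n)\<^sup>2 * integral {0..2*pi} (\<lambda>s. (f s \<bullet> b)\<^sup>2)) \<le> (\<Sum>b\<in>Basis. integral {0..2*pi} (\<lambda>s. (h s \<bullet> b)\<^sup>2))"
    by (rule sum_mono)
  then show ?thesis unfolding sq using h2 f2 by (simp add: integral_sum sum_distrib_left)
qed

section \<open>Bivectors and orthonormal frames\<close>

lemma bounded_bilinear_wedge: "bounded_bilinear wedge"
  unfolding bilinear_conv_bounded_bilinear[symmetric] bilinear_def linear_iff
  by (simp add: wedge_def vec_eq_iff algebra_simps)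

interpretation wedge: bounded_bilinear wedge
  by (rule bounded_bilinear_wedge)

lemma wedge_self [simp]: "wedge a a = 0"
  by (simp add: wedge_def vec_eq_iff)

lemma wedge_swap: "wedge b a = - wedge a b"
  by (simp add: wedge_def vec_eq_iff)

lemma inner_wedge_wedge: "wedge a b \<bullet> wedge c d = 2 * ((a \<bullet> c) * (b \<bullet> d) - (a \<bullet> d) * (b \<bullet> c))"
  by (simp add: wedge_def inner_vec_def sum_4 algebra_simps)

lemma wedge_mult_vec: "wedge a b *v v = (b \<bullet> v) *\<^sub>R a - (a \<bullet> v) *\<^sub>R b"
  by (simp add: wedge_def matrix_vector_mult_def vec_eq_iff inner_vec_def sum_4 algebra_simps)

lemma wedge_in_Lambda2: "wedge a b \<in> Lambda2"
  by (simp add: Lambda2_def wedge_def transpose_def vec_eq_iff)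

lemma Lambda2_add: "A \<in> Lambda2 \<Longrightarrow> B \<in> Lambda2 \<Longrightarrow> A + B \<in> Lambda2"
  and Lambda2_diff: "A \<in> Lambda2 \<Longrightarrow> B \<in> Lambda2 \<Longrightarrow> A - B \<in> Lambda2"
  and Lambda2_scaleR: "A \<in> Lambda2 \<Longrightarrow> r *\<^sub>R A \<in> Lambda2"
proof -
  have "transpose (A + B) = transpose A + transpose B" "transpose (A - B) = transpose A - transpose B"
    "transpose (r *\<^sub>R A) = r *\<^sub>R transpose A" by (simp_all add: transpose_def vec_eq_iff)
  then show "A \<in> Lambda2 \<Longrightarrow> B \<in> Lambda2 \<Longrightarrow> A + B \<in> Lambda2"
    "A \<in> Lambda2 \<Longrightarrow> B \<in> Lambda2 \<Longrightarrow> A - B \<in> Lambda2" "A \<in> Lambda2 \<Longrightarrow> r *\<^sub>R A \<in> Lambda2"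
    by (simp_all add: Lambda2_def)
qed

text \<open>
  Subtracting from \<open>a\<close> and \<open>b\<close> their components along \<open>v\<close> does not change the left-hand side; after
  that the claim is the Cauchy--Schwarz inequality in the plane.
\<close>

lemma norm_wedge_mult_vec_le:
  assumes "norm v = 1"
  shows "norm (wedge a b *v v) \<le> norm a * norm b"
proof -
  define p q where "p = a \<bullet> v" and "q = b \<bullet> v"
  define a' b' where "a' = a - p *\<^sub>R v" and "b' = b - q *\<^sub>R v"
  have v: "v \<bullet> v = 1" using assms by (simp add: norm_eq_1)
  have a: "(norm a)\<^sup>2 = p\<^sup>2 + (norm a')\<^sup>2"
    unfolding power2_norm_eq_inner a'_def
    by (simp add: inner_diff_left inner_diff_right v p_def inner_commute power2_eq_square)
  have b: "(norm b)\<^sup>2 = q\<^sup>2 + (norm b')\<^sup>2"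
    unfolding power2_norm_eq_inner b'_def
    by (simp add: inner_diff_left inner_diff_right v q_def inner_commute power2_eq_square)
  have "wedge a b *v v = q *\<^sub>R a' - p *\<^sub>R b'"
    by (simp add: wedge_mult_vec a'_def b'_def scaleR_right_diff_distrib mult.commute flip: p_def q_def)
  then have "norm (wedge a b *v v) \<le> \<bar>q\<bar> * norm a' + \<bar>p\<bar> * norm b'"
    using norm_triangle_ineq4[of "q *\<^sub>R a'" "p *\<^sub>R b'"] by simp
  also have "\<dots> \<le> norm a * norm b"
  proof (rule power2_le_imp_le)
    have "(\<bar>q\<bar> * norm a' + \<bar>p\<bar> * norm b')\<^sup>2 + (\<bar>p\<bar> * \<bar>q\<bar> - norm a' * norm b')\<^sup>2
        = (\<bar>p\<bar>\<^sup>2 + (norm a')\<^sup>2) * (\<bar>q\<bar>\<^sup>2 + (norm b')\<^sup>2)"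
      by (simp only: power2_eq_square) (simp add: algebra_simps)
    moreover have "0 \<le> (\<bar>p\<bar> * \<bar>q\<bar> - norm a' * norm b')\<^sup>2" by simp
    ultimately show "(\<bar>q\<bar> * norm a' + \<bar>p\<bar> * norm b')\<^sup>2 \<le> (norm a * norm b)\<^sup>2"
      unfolding power_mult_distrib a b power2_abs by linarith
  qed simp
  finally show ?thesis .
qed

lemma orthonormal4_inner:
  assumes on: "orthonormal4 e1 e2 e3 e4"
  shows "a \<bullet> b = (a \<bullet> e1) * (b \<bullet> e1) + (a \<bullet> e2) * (b \<bullet> e2) + (a \<bullet> e3) * (b \<bullet> e3) + (a \<bullet> e4) * (b \<bullet> e4)"
proof -
  have o: "e1 \<bullet> e2 = 0" "e1 \<bullet> e3 = 0" "e1 \<bullet> e4 = 0" "e2 \<bullet> e3 = 0" "e2 \<bullet> e4 = 0" "e3 \<bullet> e4 = 0"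
    "e1 \<bullet> e1 = 1" "e2 \<bullet> e2 = 1" "e3 \<bullet> e3 = 1" "e4 \<bullet> e4 = 1"
    using on by (auto simp: orthonormal4_def orthogonal4_def orthogonal_def norm_eq_1)
  have o': "e2 \<bullet> e1 = 0" "e3 \<bullet> e1 = 0" "e4 \<bullet> e1 = 0" "e3 \<bullet> e2 = 0" "e4 \<bullet> e2 = 0" "e4 \<bullet> e3 = 0"
    using o by (simp_all add: inner_commute)
  define w where "w = a - ((a \<bullet> e1) *\<^sub>R e1 + (a \<bullet> e2) *\<^sub>R e2 + (a \<bullet> e3) *\<^sub>R e3 + (a \<bullet> e4) *\<^sub>R e4)"
  have w: "w \<bullet> e1 = 0" "w \<bullet> e2 = 0" "w \<bullet> e3 = 0" "w \<bullet> e4 = 0"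
    unfolding w_def by (simp_all add: inner_diff_left inner_add_left o o')
  have "w = 0"
  proof (rule ccontr)
    assume nz: "w \<noteq> 0"
    let ?S = "{w, e1, e2, e3, e4}"
    have "pairwise orthogonal ?S"
      using w o o' by (auto simp: pairwise_def orthogonal_def inner_commute)
    moreover have "0 \<notin> ?S" using nz o by auto
    ultimately have "independent ?S" by (rule pairwise_orthogonal_independent)
    then have "card ?S \<le> DIM(real^4)" by (rule independent_card_le)
    moreover have "card ?S = 5"
    proof -
      have "e1 \<noteq> e2" "e1 \<noteq> e3" "e1 \<noteq> e4" "e2 \<noteq> e3" "e2 \<noteq> e4" "e3 \<noteq> e4" "w \<noteq> e1" "w \<noteq> e2" "w \<noteq> e3" "w \<noteq> e4"
        using o w by auto
      then show ?thesis by simp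
    qed
    ultimately show False by simp
  qed
  then have "a = (a \<bullet> e1) *\<^sub>R e1 + (a \<bullet> e2) *\<^sub>R e2 + (a \<bullet> e3) *\<^sub>R e3 + (a \<bullet> e4) *\<^sub>R e4"
    by (simp add: w_def)
  from arg_cong[OF this, of "\<lambda>x. x \<bullet> b"] show ?thesis
    unfolding inner_add_left inner_scaleR_left inner_commute[of e1 b] inner_commute[of e2 b]
      inner_commute[of e3 b] inner_commute[of e4 b] .
qed

section \<open>Operations on horizontal curves\<close>

lemma norm_derivative_le_lipschitz:
  fixes f :: "real \<Rightarrow> 'a::euclidean_space"
  assumes "L-lipschitz_on {0..T} f" "0 \<le> s" "s < T"
    "(f has_vector_derivative u) (at s within {0..T})"
  shows "norm u \<le> L"
  by (rule LIMSEQ_le_const2[OF tendsto_norm[OF clamped_quotient_tendsto[OF assms(4,2,3)]]])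
     (use clamped_quotient_le[OF assms(1)] assms in auto)

text \<open>
  The control is only determined almost everywhere and need not be bounded on the exceptional null
  set. Setting it to zero there gives a control to which the calculus above applies.
\<close>

lemma horizontal_curve_lip_deriv:
  assumes h: "horizontal_curve T \<gamma> u"
  obtains u' N where "lip_deriv T (\<lambda>s. fst (\<gamma> s)) u'"
    "lip_deriv T (\<lambda>s. snd (\<gamma> s)) (\<lambda>s. (1/2) *\<^sub>R wedge (fst (\<gamma> s)) (u' s))"
    "negligible N" "\<And>s. s \<in> {0..T} - N \<Longrightarrow> u' s = u s"
proof -
  from h obtain L where T: "0 < T" and L: "L-lipschitz_on {0..T} \<gamma>" and ae: "AE s in lebesgue. s \<in> {0..T} \<longrightarrow>
        ((\<lambda>r. fst (\<gamma> r)) has_vector_derivative u s) (at s within {0..T}) \<and>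
        ((\<lambda>r. snd (\<gamma> r)) has_vector_derivative (1/2) *\<^sub>R wedge (fst (\<gamma> s)) (u s)) (at s within {0..T})"
    unfolding horizontal_curve_def by blast
  from ae obtain N where N: "negligible N" and d: "\<And>s. s \<in> {0..T} - N \<Longrightarrow>
        ((\<lambda>r. fst (\<gamma> r)) has_vector_derivative u s) (at s within {0..T}) \<and>
        ((\<lambda>r. snd (\<gamma> r)) has_vector_derivative (1/2) *\<^sub>R wedge (fst (\<gamma> s)) (u s)) (at s within {0..T})"
    unfolding eventually_ae_filter_negligible by blast
  have Lf: "L-lipschitz_on {0..T} (\<lambda>s. fst (\<gamma> s))"
  proof (rule lipschitz_onI)
    fix s r assume "s \<in> {0..T}" "r \<in> {0..T}"
    then show "dist (fst (\<gamma> s)) (fst (\<gamma> r)) \<le> L * dist s r"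
      using lipschitz_onD[OF L] dist_fst_le order_trans by blast
  qed (use L lipschitz_on_nonneg in blast)
  have Ls: "L-lipschitz_on {0..T} (\<lambda>s. snd (\<gamma> s))"
  proof (rule lipschitz_onI)
    fix s r assume "s \<in> {0..T}" "r \<in> {0..T}"
    then show "dist (snd (\<gamma> s)) (snd (\<gamma> r)) \<le> L * dist s r"
      using lipschitz_onD[OF L] dist_snd_le order_trans by blast
  qed (use L lipschitz_on_nonneg in blast)
  have L0: "0 \<le> L" using L lipschitz_on_nonneg by blast
  define M where "M = insert T N"
  have M: "negligible M" using N by (simp add: M_def)
  define u' where "u' s = (if s \<in> M then 0 else u s)" for s
  have ub: "norm (u' s) \<le> L" if "s \<in> {0..T}" for s
  proof (cases "s \<in> M")
    case False
    then show ?thesis using d[of s] that norm_derivative_le_lipschitz[OF Lf, of s] by (auto simp: M_def u'_def)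
  qed (use L0 in \<open>simp add: u'_def\<close>)
  have tb: "norm ((1/2) *\<^sub>R wedge (fst (\<gamma> s)) (u' s)) \<le> L" if "s \<in> {0..T}" for s
  proof (cases "s \<in> M")
    case False
    then have "norm ((1/2) *\<^sub>R wedge (fst (\<gamma> s)) (u s)) \<le> L"
      using d[of s] that by (intro norm_derivative_le_lipschitz[OF Ls, of s]) (auto simp: M_def)
    then show ?thesis using False by (simp only: u'_def if_False)
  qed (use L0 in \<open>simp add: u'_def wedge.zero_right\<close>)
  have "lip_deriv T (\<lambda>s. fst (\<gamma> s)) u'"
    by (rule lip_derivI[OF T Lf ub M]) (use d in \<open>auto simp: u'_def M_def\<close>)
  moreover have "lip_deriv T (\<lambda>s. snd (\<gamma> s)) (\<lambda>s. (1/2) *\<^sub>R wedge (fst (\<gamma> s)) (u' s))"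
    by (rule lip_derivI[OF T Ls tb M]) (use d in \<open>auto simp: u'_def M_def\<close>)
  ultimately show thesis using that M by (simp add: u'_def)
qed

lemma lip_deriv_horizontal_curve:
  assumes x: "lip_deriv T x u" and t: "lip_deriv T t (\<lambda>s. (1/2) *\<^sub>R wedge (x s) (u s))"
    and L: "\<And>s. s \<in> {0..T} \<Longrightarrow> t s \<in> Lambda2"
  shows "horizontal_curve T (\<lambda>s. (x s, t s)) u"
proof -
  from x obtain K N where F: "0 < T" "K-lipschitz_on {0..T} x" "negligible N"
    "\<And>s. s \<in> {0..T} - N \<Longrightarrow> (x has_vector_derivative u s) (at s within {0..T})"
    by (elim lip_derivE) blast
  from t obtain K' N' where G: "K'-lipschitz_on {0..T} t" "negligible N'"
    "\<And>s. s \<in> {0..T} - N' \<Longrightarrow> (t has_vector_derivative (1/2) *\<^sub>R wedge (x s) (u s)) (at s within {0..T})"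
    by (elim lip_derivE) blast
  have "\<exists>L. L-lipschitz_on {0..T} (\<lambda>s. (x s, t s))"
    using lipschitz_on_Pair[OF F(2) G(1)] by blast
  moreover have "AE s in lebesgue. s \<in> {0..T} \<longrightarrow>
        (x has_vector_derivative u s) (at s within {0..T}) \<and>
        (t has_vector_derivative (1/2) *\<^sub>R wedge (x s) (u s)) (at s within {0..T})"
    unfolding eventually_ae_filter_negligible
    by (rule exI[of _ "N \<union> N'"]) (use F G in auto)
  ultimately show ?thesis unfolding horizontal_curve_def using F(1) L by auto
qed

text \<open>
  The differentiable left inverse \<open>\<sigma>\<close> ensures that \<open>\<tau>\<close> does not map a set of positive measure into
  the null set where \<open>f\<close> fails to be differentiable.
\<close>

lemma lip_deriv_reparam:
  assumes f: "lip_deriv T f u" and S: "0 < S"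
    and \<tau>: "\<And>r. r \<in> {0..S} \<Longrightarrow> \<tau> r \<in> {0..T}"
    and d: "\<And>r. r \<in> {0..S} \<Longrightarrow> (\<tau> has_real_derivative \<tau>' r) (at r within {0..S})"
    and c: "continuous_on {0..S} \<tau>'"
    and \<sigma>: "\<sigma> differentiable_on (\<tau> ` {0..S})" "\<And>r. r \<in> {0..S} \<Longrightarrow> \<sigma> (\<tau> r) = r"
  shows "lip_deriv S (\<lambda>r. f (\<tau> r)) (\<lambda>r. \<tau>' r *\<^sub>R u (\<tau> r))"
proof -
  from f obtain L B N where F: "0 < T" "L-lipschitz_on {0..T} f" "0 < B"
    "\<And>s. s \<in> {0..T} \<Longrightarrow> norm (u s) \<le> B" "negligible N"
    "\<And>s. s \<in> {0..T} - N \<Longrightarrow> (f has_vector_derivative u s) (at s within {0..T})"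
    by (elim lip_derivE) blast
  have "lip_deriv S \<tau> \<tau>'"
    by (rule lip_deriv_C1[OF S _ c]) (use d in \<open>simp add: has_real_derivative_iff_has_vector_derivative\<close>)
  then obtain K C where K: "K-lipschitz_on {0..S} \<tau>" "C > 0" "\<And>r. r \<in> {0..S} \<Longrightarrow> norm (\<tau>' r) \<le> C"
    by (elim lip_derivE) blast
  have img: "\<tau> ` {0..S} \<subseteq> {0..T}" using \<tau> by auto
  let ?M = "\<sigma> ` (N \<inter> \<tau> ` {0..S})"
  show ?thesis
  proof (rule lip_derivI[OF S])
    show "(L * K)-lipschitz_on {0..S} (\<lambda>r. f (\<tau> r))"
      by (rule lipschitz_on_compose2[OF K(1) lipschitz_on_subset[OF F(2) img]])
    show "norm (\<tau>' r *\<^sub>R u (\<tau> r)) \<le> C * B" if "r \<in> {0..S}" for r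
      using K(2,3) F(4)[OF \<tau>[OF that]] that by (auto intro!: mult_mono)
    show "negligible ?M"
    proof (rule negligible_differentiable_image_negligible)
      show "negligible (N \<inter> \<tau> ` {0..S})" using F(5) negligible_subset by blast
      show "\<sigma> differentiable_on (N \<inter> \<tau> ` {0..S})" using \<sigma>(1) by (rule differentiable_on_subset) auto
    qed simp
    fix r assume r: "r \<in> {0..S} - ?M"
    have "\<tau> r \<notin> N"
    proof
      assume "\<tau> r \<in> N"
      then have "\<sigma> (\<tau> r) \<in> ?M" using r by blast
      then show False using r \<sigma>(2) by auto
    qed
    then have "(f has_vector_derivative u (\<tau> r)) (at (\<tau> r) within \<tau> ` {0..S})"
      using F(6)[of "\<tau> r"] \<tau>[of r] r img has_vector_derivative_within_subset by blast
    moreover have "(\<tau> has_vector_derivative \<tau>' r) (at r within {0..S})"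
      using d r by (simp add: has_real_derivative_iff_has_vector_derivative)
    ultimately show "((\<lambda>r. f (\<tau> r)) has_vector_derivative \<tau>' r *\<^sub>R u (\<tau> r)) (at r within {0..S})"
      using vector_diff_chain_within by (fastforce simp: o_def)
  qed
qed

lemma lip_deriv_concat:
  assumes f: "lip_deriv S f u" and g: "lip_deriv S' g v" and eq: "f S = g 0"
  shows "lip_deriv (S + S') (\<lambda>s. if s \<le> S then f s else g (s - S)) (\<lambda>s. if s \<le> S then u s else v (s - S))"
proof -
  from f obtain L B N where F: "0 < S" "L-lipschitz_on {0..S} f" "0 < B"
    "\<And>s. s \<in> {0..S} \<Longrightarrow> norm (u s) \<le> B" "negligible N"
    "\<And>s. s \<in> {0..S} - N \<Longrightarrow> (f has_vector_derivative u s) (at s within {0..S})"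
    by (elim lip_derivE) blast
  from g obtain L' B' N' where G: "0 < S'" "L'-lipschitz_on {0..S'} g" "0 < B'"
    "\<And>s. s \<in> {0..S'} \<Longrightarrow> norm (v s) \<le> B'" "negligible N'"
    "\<And>s. s \<in> {0..S'} - N' \<Longrightarrow> (g has_vector_derivative v s) (at s within {0..S'})"
    by (elim lip_derivE) blast
  let ?M = "insert S (N \<union> (\<lambda>x. S + x) ` N')"
  have Lg: "L'-lipschitz_on {S..S + S'} (\<lambda>s. g (s - S))"
  proof (rule lipschitz_onI)
    fix x y assume "x \<in> {S..S+S'}" "y \<in> {S..S+S'}"
    then show "dist (g (x - S)) (g (y - S)) \<le> L' * dist x y"
      using lipschitz_onD[OF G(2), of "x - S" "y - S"] by (simp add: dist_real_def)
  qed (use G(2) lipschitz_on_nonneg in blast)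
  show ?thesis
  proof (rule lip_derivI)
    show "0 < S + S'" using F G by simp
    show "(max L L')-lipschitz_on {0..S + S'} (\<lambda>s. if s \<le> S then f s else g (s - S))"
      by (rule lipschitz_on_concat_max[OF F(2) Lg]) (simp add: eq)
    show "norm (if s \<le> S then u s else v (s - S)) \<le> max B B'" if "s \<in> {0..S + S'}" for s
      using F(4)[of s] G(4)[of "s - S"] that by auto
    show "negligible ?M" using F(5) negligible_translation[OF G(5), of S] by simp
    fix s assume s: "s \<in> {0..S + S'} - ?M"
    show "((\<lambda>s. if s \<le> S then f s else g (s - S)) has_vector_derivative (if s \<le> S then u s else v (s - S)))
      (at s within {0..S + S'})"
    proof (cases "s < S")
      case True
      have "(f has_vector_derivative u s) (at s within {0..S})" using F(6)[of s] s True by auto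
      also have "at s within {0..S} = at s within {0..S + S'}"
        by (rule at_within_nhd[of s "{..<S}"]) (use True G(1) in auto)
      finally have "(f has_vector_derivative u s) (at s within {0..S + S'})" .
      then have "((\<lambda>s. if s \<le> S then f s else g (s - S)) has_vector_derivative u s) (at s within {0..S + S'})"
        by (rule has_vector_derivative_transform_within[of _ _ _ _ "S - s"]) (use True s in \<open>auto simp: dist_real_def\<close>)
      then show ?thesis using True by simp
    next
      case False
      then have sS: "S < s" "s \<le> S + S'" using s by auto
      have "s - S \<notin> N'"
      proof
        assume "s - S \<in> N'"
        then have "s \<in> (\<lambda>x. S + x) ` N'" by (intro image_eqI[of _ _ "s - S"]) auto
        then show False using s by auto
      qed
      then have "(g has_vector_derivative v (s - S)) (at (s - S) within {0..S'})"
        using G(6)[of "s - S"] sS by auto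
      moreover have im: "(\<lambda>x. x - S) ` {S..S + S'} = {0..S'}"
        by (auto simp: image_iff intro!: bexI[of _ "_ + S"])
      moreover have "((\<lambda>x. x - S) has_vector_derivative 1) (at s within {S..S + S'})"
        by (auto intro!: derivative_eq_intros)
      ultimately have "(g \<circ> (\<lambda>x. x - S) has_vector_derivative 1 *\<^sub>R v (s - S)) (at s within {S..S + S'})"
        by (intro vector_diff_chain_within) auto
      moreover have "at s within {S..S + S'} = at s within {0..S + S'}"
        by (rule at_within_nhd[of s "{S<..}"]) (use sS F(1) in auto)
      ultimately have "((\<lambda>x. g (x - S)) has_vector_derivative v (s - S)) (at s within {0..S + S'})"
        by (simp add: o_def)
      then have "((\<lambda>s. if s \<le> S then f s else g (s - S)) has_vector_derivative v (s - S)) (at s within {0..S + S'})"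
        by (rule has_vector_derivative_transform_within[of _ _ _ _ "s - S"]) (use sS F(1) in \<open>auto simp: dist_real_def\<close>)
      then show ?thesis using sS by simp
    qed
  qed
qed

lemma cc_dist_le:
  assumes "horizontal_curve T \<gamma> u" "\<gamma> 0 = p" "\<gamma> T = q"
  shows "cc_dist p q \<le> control_length T u"
proof -
  have "bdd_below {control_length T u | T \<gamma> u. horizontal_curve T \<gamma> u \<and> \<gamma> 0 = p \<and> \<gamma> T = q}"
  proof (rule bdd_belowI[of _ 0])
    fix l assume "l \<in> {control_length T u | T \<gamma> u. horizontal_curve T \<gamma> u \<and> \<gamma> 0 = p \<and> \<gamma> T = q}"
    then obtain T u where l: "l = control_length T u" by blast
    show "0 \<le> l" unfolding l control_length_def
      by (cases "(\<lambda>s. norm (u s)) integrable_on {0..T}") (auto intro: integral_nonneg simp: not_integrable_integral)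
  qed
  then show ?thesis unfolding cc_dist_def using assms by (intro cInf_lower) auto
qed

section \<open>Splitting off one Fourier mode\<close>

lemma has_integral_cos_int:
  "((\<lambda>s. cos (real_of_int m * s)) has_integral (if m = 0 then 2 * pi else 0)) {0..2*pi}"
  using has_integral_linear[OF has_integral_cis[of m] bounded_linear_Re] by (simp add: o_def if_distrib cong: if_cong)

lemma has_integral_sin_int:
  "((\<lambda>s. sin (real_of_int m * s)) has_integral 0) {0..2*pi}"
  using has_integral_linear[OF has_integral_cis[of m] bounded_linear_Im] by (simp add: o_def if_distrib cong: if_cong)

lemma has_integral_cos_cos:
  assumes "n \<ge> 1"
  shows "((\<lambda>s. cos (real k * s) * cos (real n * s)) has_integral (if k = n then pi else 0)) {0..2*pi}"
proof -
  have "((\<lambda>s. (cos (real_of_int (int k - int n) * s) + cos (real_of_int (int k + int n) * s)) / 2) has_integral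
     ((if int k - int n = 0 then 2 * pi else 0) + (if int k + int n = 0 then 2 * pi else 0)) / 2) {0..2*pi}"
    by (intro has_integral_divide has_integral_add has_integral_cos_int)
  moreover have "(cos (real_of_int (int k - int n) * s) + cos (real_of_int (int k + int n) * s)) / 2
      = cos (real k * s) * cos (real n * s)" for s
    by (simp add: cos_times_cos left_diff_distrib distrib_right)
  moreover have "((if int k - int n = 0 then 2 * pi else 0) + (if int k + int n = 0 then 2 * pi else 0)) / 2
      = (if k = n then pi else 0)" using assms by auto
  ultimately show ?thesis by (simp only:)
qed

lemma has_integral_sin_sin:
  assumes "n \<ge> 1"
  shows "((\<lambda>s. sin (real k * s) * sin (real n * s)) has_integral (if k = n then pi else 0)) {0..2*pi}"
proof -
  have "((\<lambda>s. (cos (real_of_int (int k - int n) * s) - cos (real_of_int (int k + int n) * s)) / 2) has_integral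
     ((if int k - int n = 0 then 2 * pi else 0) - (if int k + int n = 0 then 2 * pi else 0)) / 2) {0..2*pi}"
    by (intro has_integral_divide has_integral_diff has_integral_cos_int)
  moreover have "(cos (real_of_int (int k - int n) * s) - cos (real_of_int (int k + int n) * s)) / 2
      = sin (real k * s) * sin (real n * s)" for s
    by (simp add: sin_times_sin left_diff_distrib distrib_right)
  moreover have "((if int k - int n = 0 then 2 * pi else 0) - (if int k + int n = 0 then 2 * pi else 0)) / 2
      = (if k = n then pi else 0)" using assms by auto
  ultimately show ?thesis by (simp only:)
qed

lemma has_integral_sin_cos:
  "((\<lambda>s. sin (real k * s) * cos (real n * s)) has_integral 0) {0..2*pi}"
proof -
  have "((\<lambda>s. (sin (real_of_int (int k + int n) * s) + sin (real_of_int (int k - int n) * s)) / 2) has_integral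
     (0 + 0) / 2) {0..2*pi}"
    by (intro has_integral_divide has_integral_add has_integral_sin_int)
  then show ?thesis by (simp add: sin_times_cos left_diff_distrib distrib_right)
qed

lemma has_integral_mode_norm:
  fixes p q :: "'a::euclidean_space"
  assumes "n \<ge> 1"
  shows "((\<lambda>s. (norm (cos (real n * s) *\<^sub>R p + sin (real n * s) *\<^sub>R q))\<^sup>2) has_integral pi * ((norm p)\<^sup>2 + (norm q)\<^sup>2)) {0..2*pi}"
proof -
  have "((\<lambda>s. (cos (real n * s) * cos (real n * s)) * (norm p)\<^sup>2 + (sin (real n * s) * sin (real n * s)) * (norm q)\<^sup>2 +
       (sin (real n * s) * cos (real n * s)) * (2 * (p \<bullet> q))) has_integral
       (if n = n then pi else 0) * (norm p)\<^sup>2 + (if n = n then pi else 0) * (norm q)\<^sup>2 + 0 * (2 * (p \<bullet> q))) {0..2*pi}"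
    by (intro has_integral_add has_integral_mult_left has_integral_cos_cos has_integral_sin_sin has_integral_sin_cos assms)
  moreover have "(cos (real n * s) * cos (real n * s)) * (norm p)\<^sup>2 + (sin (real n * s) * sin (real n * s)) * (norm q)\<^sup>2 +
       (sin (real n * s) * cos (real n * s)) * (2 * (p \<bullet> q)) = (norm (cos (real n * s) *\<^sub>R p + sin (real n * s) *\<^sub>R q))\<^sup>2" for s
    unfolding power2_norm_eq_inner by (simp add: inner_add_left inner_add_right inner_commute[of q p] algebra_simps)
  ultimately show ?thesis by (simp add: algebra_simps)
qed

text \<open>
  The \<open>n\<close>-th Fourier mode of \<open>y\<close> vanishes; for \<open>n = 0\<close> this means that \<open>y\<close> has mean zero.
\<close>

definition no_mode :: "nat \<Rightarrow> (real \<Rightarrow> 'a::euclidean_space) \<Rightarrow> bool" where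
  "no_mode n y \<longleftrightarrow> ((\<lambda>s. cos (real n * s) *\<^sub>R y s) has_integral 0) {0..2*pi} \<and>
     ((\<lambda>s. sin (real n * s) *\<^sub>R y s) has_integral 0) {0..2*pi}"

lemma no_mode_bilinear:
  assumes "bounded_bilinear h" and y: "no_mode n y"
  shows "((\<lambda>s. h (y s) (cos (real n * s) *\<^sub>R p + sin (real n * s) *\<^sub>R q)) has_integral 0) {0..2*pi}"
proof -
  interpret bounded_bilinear h by fact
  have "((\<lambda>s. h (cos (real n * s) *\<^sub>R y s) p + h (sin (real n * s) *\<^sub>R y s) q) has_integral h 0 p + h 0 q) {0..2*pi}"
    using has_integral_linear[OF conjunct1[OF y[unfolded no_mode_def]] bounded_linear_left[of p]]
      has_integral_linear[OF conjunct2[OF y[unfolded no_mode_def]] bounded_linear_left[of q]]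
    by (intro has_integral_add) (simp_all add: o_def)
  then show ?thesis by (simp add: add_right scaleR_left scaleR_right zero_left)
qed

lemma mode_has_vector_derivative:
  "((\<lambda>s. cos (r * s) *\<^sub>R p + sin (r * s) *\<^sub>R q) has_vector_derivative
     cos (r * s) *\<^sub>R (r *\<^sub>R q) + sin (r * s) *\<^sub>R (- r *\<^sub>R p)) (at s within S)"
  by (auto intro!: derivative_eq_intros simp: algebra_simps)

lemma lip_deriv_mode:
  assumes "0 < T"
  shows "lip_deriv T (\<lambda>s. cos (r * s) *\<^sub>R p + sin (r * s) *\<^sub>R q)
     (\<lambda>s. cos (r * s) *\<^sub>R (r *\<^sub>R q) + sin (r * s) *\<^sub>R (- r *\<^sub>R p))"
  by (rule lip_deriv_C1[OF assms mode_has_vector_derivative]) (intro continuous_intros)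

text \<open>
  Integration by parts moves the derivative to the trigonometric factor, whose derivative is again
  a combination of \<open>cos (n s)\<close> and \<open>sin (n s)\<close>.
\<close>

lemma no_mode_derivative_bilinear:
  fixes h :: "'a::euclidean_space \<Rightarrow> 'a \<Rightarrow> 'b::euclidean_space"
  assumes h: "bounded_bilinear h" and y: "no_mode n y" and l: "lip_deriv (2*pi) y v" and per: "y 0 = y (2*pi)"
  shows "((\<lambda>s. h (v s) (cos (real n * s) *\<^sub>R p + sin (real n * s) *\<^sub>R q)) has_integral 0) {0..2*pi}"
proof -
  interpret bounded_bilinear h by fact
  let ?Q = "\<lambda>s. cos (real n * s) *\<^sub>R p + sin (real n * s) *\<^sub>R q"
  let ?Q' = "\<lambda>s. cos (real n * s) *\<^sub>R (real n *\<^sub>R q) + sin (real n * s) *\<^sub>R (- real n *\<^sub>R p)"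
  have Q2: "?Q (2*pi) = ?Q 0"
    using cos_int_2pin[of "int n"] sin_int_2pin[of "int n"] by (simp add: mult_ac)
  have "((\<lambda>s. h (y s) (?Q' s) + h (v s) (?Q s)) has_integral h (y (2*pi)) (?Q (2*pi)) - h (y 0) (?Q 0)) {0..2*pi}"
    by (rule lip_deriv_has_integral[OF lip_deriv_bilinear[OF h l lip_deriv_mode]]) simp
  then have "((\<lambda>s. h (y s) (?Q' s) + h (v s) (?Q s)) has_integral 0) {0..2*pi}"
    unfolding Q2 per by simp
  from has_integral_diff[OF this no_mode_bilinear[OF h y, of "real n *\<^sub>R q" "- real n *\<^sub>R p"]]
  show ?thesis by (simp only: add_diff_cancel_left' diff_0_right)
qed

lemma no_mode_remove:
  fixes x :: "real \<Rightarrow> 'a::euclidean_space"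
  assumes n: "n \<ge> 1"
    and c: "((\<lambda>s. cos (real k * s) *\<^sub>R x s) has_integral (if k = n then pi else 0) *\<^sub>R c) {0..2*pi}"
    and d: "((\<lambda>s. sin (real k * s) *\<^sub>R x s) has_integral (if k = n then pi else 0) *\<^sub>R d) {0..2*pi}"
  shows "no_mode k (\<lambda>s. x s - (cos (real n * s) *\<^sub>R c + sin (real n * s) *\<^sub>R d))"
proof -
  have "((\<lambda>s. cos (real k * s) *\<^sub>R x s - ((cos (real k * s) * cos (real n * s)) *\<^sub>R c + (sin (real n * s) * cos (real k * s)) *\<^sub>R d))
    has_integral (if k = n then pi else 0) *\<^sub>R c - ((if k = n then pi else 0) *\<^sub>R c + 0 *\<^sub>R d)) {0..2*pi}"
    by (intro has_integral_diff has_integral_add has_integral_scaleR_left c has_integral_cos_cos has_integral_sin_cos n)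
  moreover have "((\<lambda>s. sin (real k * s) *\<^sub>R x s - ((sin (real k * s) * cos (real n * s)) *\<^sub>R c + (sin (real k * s) * sin (real n * s)) *\<^sub>R d))
    has_integral (if k = n then pi else 0) *\<^sub>R d - (0 *\<^sub>R c + (if k = n then pi else 0) *\<^sub>R d)) {0..2*pi}"
    by (intro has_integral_diff has_integral_add has_integral_scaleR_left d has_integral_sin_sin has_integral_sin_cos n)
  ultimately show ?thesis unfolding no_mode_def by (simp add: scaleR_right_diff_distrib scaleR_right_distrib mult_ac)
qed

lemma square_norm_integrable:
  assumes "lip_deriv T y v"
  shows "(\<lambda>s. (norm (v s))\<^sup>2) integrable_on {0..T}" "(\<lambda>s. (norm (y s))\<^sup>2) integrable_on {0..T}"
  using lip_deriv_bilinear_absolutely_integrable[OF bounded_bilinear_inner assms assms]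
  by (simp_all add: power2_norm_eq_inner set_lebesgue_integral_eq_integral(1) integrable_continuous_real
     continuous_on_inner lip_deriv_continuous[OF assms])

lemma norm_add_square: "(norm (a + b))\<^sup>2 = (norm a)\<^sup>2 + 2 * (a \<bullet> b) + (norm b)\<^sup>2"
  by (simp add: power2_norm_eq_inner inner_add_left inner_add_right inner_commute)

context
  fixes y v :: "real \<Rightarrow> 'a::euclidean_space" and n :: nat
  assumes n: "n \<ge> 1" and y: "no_mode n y" and l: "lip_deriv (2*pi) y v" and per: "y 0 = y (2*pi)"
begin

lemma no_mode_add_norm:
  "integral {0..2*pi} (\<lambda>s. (norm (y s + (cos (real n * s) *\<^sub>R c + sin (real n * s) *\<^sub>R d)))\<^sup>2)
    = integral {0..2*pi} (\<lambda>s. (norm (y s))\<^sup>2) + pi * ((norm c)\<^sup>2 + (norm d)\<^sup>2)"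
proof -
  let ?P = "\<lambda>s. cos (real n * s) *\<^sub>R c + sin (real n * s) *\<^sub>R d"
  have "((\<lambda>s. (norm (y s))\<^sup>2 + 2 * (y s \<bullet> ?P s) + (norm (?P s))\<^sup>2) has_integral
    integral {0..2*pi} (\<lambda>s. (norm (y s))\<^sup>2) + 2 * 0 + pi * ((norm c)\<^sup>2 + (norm d)\<^sup>2)) {0..2*pi}"
    by (intro has_integral_add has_integral_mult_right no_mode_bilinear[OF bounded_bilinear_inner y] has_integral_mode_norm n
       integrable_integral square_norm_integrable(2)[OF l])
  moreover have "(norm (y s))\<^sup>2 + 2 * (y s \<bullet> ?P s) + (norm (?P s))\<^sup>2 = (norm (y s + ?P s))\<^sup>2" for s
    by (rule norm_add_square[symmetric])
  ultimately show ?thesis by (simp add: integral_unique)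
qed

lemma no_mode_derivative_add_norm:
  "integral {0..2*pi} (\<lambda>s. (norm (v s + (cos (real n * s) *\<^sub>R c + sin (real n * s) *\<^sub>R d)))\<^sup>2)
    = integral {0..2*pi} (\<lambda>s. (norm (v s))\<^sup>2) + pi * ((norm c)\<^sup>2 + (norm d)\<^sup>2)"
proof -
  let ?P = "\<lambda>s. cos (real n * s) *\<^sub>R c + sin (real n * s) *\<^sub>R d"
  have "((\<lambda>s. (norm (v s))\<^sup>2 + 2 * (v s \<bullet> ?P s) + (norm (?P s))\<^sup>2) has_integral
    integral {0..2*pi} (\<lambda>s. (norm (v s))\<^sup>2) + 2 * 0 + pi * ((norm c)\<^sup>2 + (norm d)\<^sup>2)) {0..2*pi}"
    by (intro has_integral_add has_integral_mult_right no_mode_derivative_bilinear[OF bounded_bilinear_inner y l per] has_integral_mode_norm n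
       integrable_integral square_norm_integrable(1)[OF l])
  moreover have "(norm (v s))\<^sup>2 + 2 * (v s \<bullet> ?P s) + (norm (?P s))\<^sup>2 = (norm (v s + ?P s))\<^sup>2" for s
    by (rule norm_add_square[symmetric])
  ultimately show ?thesis by (simp add: integral_unique)
qed

end

lemma wedge_mode:
  "wedge (cos r *\<^sub>R c + sin r *\<^sub>R d) (cos r *\<^sub>R (k *\<^sub>R d) + sin r *\<^sub>R (- k *\<^sub>R c)) = k *\<^sub>R wedge c d"
proof -
  have "wedge (cos r *\<^sub>R c + sin r *\<^sub>R d) (cos r *\<^sub>R (k *\<^sub>R d) + sin r *\<^sub>R (- k *\<^sub>R c))
    = (k * (cos r)\<^sup>2) *\<^sub>R wedge c d - (k * (sin r)\<^sup>2) *\<^sub>R wedge d c"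
    by (simp add: wedge.add_left wedge.add_right wedge.scaleR_left wedge.scaleR_right wedge.minus_right wedge.diff_right scaleR_right_diff_distrib power2_eq_square mult_ac)
  also have "\<dots> = (k * ((cos r)\<^sup>2 + (sin r)\<^sup>2)) *\<^sub>R wedge c d"
    by (simp only: wedge_swap[of d c] distrib_left scaleR_left_distrib) simp
  finally show ?thesis by simp
qed

lemma no_mode_area:
  fixes y v :: "real \<Rightarrow> real^4"
  assumes y: "no_mode n y" and l: "lip_deriv (2*pi) y v" and per: "y 0 = y (2*pi)"
  shows "integral {0..2*pi} (\<lambda>s. (1/2) *\<^sub>R wedge (y s + (cos (real n * s) *\<^sub>R c + sin (real n * s) *\<^sub>R d))
      (v s + (cos (real n * s) *\<^sub>R (real n *\<^sub>R d) + sin (real n * s) *\<^sub>R (- real n *\<^sub>R c))))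
    = integral {0..2*pi} (\<lambda>s. (1/2) *\<^sub>R wedge (y s) (v s)) + (pi * real n) *\<^sub>R wedge c d"
proof -
  let ?P = "\<lambda>s. cos (real n * s) *\<^sub>R c + sin (real n * s) *\<^sub>R d"
  let ?P' = "\<lambda>s. cos (real n * s) *\<^sub>R (real n *\<^sub>R d) + sin (real n * s) *\<^sub>R (- real n *\<^sub>R c)"
  have i: "(\<lambda>s. (1/2) *\<^sub>R wedge (y s) (v s)) integrable_on {0..2*pi}"
    using lip_deriv_continuous_bilinear_absolutely_integrable[OF bounded_bilinear_wedge lip_deriv_continuous[OF l] l]
    by (intro integrable_on_scaleR_left integrable_cmul) (simp add: set_lebesgue_integral_eq_integral(1))
  have "((\<lambda>s. (1/2) *\<^sub>R wedge (y s) (v s) + (1/2) *\<^sub>R (wedge (y s) (?P' s) - wedge (v s) (?P s)) + (real n / 2) *\<^sub>R wedge c d) has_integral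
    integral {0..2*pi} (\<lambda>s. (1/2) *\<^sub>R wedge (y s) (v s)) + (1/2) *\<^sub>R (0 - 0) + (2 * pi - 0) *\<^sub>R ((real n / 2) *\<^sub>R wedge c d)) {0..2*pi}"
    using has_integral_const_real[of "(real n / 2) *\<^sub>R wedge c d" 0 "2 * pi"]
    by (intro has_integral_add has_integral_cmul has_integral_diff integrable_integral[OF i]
        no_mode_bilinear[OF bounded_bilinear_wedge y] no_mode_derivative_bilinear[OF bounded_bilinear_wedge y l per]) simp
  moreover have "(1/2) *\<^sub>R wedge (y s) (v s) + (1/2) *\<^sub>R (wedge (y s) (?P' s) - wedge (v s) (?P s)) + (real n / 2) *\<^sub>R wedge c d
     = (1/2) *\<^sub>R wedge (y s + ?P s) (v s + ?P' s)" for s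
  proof -
    have "wedge (y s + ?P s) (v s + ?P' s) = wedge (y s) (v s) + wedge (y s) (?P' s) + wedge (?P s) (v s) + wedge (?P s) (?P' s)"
      by (simp only: wedge.add_left wedge.add_right) (simp add: algebra_simps)
    also have "wedge (?P s) (?P' s) = real n *\<^sub>R wedge c d" by (rule wedge_mode)
    also have "wedge (?P s) (v s) = - wedge (v s) (?P s)" by (rule wedge_swap)
    finally show ?thesis by (simp add: scaleR_right_distrib scaleR_right_diff_distrib)
  qed
  moreover have "I + (1/2) *\<^sub>R (0 - 0) + (2 * pi - 0) *\<^sub>R ((real n / 2) *\<^sub>R wedge c d)
     = I + (pi * real n) *\<^sub>R wedge c d" for I by simp
  ultimately show ?thesis by (intro integral_unique) (simp only:)
qed

text \<open>
  The functional is at most \<open>|y| |v| / 2\<close> under the integral, and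
  \<open>|y| |v| \<le> |y|\<^sup>2 + |v|\<^sup>2 / 4\<close>. The weights are chosen so that the Poincare inequality
  \<open>4 \<integral> |y|\<^sup>2 \<le> \<integral> |v|\<^sup>2\<close> turns the bound into a quarter of the energy.
\<close>

lemma area_functional_le:
  fixes y v :: "real \<Rightarrow> real^4"
  assumes l: "lip_deriv T y v" and \<phi>: "bounded_linear \<phi>" "\<And>a b. \<phi> (wedge a b) \<le> norm a * norm b"
  shows "\<phi> (integral {0..T} (\<lambda>s. (1/2) *\<^sub>R wedge (y s) (v s))) \<le>
     integral {0..T} (\<lambda>s. (norm (y s))\<^sup>2) / 2 + integral {0..T} (\<lambda>s. (norm (v s))\<^sup>2) / 8"
proof -
  interpret bounded_linear \<phi> by fact
  have i: "(\<lambda>s. (1/2) *\<^sub>R wedge (y s) (v s)) integrable_on {0..T}"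
    using lip_deriv_continuous_bilinear_absolutely_integrable[OF bounded_bilinear_wedge lip_deriv_continuous[OF l] l]
    by (intro integrable_on_scaleR_left integrable_cmul) (simp add: set_lebesgue_integral_eq_integral(1))
  have "((\<lambda>s. (norm (y s))\<^sup>2 / 2 + (norm (v s))\<^sup>2 / 8) has_integral
      integral {0..T} (\<lambda>s. (norm (y s))\<^sup>2) / 2 + integral {0..T} (\<lambda>s. (norm (v s))\<^sup>2) / 8) {0..T}"
    by (intro has_integral_add has_integral_divide integrable_integral square_norm_integrable[OF l])
  with has_integral_linear[OF integrable_integral[OF i] \<phi>(1)] show ?thesis
  proof (rule has_integral_le)
    fix s
    have "0 \<le> (norm (y s) - norm (v s) / 2)\<^sup>2" by simp
    then have "norm (y s) * norm (v s) / 2 \<le> (norm (y s))\<^sup>2 / 2 + (norm (v s))\<^sup>2 / 8"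
      by (simp add: power2_eq_square field_simps)
    then show "(\<phi> \<circ> (\<lambda>s. (1/2) *\<^sub>R wedge (y s) (v s))) s \<le> (norm (y s))\<^sup>2 / 2 + (norm (v s))\<^sup>2 / 8"
      using \<phi>(2)[of "y s" "v s"] by (simp add: scaleR)
  qed
qed

text \<open>
  Subtracting one Fourier mode splits the norm, the energy and the area additively, because all
  mixed terms are Fourier coefficients that vanish.
\<close>

lemma mode_split:
  fixes x u :: "real \<Rightarrow> real^4"
  assumes n: "n \<ge> 1" and x: "lip_deriv (2*pi) x u" and per: "x 0 = x (2*pi)"
  obtains c d y v where "lip_deriv (2*pi) y v" "y 0 = y (2*pi)" "no_mode n y"
    "\<And>k. k \<noteq> n \<Longrightarrow> no_mode k x \<Longrightarrow> no_mode k y"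
    "\<And>s. x s = y s + (cos (real n * s) *\<^sub>R c + sin (real n * s) *\<^sub>R d)"
    "integral {0..2*pi} (\<lambda>s. (norm (x s))\<^sup>2)
      = integral {0..2*pi} (\<lambda>s. (norm (y s))\<^sup>2) + pi * ((norm c)\<^sup>2 + (norm d)\<^sup>2)"
    "integral {0..2*pi} (\<lambda>s. (norm (u s))\<^sup>2)
      = integral {0..2*pi} (\<lambda>s. (norm (v s))\<^sup>2) + pi * (real n)\<^sup>2 * ((norm c)\<^sup>2 + (norm d)\<^sup>2)"
    "integral {0..2*pi} (\<lambda>s. (1/2) *\<^sub>R wedge (x s) (u s))
      = integral {0..2*pi} (\<lambda>s. (1/2) *\<^sub>R wedge (y s) (v s)) + (pi * real n) *\<^sub>R wedge c d"
proof -
  define c where "c = (1/pi) *\<^sub>R integral {0..2*pi} (\<lambda>s. cos (real n * s) *\<^sub>R x s)"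
  define d where "d = (1/pi) *\<^sub>R integral {0..2*pi} (\<lambda>s. sin (real n * s) *\<^sub>R x s)"
  let ?P = "\<lambda>s. cos (real n * s) *\<^sub>R c + sin (real n * s) *\<^sub>R d"
  let ?P' = "\<lambda>s. cos (real n * s) *\<^sub>R (real n *\<^sub>R d) + sin (real n * s) *\<^sub>R (- real n *\<^sub>R c)"
  define y where "y s = x s - ?P s" for s
  define v where "v s = u s - ?P' s" for s
  have ci: "((\<lambda>s. cos (real n * s) *\<^sub>R x s) has_integral pi *\<^sub>R c) {0..2*pi}"
    using integrable_integral[OF integrable_continuous_real, of 0 "2*pi" "\<lambda>s. cos (real n * s) *\<^sub>R x s"]
    by (simp add: c_def continuous_on_scaleR lip_deriv_continuous[OF x] continuous_on_cos continuous_on_mult continuous_on_const continuous_on_id)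
  have di: "((\<lambda>s. sin (real n * s) *\<^sub>R x s) has_integral pi *\<^sub>R d) {0..2*pi}"
    using integrable_integral[OF integrable_continuous_real, of 0 "2*pi" "\<lambda>s. sin (real n * s) *\<^sub>R x s"]
    by (simp add: d_def continuous_on_scaleR lip_deriv_continuous[OF x] continuous_on_sin continuous_on_mult continuous_on_const continuous_on_id)
  have ly: "lip_deriv (2*pi) y v"
    unfolding y_def[abs_def] v_def[abs_def] by (intro lip_deriv_diff x lip_deriv_mode) simp
  have "?P (2*pi) = ?P 0"
    using cos_int_2pin[of "int n"] sin_int_2pin[of "int n"] by (simp add: mult_ac)
  then have yper: "y 0 = y (2*pi)" unfolding y_def using per by (simp only:)
  have ny: "no_mode n y"
    unfolding y_def[abs_def] by (rule no_mode_remove[OF n]) (use ci di in simp_all)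
  have nk: "no_mode k y" if "k \<noteq> n" "no_mode k x" for k
    unfolding y_def[abs_def] by (rule no_mode_remove[OF n]) (use that in \<open>simp_all add: no_mode_def\<close>)
  have xy: "x s = y s + ?P s" for s by (simp add: y_def)
  have uv: "u s = v s + ?P' s" for s by (simp add: v_def)
  have "integral {0..2*pi} (\<lambda>s. (norm (x s))\<^sup>2)
      = integral {0..2*pi} (\<lambda>s. (norm (y s))\<^sup>2) + pi * ((norm c)\<^sup>2 + (norm d)\<^sup>2)"
    unfolding xy by (rule no_mode_add_norm[OF n ny ly yper])
  moreover have "integral {0..2*pi} (\<lambda>s. (norm (u s))\<^sup>2)
      = integral {0..2*pi} (\<lambda>s. (norm (v s))\<^sup>2) + pi * (real n)\<^sup>2 * ((norm c)\<^sup>2 + (norm d)\<^sup>2)"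
    unfolding uv no_mode_derivative_add_norm[OF n ny ly yper]
    by (simp add: power_mult_distrib algebra_simps)
  moreover have "integral {0..2*pi} (\<lambda>s. (1/2) *\<^sub>R wedge (x s) (u s))
      = integral {0..2*pi} (\<lambda>s. (1/2) *\<^sub>R wedge (y s) (v s)) + (pi * real n) *\<^sub>R wedge c d"
    unfolding xy uv by (rule no_mode_area[OF ny ly yper])
  ultimately show thesis using that[OF ly yper ny nk xy] by blast
qed

section \<open>The energy inequality for closed curves\<close>

text \<open>
  The orthogonal complex structure for which \<open>(x1, y1)\<close> and \<open>(x2, y2)\<close> span complex lines, that is,
  the rotation by a right angle in both planes. Half the inner product with
  \<open>x1 \<and> y1 + x2 \<and> y2\<close>, applied to \<open>a \<and> b\<close>, is its Kaehler form (\<open>calibration_wedge\<close>).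
\<close>

definition double_rotation :: "real^4 \<Rightarrow> real^4 \<Rightarrow> real^4 \<Rightarrow> real^4 \<Rightarrow> real^4 \<Rightarrow> real^4" where
  "double_rotation x1 y1 x2 y2 a =
     (a \<bullet> x1) *\<^sub>R y1 - (a \<bullet> y1) *\<^sub>R x1 + (a \<bullet> x2) *\<^sub>R y2 - (a \<bullet> y2) *\<^sub>R x2"

lemma orthonormal4_relations:
  assumes "orthonormal4 e1 e2 e3 e4"
  shows "e1 \<bullet> e1 = 1" "e2 \<bullet> e2 = 1" "e3 \<bullet> e3 = 1" "e4 \<bullet> e4 = 1"
    "e1 \<bullet> e2 = 0" "e1 \<bullet> e3 = 0" "e1 \<bullet> e4 = 0" "e2 \<bullet> e3 = 0" "e2 \<bullet> e4 = 0" "e3 \<bullet> e4 = 0"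
    "e2 \<bullet> e1 = 0" "e3 \<bullet> e1 = 0" "e4 \<bullet> e1 = 0" "e3 \<bullet> e2 = 0" "e4 \<bullet> e2 = 0" "e4 \<bullet> e3 = 0"
  using assms by (auto simp: orthonormal4_def orthogonal4_def orthogonal_def norm_eq_1 inner_commute)

context
  fixes x1 y1 x2 y2 :: "real^4"
  assumes on: "orthonormal4 x1 y1 x2 y2"
begin

abbreviation "J \<equiv> double_rotation x1 y1 x2 y2"

lemmas frame_relations = orthonormal4_relations[OF on]

lemma double_rotation_inner: "J a \<bullet> J b = a \<bullet> b"
  unfolding orthonormal4_inner[OF on, of a b] double_rotation_def
  by (simp add: inner_add_left inner_add_right inner_diff_left inner_diff_right frame_relations)

lemma double_rotation_norm: "norm (J a) = norm a"
  by (simp add: norm_eq_sqrt_inner double_rotation_inner)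

lemma calibration_wedge:
  "(1/2) * (wedge a b \<bullet> (wedge x1 y1 + wedge x2 y2)) = J a \<bullet> b"
  by (simp add: inner_wedge_wedge inner_add_right double_rotation_def inner_add_left inner_diff_left
      inner_commute[of _ b] algebra_simps)

lemma calibration_wedge_le: "(1/2) * (wedge a b \<bullet> (wedge x1 y1 + wedge x2 y2)) \<le> norm a * norm b"
  unfolding calibration_wedge using norm_cauchy_schwarz[of "J a" b] by (simp add: double_rotation_norm)

lemma calibration_target:
  "(1/2) * ((t1 *\<^sub>R wedge x1 y1 + t2 *\<^sub>R wedge x2 y2) \<bullet> (wedge x1 y1 + wedge x2 y2)) = t1 + t2"
  by (simp add: inner_add_left inner_add_right inner_wedge_wedge frame_relations)

text \<open>
  The equality case of \<open>J a \<bullet> b \<le> (|a|\<^sup>2 + |b|\<^sup>2) / 2\<close>.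
\<close>

lemma double_rotation_eqI:
  assumes "J a \<bullet> b = ((norm a)\<^sup>2 + (norm b)\<^sup>2) / 2"
  shows "b = J a"
proof -
  have "(norm (b - J a))\<^sup>2 = b \<bullet> b - 2 * (J a \<bullet> b) + J a \<bullet> J a"
    by (simp add: power2_norm_eq_inner inner_diff_left inner_diff_right inner_commute)
  also have "\<dots> = 0" unfolding assms double_rotation_inner by (simp add: power2_norm_eq_inner field_simps)
  finally show ?thesis by simp
qed

lemma double_rotation_skew: "J a \<bullet> b = - (J b \<bullet> a)"
  unfolding calibration_wedge[symmetric] wedge_swap[of b a] by simp

text \<open>
  As a skew matrix the bivector has the singular values \<open>t1, t1, t2, t2\<close>, the smallest of which is \<open>t2\<close>.
\<close>

lemma norm_target_mult_vec_ge:
  assumes t: "t2 \<le> t1" "0 < t2"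
  shows "t2 * norm v \<le> norm ((t1 *\<^sub>R wedge x1 y1 + t2 *\<^sub>R wedge x2 y2) *v v)"
proof (rule power2_le_imp_le)
  let ?A = "(y1 \<bullet> v)\<^sup>2 + (x1 \<bullet> v)\<^sup>2" and ?B = "(y2 \<bullet> v)\<^sup>2 + (x2 \<bullet> v)\<^sup>2"
  have tv: "(t1 *\<^sub>R wedge x1 y1 + t2 *\<^sub>R wedge x2 y2) *v v =
      t1 *\<^sub>R ((y1 \<bullet> v) *\<^sub>R x1 - (x1 \<bullet> v) *\<^sub>R y1) + t2 *\<^sub>R ((y2 \<bullet> v) *\<^sub>R x2 - (x2 \<bullet> v) *\<^sub>R y2)"
    by (simp add: matrix_vector_mult_add_rdistrib scaleR_matrix_vector_assoc[symmetric] wedge_mult_vec)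
  have "(norm ((t1 *\<^sub>R wedge x1 y1 + t2 *\<^sub>R wedge x2 y2) *v v))\<^sup>2 = t1\<^sup>2 * ?A + t2\<^sup>2 * ?B"
    unfolding tv power2_norm_eq_inner
    by (simp add: inner_add_left inner_add_right inner_diff_left inner_diff_right frame_relations power2_eq_square algebra_simps)
  moreover have "t2\<^sup>2 * ?A \<le> t1\<^sup>2 * ?A"
    using t by (intro mult_right_mono power_mono) auto
  moreover have "(norm v)\<^sup>2 = ?A + ?B"
    unfolding power2_norm_eq_inner orthonormal4_inner[OF on, of v v]
    by (simp add: power2_eq_square inner_commute)
  ultimately show "(t2 * norm v)\<^sup>2 \<le> (norm ((t1 *\<^sub>R wedge x1 y1 + t2 *\<^sub>R wedge x2 y2) *v v))\<^sup>2"
    by (simp add: power_mult_distrib distrib_left)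
qed simp

text \<open>
  Both sides of the last hypothesis are sums of two bivectors, with the same two norms. The two on
  the right are orthogonal, hence so are the two on the left. For complex lines this inner product is
  twice the sum of the squares of inner products between the lines.
\<close>

lemma calibrated_planes_orthogonal:
  assumes c: "pi * (norm c)\<^sup>2 = t1" and c2: "2 * pi * (norm c2)\<^sup>2 = t2"
    and t: "pi *\<^sub>R wedge c (J c) + (2 * pi) *\<^sub>R wedge c2 (J c2) = t1 *\<^sub>R wedge x1 y1 + t2 *\<^sub>R wedge x2 y2"
  shows "orthogonal4 c (J c) c2 (J c2)"
proof -
  have jj: "J a \<bullet> a = 0" for a using double_rotation_skew[of a a] by simp
  have w: "wedge a (J a) \<bullet> wedge a (J a) = 2 * ((norm a)\<^sup>2)\<^sup>2" for a
    unfolding power2_norm_eq_inner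
    using jj[of a] by (simp add: inner_wedge_wedge double_rotation_inner inner_commute power2_eq_square)
  have w2: "wedge c (J c) \<bullet> wedge c2 (J c2) = 2 * ((c \<bullet> c2)\<^sup>2 + (J c \<bullet> c2)\<^sup>2)"
    using double_rotation_skew[of c2 c]
    by (simp add: inner_wedge_wedge double_rotation_inner inner_commute[of c "J c2"] power2_eq_square)
  have "(t1 *\<^sub>R wedge x1 y1 + t2 *\<^sub>R wedge x2 y2) \<bullet> (t1 *\<^sub>R wedge x1 y1 + t2 *\<^sub>R wedge x2 y2) = 2 * (t1\<^sup>2 + t2\<^sup>2)"
    by (simp add: inner_add_left inner_add_right inner_wedge_wedge frame_relations power2_eq_square algebra_simps)
  moreover have "(pi *\<^sub>R wedge c (J c) + (2 * pi) *\<^sub>R wedge c2 (J c2)) \<bullet> (pi *\<^sub>R wedge c (J c) + (2 * pi) *\<^sub>R wedge c2 (J c2))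
     = 2 * (t1\<^sup>2 + t2\<^sup>2) + 4 * pi\<^sup>2 * (wedge c (J c) \<bullet> wedge c2 (J c2))"
    unfolding c[symmetric] c2[symmetric]
    by (simp add: inner_add_left inner_add_right w inner_commute[of "wedge c2 (J c2)"] power2_eq_square algebra_simps)
  ultimately have "4 * pi\<^sup>2 * (wedge c (J c) \<bullet> wedge c2 (J c2)) = 0" unfolding t by linarith
  then have "wedge c (J c) \<bullet> wedge c2 (J c2) = 0" by simp
  then have "(c \<bullet> c2)\<^sup>2 + (J c \<bullet> c2)\<^sup>2 = 0" unfolding w2 mult_eq_0_iff by (rule disjE) simp_all
  then have "c \<bullet> c2 = 0" "J c \<bullet> c2 = 0" by (simp_all add: sum_power2_eq_zero_iff)
  moreover have "J c \<bullet> J c2 = 0" "c \<bullet> J c2 = 0"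
    using calculation double_rotation_inner[of c c2] double_rotation_skew[of c2 c] by (simp_all add: inner_commute[of c "J c2"])
  ultimately show ?thesis using jj[of c] jj[of c2]
    by (simp add: orthogonal4_def orthogonal_def inner_commute[of c "J c"] inner_commute[of c2 "J c2"])
qed

text \<open>
  With \<open>m\<close> half the energy of the first mode and \<open>R\<close> the area of the remaining part, the facts \<open>b1\<close> and
  \<open>b2\<close> bound the energy of the remaining part in terms of \<open>m\<close>. The first suffices for \<open>m \<le> t1\<close>, the
  second for \<open>m \<ge> t1\<close>, and both can only be sharp at \<open>m = t1\<close>.
\<close>

lemma energy_analysis:
  assumes t: "t2 \<le> t1" "0 < t2"
    and x: "lip_deriv (2*pi) x u" and per: "x 0 = x (2*pi)"
    and area: "integral {0..2*pi} (\<lambda>s. (1/2) *\<^sub>R wedge (x s) (u s)) = t1 *\<^sub>R wedge x1 y1 + t2 *\<^sub>R wedge x2 y2"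
  shows energy_bound: "2 * t1 + 4 * t2 \<le> integral {0..2*pi} (\<lambda>s. (norm (u s))\<^sup>2)"
    and energy_equality: "integral {0..2*pi} (\<lambda>s. (norm (u s))\<^sup>2) = 2 * t1 + 4 * t2 \<Longrightarrow>
      \<exists>\<alpha> c d c2 d2. orthogonal4 c d c2 d2 \<and> norm c = norm d \<and> norm c2 = norm d2 \<and>
        (\<forall>s\<in>{0..2*pi}. x s = \<alpha> + (cos s *\<^sub>R c + sin s *\<^sub>R d) + (cos (2 * s) *\<^sub>R c2 + sin (2 * s) *\<^sub>R d2))"
proof -
  let ?t = "t1 *\<^sub>R wedge x1 y1 + t2 *\<^sub>R wedge x2 y2"
  define \<phi> where "\<phi> B = (1/2) * (B \<bullet> (wedge x1 y1 + wedge x2 y2))" for B :: "real^4^4"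
  have \<phi>: "bounded_linear \<phi>"
    unfolding \<phi>_def[abs_def] by (intro bounded_linear_const_mult bounded_linear_inner_left)
  interpret \<phi>: bounded_linear \<phi> by fact
  have \<phi>w: "\<phi> (wedge a b) = J a \<bullet> b" for a b unfolding \<phi>_def by (rule calibration_wedge)
  have \<phi>le: "\<phi> (wedge a b) \<le> norm a * norm b" for a b unfolding \<phi>_def by (rule calibration_wedge_le)
  have \<phi>t: "\<phi> ?t = t1 + t2" unfolding \<phi>_def by (rule calibration_target)
  let ?I = "\<lambda>f. integral {0..2*pi} (\<lambda>s. (norm (f s :: real^4))\<^sup>2)"
  \<comment> \<open>A closed curve may be translated to mean zero without changing its area.\<close>
  define \<alpha> where "\<alpha> = (1 / (2*pi)) *\<^sub>R integral {0..2*pi} x"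
  define z where "z s = x s - \<alpha>" for s
  have cx: "continuous_on {0..2*pi} x" by (rule lip_deriv_continuous[OF x])
  have lz: "lip_deriv (2*pi) z u"
    using lip_deriv_diff[OF x lip_deriv_const[of "2*pi" \<alpha>]] by (simp add: z_def[abs_def])
  have zper: "z 0 = z (2*pi)" using per by (simp add: z_def)
  have "(x has_integral (2*pi) *\<^sub>R \<alpha>) {0..2*pi}"
    using integrable_integral[OF integrable_continuous_real[OF cx]] by (simp add: \<alpha>_def)
  from has_integral_diff[OF this has_integral_const_real[of \<alpha> 0 "2*pi"]]
  have z0: "no_mode 0 z" by (simp add: no_mode_def z_def)
  have "((\<lambda>s. wedge \<alpha> (u s)) has_integral 0) {0..2*pi}"
    using has_integral_linear[OF lip_deriv_has_integral[OF x] wedge.bounded_linear_right[of \<alpha>]] per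
    by (simp add: o_def wedge.zero_right)
  from has_integral_cmul[OF this, of "1/2"]
  have \<alpha>0: "((\<lambda>s. (1/2) *\<^sub>R wedge \<alpha> (u s)) has_integral 0) {0..2*pi}" by simp
  have "(\<lambda>s. (1/2) *\<^sub>R wedge (x s) (u s)) integrable_on {0..2*pi}"
    using lip_deriv_continuous_bilinear_absolutely_integrable[OF bounded_bilinear_wedge cx x]
    by (intro integrable_cmul) (simp add: set_lebesgue_integral_eq_integral(1))
  from has_integral_diff[OF integrable_integral[OF this] \<alpha>0]
  have "integral {0..2*pi} (\<lambda>s. (1/2) *\<^sub>R wedge (x s) (u s) - (1/2) *\<^sub>R wedge \<alpha> (u s)) = ?t - 0"
    unfolding area by (rule integral_unique)
  then have zarea: "integral {0..2*pi} (\<lambda>s. (1/2) *\<^sub>R wedge (z s) (u s)) = ?t"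
    by (simp only: z_def wedge.diff_left scaleR_right_diff_distrib diff_0_right)
  \<comment> \<open>\<open>n1\<close> stands for the first frequency, and \<open>n2\<close> below for the second, so that the mode terms keep
    their general form.\<close>
  obtain n1 :: nat where n1: "n1 = 1" by simp
  then have n1': "1 \<le> n1" by linarith
  obtain y v c d where y: "lip_deriv (2*pi) y v" "y 0 = y (2*pi)" "no_mode n1 y"
    "\<And>k. k \<noteq> n1 \<Longrightarrow> no_mode k z \<Longrightarrow> no_mode k y"
    "\<And>s. z s = y s + (cos (real n1 * s) *\<^sub>R c + sin (real n1 * s) *\<^sub>R d)"
    "?I z = ?I y + pi * ((norm c)\<^sup>2 + (norm d)\<^sup>2)"
    "?I u = ?I v + pi * (real n1)\<^sup>2 * ((norm c)\<^sup>2 + (norm d)\<^sup>2)"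
    "integral {0..2*pi} (\<lambda>s. (1/2) *\<^sub>R wedge (z s) (u s))
      = integral {0..2*pi} (\<lambda>s. (1/2) *\<^sub>R wedge (y s) (v s)) + (pi * real n1) *\<^sub>R wedge c d"
    by (rule mode_split[OF n1' lz zper]) (rule that; assumption)
  define R where "R = integral {0..2*pi} (\<lambda>s. (1/2) *\<^sub>R wedge (y s) (v s))"
  define m where "m = pi * ((norm c)\<^sup>2 + (norm d)\<^sup>2) / 2"
  have tR: "?t = R + pi *\<^sub>R wedge c d" using y(8) zarea by (simp add: R_def n1)
  have E: "?I u = ?I v + 2 * m" using y(7) by (simp add: m_def n1)
  have y01: "no_mode k y" if "k < 2" for k
    using y(3) y(4)[OF _ z0] n1 that less_2_cases[of k] by auto
  have poin: "4 * ?I y \<le> ?I v"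
    using poincare[OF y(1,2), of 2] y01 by (simp add: no_mode_def)
  have Rle: "\<psi> R \<le> ?I v / 4" if "bounded_linear \<psi>" "\<And>a b. \<psi> (wedge a b) \<le> norm a * norm b" for \<psi>
    using area_functional_le[OF y(1) that] poin unfolding R_def by linarith
  have cd: "pi * (norm c * norm d) \<le> m"
  proof -
    have "0 \<le> pi / 2 * (norm c - norm d)\<^sup>2" by simp
    then show ?thesis by (simp add: m_def power2_eq_square field_simps)
  qed
  have \<phi>R: "\<phi> R = t1 + t2 - pi * (J c \<bullet> d)"
    using \<phi>t unfolding tR \<phi>.add \<phi>.scaleR \<phi>w by simp
  have Jcd: "J c \<bullet> d \<le> norm c * norm d" using \<phi>le[of c d] unfolding \<phi>w .
  then have Jcd': "pi * (J c \<bullet> d) \<le> m" using cd by (smt (verit) mult_left_mono pi_ge_zero)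
  have b1: "4 * (t1 + t2 - m) \<le> ?I v"
    using Rle[OF \<phi> \<phi>le] \<phi>R Jcd' by simp
  have b2: "4 * t2 \<le> ?I v"
  proof -
    have "dim {c, d} < DIM(real^4)" using dim_le_card[of "{c, d}" "{c, d}"] card_insert_le_m1[of 2 "{d}" c] 
      by (simp add: span_superset)
    then obtain w where w: "w \<noteq> 0" "\<And>y. y \<in> span {c, d} \<Longrightarrow> orthogonal w y"
      using orthogonal_to_subspace_exists by blast
    define e where "e = w /\<^sub>R norm w"
    have e: "norm e = 1" using w by (simp add: e_def)
    have "w \<bullet> c = 0" "w \<bullet> d = 0" using w(2) by (simp_all add: orthogonal_def span_base)
    then have ecd: "c \<bullet> e = 0" "d \<bullet> e = 0" by (simp_all add: e_def inner_commute)
    define q where "q = ?t *v e"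
    have q: "t2 \<le> norm q" using norm_target_mult_vec_ge[OF t, of e] e by (simp add: q_def)
    then have q0: "norm q > 0" using t by linarith
    define \<psi> where "\<psi> B = (B *v e) \<bullet> (q /\<^sub>R norm q)" for B :: "real^4^4"
    have "bounded_linear (\<lambda>B :: real^4^4. B *v e)"
      by (rule linear_conv_bounded_linear[THEN iffD1], rule linearI)
        (simp_all add: matrix_vector_mult_add_rdistrib scaleR_matrix_vector_assoc)
    then have \<psi>: "bounded_linear \<psi>"
      unfolding \<psi>_def[abs_def] by (rule bounded_linear_inner_left_comp)
    have \<psi>le: "\<psi> (wedge a b) \<le> norm a * norm b" for a b
    proof -
      have "\<psi> (wedge a b) \<le> norm (wedge a b *v e) * norm (q /\<^sub>R norm q)"
        unfolding \<psi>_def by (rule norm_cauchy_schwarz)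
      also have "\<dots> = norm (wedge a b *v e)" using q0 by simp
      also have "\<dots> \<le> norm a * norm b" by (rule norm_wedge_mult_vec_le[OF e])
      finally show ?thesis .
    qed
    have "wedge c d *v e = 0" using ecd by (simp add: wedge_mult_vec)
    then have "R *v e = q"
      unfolding q_def tR by (simp add: matrix_vector_mult_add_rdistrib scaleR_matrix_vector_assoc[symmetric])
    then have "\<psi> R = norm q" using q0 by (simp add: \<psi>_def power2_norm_eq_inner[symmetric] power2_eq_square)
    then show ?thesis using Rle[OF \<psi> \<psi>le] q by simp
  qed
  show "2 * t1 + 4 * t2 \<le> ?I u"
  proof -
    have "2 * t1 + 4 * t2 \<le> U" if "U = V + 2 * m" "4 * (t1 + t2 - m) \<le> V" "4 * t2 \<le> V" for U V :: real
      using that by (cases "m \<le> t1") (simp_all add: algebra_simps)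
    from this[OF E b1 b2] show ?thesis .
  qed
  assume eq: "?I u = 2 * t1 + 4 * t2"
  have "m = t1 \<and> V = 4 * t2" if "U = V + 2 * m" "4 * (t1 + t2 - m) \<le> V" "4 * t2 \<le> V" "U = 2 * t1 + 4 * t2" for U V :: real
    using that by (cases m t1 rule: linorder_cases) (simp_all add: algebra_simps)
  from this[OF E b1 b2 eq] have m: "m = t1" and EV: "?I v = 4 * t2" by blast+
  have c_J: "pi * (J c \<bullet> d) = m" and poin_eq: "4 * ?I y = ?I v"
    using area_functional_le[OF y(1) \<phi> \<phi>le] poin \<phi>R Jcd' m EV unfolding R_def[symmetric] by linarith+
  \<comment> \<open>Equality in the Poincare inequality for \<open>y\<close>: what remains after removing the second mode satisfies
    it with the constant 9 instead of 4, hence vanishes.\<close>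
  obtain n2 :: nat where n2: "n2 = 2" by simp
  then have n2': "1 \<le> n2" by linarith
  obtain r w c2 d2 where r: "lip_deriv (2*pi) r w" "r 0 = r (2*pi)" "no_mode n2 r"
    "\<And>k. k \<noteq> n2 \<Longrightarrow> no_mode k y \<Longrightarrow> no_mode k r"
    "\<And>s. y s = r s + (cos (real n2 * s) *\<^sub>R c2 + sin (real n2 * s) *\<^sub>R d2)"
    "?I y = ?I r + pi * ((norm c2)\<^sup>2 + (norm d2)\<^sup>2)"
    "?I v = ?I w + pi * (real n2)\<^sup>2 * ((norm c2)\<^sup>2 + (norm d2)\<^sup>2)"
    "integral {0..2*pi} (\<lambda>s. (1/2) *\<^sub>R wedge (y s) (v s))
      = integral {0..2*pi} (\<lambda>s. (1/2) *\<^sub>R wedge (r s) (w s)) + (pi * real n2) *\<^sub>R wedge c2 d2"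
    by (rule mode_split[OF n2' y(1,2)]) (rule that; assumption)
  have r012: "no_mode k r" if "k < 3" for k
    using r(3) r(4)[OF _ y01] n2 that by (cases "k = 2") auto
  have "9 * ?I r \<le> ?I w"
    using poincare[OF r(1,2), of 3] r012 by (simp add: no_mode_def)
  moreover have "?I w = 4 * ?I r" using poin_eq r(6,7) by (simp add: n2 algebra_simps)
  moreover have "0 \<le> ?I r" by (intro integral_nonneg square_norm_integrable(2)[OF r(1)]) simp
  ultimately have Ir: "?I r = 0" "?I w = 0" by linarith+
  have r0: "r s = 0" if "s \<in> {0..2*pi}" for s
  proof -
    have "((\<lambda>s. (norm (r s))\<^sup>2) has_integral 0) (cbox 0 (2*pi))"
      using integrable_integral[OF square_norm_integrable(2)[OF r(1)]] Ir by simp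
    then have "(norm (r s))\<^sup>2 = 0"
      by (rule has_integral_0_cbox_imp_0[rotated 2])
         (use that in \<open>auto intro!: continuous_intros lip_deriv_continuous[OF r(1)] simp: box_real not_le[THEN iffD2, OF pi_gt_zero]\<close>)
    then show ?thesis by simp
  qed
  have "integral {0..2*pi} (\<lambda>s. (1/2) *\<^sub>R wedge (r s) (w s)) = integral {0..2*pi} (\<lambda>s. 0)"
    by (rule integral_cong) (simp add: r0 wedge.zero_left)
  then have R2: "R = (2*pi) *\<^sub>R wedge c2 d2" using r(8) by (simp add: R_def n2)
  have c2d2: "pi * ((norm c2)\<^sup>2 + (norm d2)\<^sup>2) = t2" using EV r(7) Ir by (simp add: n2)
  have "\<phi> R = t2" using \<phi>R c_J m by simp
  then have "2 * pi * (J c2 \<bullet> d2) = pi * ((norm c2)\<^sup>2 + (norm d2)\<^sup>2)"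
    unfolding R2 \<phi>.scaleR \<phi>w c2d2 by simp
  then have "J c2 \<bullet> d2 = ((norm c2)\<^sup>2 + (norm d2)\<^sup>2) / 2" by simp
  then have d2: "d2 = J c2" by (rule double_rotation_eqI)
  have "J c \<bullet> d = ((norm c)\<^sup>2 + (norm d)\<^sup>2) / 2" using c_J by (simp add: m_def)
  then have d: "d = J c" by (rule double_rotation_eqI)
  have "orthogonal4 c (J c) c2 (J c2)"
  proof (rule calibrated_planes_orthogonal)
    show "pi * (norm c)\<^sup>2 = t1" using m by (simp add: m_def d double_rotation_norm)
    show "2 * pi * (norm c2)\<^sup>2 = t2" using c2d2 by (simp add: d2 double_rotation_norm)
    show "pi *\<^sub>R wedge c (J c) + (2 * pi) *\<^sub>R wedge c2 (J c2) = ?t"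
      unfolding tR R2 d d2 by simp
  qed
  moreover have "x s = \<alpha> + (cos s *\<^sub>R c + sin s *\<^sub>R d) + (cos (2 * s) *\<^sub>R c2 + sin (2 * s) *\<^sub>R d2)"
    if "s \<in> {0..2*pi}" for s
    using y(5)[of s] r(5)[of s] r0[OF that] by (simp add: z_def n1 n2 algebra_simps)
  ultimately show "\<exists>\<alpha> c d c2 d2. orthogonal4 c d c2 d2 \<and> norm c = norm d \<and> norm c2 = norm d2 \<and>
        (\<forall>s\<in>{0..2*pi}. x s = \<alpha> + (cos s *\<^sub>R c + sin s *\<^sub>R d) + (cos (2 * s) *\<^sub>R c2 + sin (2 * s) *\<^sub>R d2))"
    unfolding d d2 using double_rotation_norm[of c, symmetric] double_rotation_norm[of c2, symmetric] by blast
qed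

end

section \<open>From energy to length\<close>

text \<open>
  The density is continued by constants beyond the interval, so that at the end points, too, the
  inverse of its primitive is differentiable by the inverse function theorem on an open interval.
\<close>

lemma positive_density_inverse:
  assumes T: "0 < T" and c: "continuous_on {0..T} \<rho>" and pos: "\<And>s. s \<in> {0..T} \<Longrightarrow> 0 < \<rho> s"
    and S: "S = integral {0..T} \<rho>"
  obtains \<tau> \<sigma> where "0 < S" "\<And>s. s \<in> {0..T} \<Longrightarrow> \<sigma> s = integral {0..s} \<rho>"
    "\<And>s. s \<in> {0..T} \<Longrightarrow> (\<sigma> has_real_derivative \<rho> s) (at s)"
    "\<sigma> ` {0..T} = {0..S}" "\<tau> ` {0..S} = {0..T}" "\<And>s. s \<in> {0..T} \<Longrightarrow> \<tau> (\<sigma> s) = s"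
    "\<And>r. r \<in> {0..S} \<Longrightarrow> \<sigma> (\<tau> r) = r"
    "\<And>r. r \<in> {0..S} \<Longrightarrow> (\<tau> has_real_derivative 1 / \<rho> (\<tau> r)) (at r)"
proof -
  define R where "R s = \<rho> (max 0 (min T s))" for s
  have cR: "continuous_on A R" for A
    unfolding R_def[abs_def] by (intro continuous_on_compose2[OF c] continuous_intros) (use T in auto)
  have Rpos: "0 < R s" for s unfolding R_def by (rule pos) (use T in auto)
  have iR: "R integrable_on {a..b}" for a b by (rule integrable_continuous_real[OF cR])
  \<comment> \<open>any interval with \<open>[0, T]\<close> in its interior\<close>
  define a b where "a = (-1::real)" and "b = T + 1"
  define \<sigma> where "\<sigma> s = integral {a..s} R - integral {a..0} R" for s
  have d: "(\<sigma> has_real_derivative R s) (at s)" if "a < s" "s < b" for s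
  proof -
    have "((\<lambda>s. integral {a..s} R) has_real_derivative R s) (at s within {a..b})"
      by (rule integral_has_real_derivative[OF cR]) (use that in auto)
    then have "((\<lambda>s. integral {a..s} R) has_real_derivative R s) (at s)"
      using that at_within_Icc_at[of a s b] by simp
    then show ?thesis unfolding \<sigma>_def[abs_def] by (auto intro!: derivative_eq_intros)
  qed
  have \<sigma>int: "\<sigma> y - \<sigma> x = integral {x..y} R" if "a \<le> x" "x \<le> y" for x y
    using Henstock_Kurzweil_Integration.integral_combine[where f=R and a=a and c=x and b=y] that iR
    by (simp add: \<sigma>_def algebra_simps)
  have mono: "\<sigma> x < \<sigma> y" if "a \<le> x" "x < y" "y \<le> b" for x y
  proof -
    have "\<exists>m\<in>{x..y}. \<forall>s\<in>{x..y}. R m \<le> R s"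
      by (rule continuous_attains_inf[OF compact_Icc _ cR]) (use that in auto)
    then obtain m where m: "\<And>s. s \<in> {x..y} \<Longrightarrow> R m \<le> R s" "m \<in> {x..y}" by blast
    have "R m * (y - x) \<le> integral {x..y} R"
      using integral_le[OF integrable_const_ivl iR, of x y "R m"] m that by (simp add: mult.commute)
    moreover have "0 < R m * (y - x)" using Rpos that by simp
    ultimately show ?thesis using \<sigma>int[of x y] that by linarith
  qed
  have \<sigma>0: "\<sigma> 0 = 0" by (simp add: \<sigma>_def)
  have eq: "\<sigma> s = integral {0..s} \<rho>" if "s \<in> {0..T}" for s
  proof -
    have "\<sigma> s = integral {0..s} R" using \<sigma>int[of 0 s] that \<sigma>0 by (simp add: a_def)
    also have "\<dots> = integral {0..s} \<rho>" by (rule integral_cong) (use that in \<open>auto simp: R_def\<close>)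
    finally show ?thesis .
  qed
  have \<sigma>T: "\<sigma> T = S" using eq[of T] T S by simp
  have S0: "0 < S" using mono[of 0 T] T \<sigma>0 \<sigma>T by (simp add: a_def b_def)
  have inj: "inj_on \<sigma> {a..b}"
  proof (rule inj_onI)
    fix x y assume "x \<in> {a..b}" "y \<in> {a..b}" "\<sigma> x = \<sigma> y"
    then show "x = y" using mono[of x y] mono[of y x] by (cases x y rule: linorder_cases) auto
  qed
  define \<tau> where "\<tau> = inv_into {a..b} \<sigma>"
  have \<tau>\<sigma>: "\<tau> (\<sigma> s) = s" if "s \<in> {a..b}" for s using inj that by (simp add: \<tau>_def)
  have c\<sigma>: "continuous_on {a..b} \<sigma>"
    unfolding \<sigma>_def[abs_def] by (intro continuous_intros indefinite_integral_continuous_1 iR)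
  have ab: "a \<le> b" using T by (simp add: a_def b_def)
  have img: "\<sigma> ` {x..y} = {\<sigma> x..\<sigma> y}" if "a \<le> x" "x \<le> y" "y \<le> b" for x y
  proof
    show "\<sigma> ` {x..y} \<subseteq> {\<sigma> x..\<sigma> y}"
      using mono that by (fastforce simp: le_less)
    show "{\<sigma> x..\<sigma> y} \<subseteq> \<sigma> ` {x..y}"
    proof
      fix z assume "z \<in> {\<sigma> x..\<sigma> y}"
      then show "z \<in> \<sigma> ` {x..y}"
        using IVT'[of \<sigma> x z y] that continuous_on_subset[OF c\<sigma>, of "{x..y}"] by auto
    qed
  qed
  have img0: "\<sigma> ` {0..T} = {0..S}" using img[of 0 T] \<sigma>0 \<sigma>T T by (simp add: a_def b_def)
  have c\<tau>: "continuous_on {\<sigma> a..\<sigma> b} \<tau>"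
    using continuous_on_inv[OF c\<sigma> compact_Icc, of \<tau>] \<tau>\<sigma> img[of a b] ab by simp
  have ends: "\<sigma> a < 0" "S < \<sigma> b" using mono[of a 0] mono[of T b] T \<sigma>0 \<sigma>T by (simp_all add: a_def b_def)
  have \<sigma>\<tau>: "\<sigma> (\<tau> r) = r" if "r \<in> {\<sigma> a..\<sigma> b}" for r
    using img[of a b] ab that f_inv_into_f[of r \<sigma> "{a..b}"] by (simp add: \<tau>_def)
  have img\<tau>: "\<tau> ` {0..S} = {0..T}"
  proof -
    have "\<tau> ` \<sigma> ` {0..T} = (\<lambda>x. x) ` {0..T}"
      unfolding image_image by (rule image_cong) (use \<tau>\<sigma> in \<open>auto simp: a_def b_def\<close>)
    then show ?thesis unfolding img0 by simp
  qed
  have d\<tau>: "(\<tau> has_real_derivative 1 / \<rho> (\<tau> r)) (at r)" if r: "r \<in> {0..S}" for r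
  proof -
    have tr: "\<tau> r \<in> {0..T}" using img\<tau> r by blast
    have "(\<tau> has_real_derivative inverse (R (\<tau> r))) (at r)"
    proof (rule DERIV_inverse_function[where f=\<sigma> and a="\<sigma> a" and b="\<sigma> b"])
      show "(\<sigma> has_real_derivative R (\<tau> r)) (at (\<tau> r))" by (rule d) (use tr in \<open>auto simp: a_def b_def\<close>)
      show "R (\<tau> r) \<noteq> 0" using Rpos[of "\<tau> r"] by simp
      show "\<sigma> a < r" "r < \<sigma> b" using ends r by auto
      show "\<sigma> (\<tau> y) = y" if "\<sigma> a < y" "y < \<sigma> b" for y using \<sigma>\<tau> that by simp
      show "isCont \<tau> r"
        using c\<tau> ends r by (intro continuous_on_interior[of "{\<sigma> a..\<sigma> b}"]) auto
    qed
    moreover have "R (\<tau> r) = \<rho> (\<tau> r)" using tr by (simp add: R_def)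
    ultimately show ?thesis by (simp add: inverse_eq_divide)
  qed
  have d\<sigma>: "(\<sigma> has_real_derivative \<rho> s) (at s)" if "s \<in> {0..T}" for s
    using d[of s] that by (simp add: a_def b_def R_def)
  have \<tau>\<sigma>0: "\<tau> (\<sigma> s) = s" if "s \<in> {0..T}" for s by (rule \<tau>\<sigma>) (use that in \<open>auto simp: a_def b_def\<close>)
  have \<sigma>\<tau>0: "\<sigma> (\<tau> r) = r" if "r \<in> {0..S}" for r by (rule \<sigma>\<tau>) (use that ends in auto)
  show thesis by (rule that[OF S0 eq d\<sigma> img0 img\<tau> \<tau>\<sigma>0 \<sigma>\<tau>0 d\<tau>])
qed

text \<open>
  Traversing the curve over \<open>[0, 2\<pi>]\<close> in such a way that the time \<open>ds\<close> takes the time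
  \<open>2\<pi> \<rho> ds / S\<close> turns its energy into a multiple of \<open>\<integral> |u|\<^sup>2 / \<rho>\<close>.
\<close>

lemma reparam_to_circle:
  fixes x u :: "real \<Rightarrow> real^4"
  assumes x: "lip_deriv T x u" and t: "lip_deriv T t (\<lambda>s. (1/2) *\<^sub>R wedge (x s) (u s))"
    and c: "continuous_on {0..T} \<rho>" and pos: "\<And>s. s \<in> {0..T} \<Longrightarrow> 0 < \<rho> s"
    and S: "S = integral {0..T} \<rho>"
  obtains X v where "lip_deriv (2*pi) X v"
    "\<And>s. s \<in> {0..T} \<Longrightarrow> x s = X ((2*pi/S) * integral {0..s} \<rho>)" "0 < S"
    "integral {0..2*pi} (\<lambda>r. (1/2) *\<^sub>R wedge (X r) (v r)) = t T - t 0"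
    "integral {0..2*pi} (\<lambda>r. (norm (v r))\<^sup>2) = S / (2*pi) * integral {0..T} (\<lambda>s. (norm (u s))\<^sup>2 / \<rho> s)"
proof -
  have T: "0 < T" using x by (simp add: lip_deriv_def)
  have S0: "0 < S" using positive_density_inverse[OF T c pos S] by blast
  define k where "k = 2*pi / S"
  have k: "0 < k" using S0 by (simp add: k_def)
  have kS: "integral {0..T} (\<lambda>s. k * \<rho> s) = 2*pi" using S0 by (simp add: k_def S[symmetric])
  have ck: "continuous_on {0..T} (\<lambda>s. k * \<rho> s)" by (intro continuous_intros c)
  have kpos: "0 < k * \<rho> s" if "s \<in> {0..T}" for s using pos[OF that] k by simp
  obtain \<tau> \<sigma> where "0 < 2*pi" and \<sigma>: "\<And>s. s \<in> {0..T} \<Longrightarrow> \<sigma> s = integral {0..s} (\<lambda>s. k * \<rho> s)"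
    "\<And>s. s \<in> {0..T} \<Longrightarrow> (\<sigma> has_real_derivative k * \<rho> s) (at s)"
    "\<sigma> ` {0..T} = {0..2*pi}" "\<tau> ` {0..2*pi} = {0..T}" "\<And>s. s \<in> {0..T} \<Longrightarrow> \<tau> (\<sigma> s) = s"
    "\<And>r. r \<in> {0..2*pi} \<Longrightarrow> \<sigma> (\<tau> r) = r"
    "\<And>r. r \<in> {0..2*pi} \<Longrightarrow> (\<tau> has_real_derivative 1 / (k * \<rho> (\<tau> r))) (at r)"
    by (rule positive_density_inverse[OF T ck kpos kS[symmetric]]) (assumption | (rule that; assumption))+
  define v where "v r = (1 / (k * \<rho> (\<tau> r))) *\<^sub>R u (\<tau> r)" for r
  have c\<tau>: "continuous_on {0..2*pi} \<tau>"
    by (rule DERIV_continuous_on) (use \<sigma>(7) in \<open>auto intro: has_field_derivative_at_within\<close>)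
  have img: "\<tau> r \<in> {0..T}" if "r \<in> {0..2*pi}" for r using \<sigma>(4) that by blast
  have c\<tau>': "continuous_on {0..2*pi} (\<lambda>r. 1 / (k * \<rho> (\<tau> r)))"
  proof (rule continuous_on_divide[OF continuous_on_const])
    show "continuous_on {0..2*pi} (\<lambda>r. k * \<rho> (\<tau> r))"
      by (rule continuous_on_compose2[OF ck c\<tau>]) (use img in auto)
    show "\<forall>r\<in>{0..2*pi}. k * \<rho> (\<tau> r) \<noteq> 0" using kpos[OF img] by (metis less_irrefl)
  qed
  have diff: "\<sigma> differentiable_on (\<tau> ` {0..2*pi})"
    unfolding \<sigma>(4) differentiable_on_def
    using \<sigma>(2) by (meson differentiable_at_withinI real_differentiable_def)
  have rep: "lip_deriv (2*pi) (\<lambda>r. f (\<tau> r)) (\<lambda>r. (1 / (k * \<rho> (\<tau> r))) *\<^sub>R w (\<tau> r))" if "lip_deriv T f w" for f w :: "real \<Rightarrow> 'a::euclidean_space"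
    by (rule lip_deriv_reparam[OF that _ img _ c\<tau>' diff \<sigma>(6)]) (use \<sigma>(7) in \<open>auto intro: has_field_derivative_at_within\<close>)
  have X: "lip_deriv (2*pi) (\<lambda>r. x (\<tau> r)) v" using rep[OF x] by (simp add: v_def[abs_def])
  have "lip_deriv (2*pi) (\<lambda>r. t (\<tau> r)) (\<lambda>r. (1/2) *\<^sub>R wedge (x (\<tau> r)) (v r))"
    using rep[OF t] by (simp add: v_def wedge.scaleR_right mult.commute)
  from lip_deriv_has_integral[OF this]
  have "integral {0..2*pi} (\<lambda>r. (1/2) *\<^sub>R wedge (x (\<tau> r)) (v r)) = t (\<tau> (2*pi)) - t (\<tau> 0)"
    by (rule integral_unique)
  moreover have "\<tau> 0 = 0" using \<sigma>(1)[of 0] \<sigma>(5)[of 0] T by simp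
  moreover have "\<tau> (2*pi) = T" using \<sigma>(1)[of T] \<sigma>(5)[of T] T kS by simp
  ultimately have area: "integral {0..2*pi} (\<lambda>r. (1/2) *\<^sub>R wedge (x (\<tau> r)) (v r)) = t T - t 0" by simp
  have "(\<lambda>r. (norm (v r))\<^sup>2) absolutely_integrable_on {0..2*pi}"
    by (rule nonnegative_absolutely_integrable_1[OF square_norm_integrable(1)[OF X]]) simp
  then have "integral {0..T} (\<lambda>s. \<bar>k * \<rho> s\<bar> *\<^sub>R (norm (v (\<sigma> s)))\<^sup>2) = integral {0..2*pi} (\<lambda>r. (norm (v r))\<^sup>2)"
    using has_absolute_integral_change_of_variables_real[of "{0..T}" \<sigma> "\<lambda>s. k * \<rho> s" "\<lambda>r. (norm (v r))\<^sup>2"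
       "integral {0..2*pi} (\<lambda>r. (norm (v r))\<^sup>2)"] \<sigma>(2,3) inj_on_inverseI[of "{0..T}" \<tau> \<sigma>] \<sigma>(5)
    by (simp add: has_field_derivative_at_within)
  moreover have "integral {0..T} (\<lambda>s. \<bar>k * \<rho> s\<bar> *\<^sub>R (norm (v (\<sigma> s)))\<^sup>2) = integral {0..T} (\<lambda>s. (1/k) * ((norm (u s))\<^sup>2 / \<rho> s))"
  proof (rule integral_cong)
    fix s assume s: "s \<in> {0..T}"
    have n: "norm (v (\<sigma> s)) = norm (u s) / (k * \<rho> s)"
      unfolding v_def \<sigma>(5)[OF s] norm_scaleR using kpos[OF s] by simp
    have "p * (a / p)\<^sup>2 = a\<^sup>2 / p" if "0 < p" for p a :: real using that by (simp add: power2_eq_square)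
    from this[OF kpos[OF s]]
    show "\<bar>k * \<rho> s\<bar> *\<^sub>R (norm (v (\<sigma> s)))\<^sup>2 = (1/k) * ((norm (u s))\<^sup>2 / \<rho> s)"
      unfolding n abs_of_pos[OF kpos[OF s]] by simp
  qed
  moreover have "integral {0..T} (\<lambda>s. (1/k) * ((norm (u s))\<^sup>2 / \<rho> s)) = (1/k) * integral {0..T} (\<lambda>s. (norm (u s))\<^sup>2 / \<rho> s)"
    by (rule integral_mult_right)
  moreover have "1 / k = S / (2*pi)" by (simp add: k_def)
  ultimately have energy: "integral {0..2*pi} (\<lambda>r. (norm (v r))\<^sup>2) = S / (2*pi) * integral {0..T} (\<lambda>s. (norm (u s))\<^sup>2 / \<rho> s)"
    by (simp only:)
  have "x s = x (\<tau> ((2*pi/S) * integral {0..s} \<rho>))" if "s \<in> {0..T}" for s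
    using \<sigma>(1,5)[OF that] by (simp add: k_def)
  then show thesis using that[OF X _ S0 area energy] by blast
qed

lemma weighted_length_bound:
  fixes x u :: "real \<Rightarrow> real^4"
  assumes on: "orthonormal4 x1 y1 x2 y2" and t12: "t2 \<le> t1" "0 < t2"
    and x: "lip_deriv T x u" and t: "lip_deriv T t (\<lambda>s. (1/2) *\<^sub>R wedge (x s) (u s))"
    and closed: "x 0 = x T" and area: "t T - t 0 = t1 *\<^sub>R wedge x1 y1 + t2 *\<^sub>R wedge x2 y2"
    and c: "continuous_on {0..T} \<rho>" and pos: "\<And>s. s \<in> {0..T} \<Longrightarrow> 0 < \<rho> s"
  shows "4 * pi * t1 + 8 * pi * t2 \<le> integral {0..T} \<rho> * integral {0..T} (\<lambda>s. (norm (u s))\<^sup>2 / \<rho> s)"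
proof -
  have T: "0 < T" using x by (simp add: lip_deriv_def)
  define S where "S = integral {0..T} \<rho>"
  obtain X v where X: "lip_deriv (2*pi) X v"
    "\<And>s. s \<in> {0..T} \<Longrightarrow> x s = X ((2*pi/S) * integral {0..s} \<rho>)" "0 < S"
    "integral {0..2*pi} (\<lambda>r. (1/2) *\<^sub>R wedge (X r) (v r)) = t T - t 0"
    "integral {0..2*pi} (\<lambda>r. (norm (v r))\<^sup>2) = S / (2*pi) * integral {0..T} (\<lambda>s. (norm (u s))\<^sup>2 / \<rho> s)"
    using reparam_to_circle[OF x t c pos S_def] by blast
  have "X 0 = X (2*pi)" using X(2)[of 0] X(2)[of T] X(3) T closed by (simp add: S_def)
  from energy_bound[OF on t12 X(1) this X(4)[unfolded area]]
  have "2 * t1 + 4 * t2 \<le> S / (2*pi) * integral {0..T} (\<lambda>s. (norm (u s))\<^sup>2 / \<rho> s)" unfolding X(5) .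
  then show ?thesis unfolding S_def[symmetric] by (simp add: field_simps)
qed

text \<open>
  Taking for \<open>\<rho>\<close> the speed itself would turn the weighted bound into the square of the length. The
  speed is neither continuous nor positive, so it is replaced by \<open>e\<close> plus the norm of a difference quotient;
  first the quotients converge, then \<open>e\<close> tends to 0.
\<close>

lemma length_bound:
  fixes x u :: "real \<Rightarrow> real^4"
  assumes on: "orthonormal4 x1 y1 x2 y2" and t12: "t2 \<le> t1" "0 < t2"
    and x: "lip_deriv T x u" and t: "lip_deriv T t (\<lambda>s. (1/2) *\<^sub>R wedge (x s) (u s))"
    and closed: "x 0 = x T" and area: "t T - t 0 = t1 *\<^sub>R wedge x1 y1 + t2 *\<^sub>R wedge x2 y2"
  shows "4 * pi * t1 + 8 * pi * t2 \<le> (integral {0..T} (\<lambda>s. norm (u s)))\<^sup>2"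
proof -
  let ?K = "4 * pi * t1 + 8 * pi * t2" and ?\<Lambda> = "integral {0..T} (\<lambda>s. norm (u s))"
  from x obtain L B N where F: "0 < T" "L-lipschitz_on {0..T} x" "0 < B"
    "\<And>s. s \<in> {0..T} \<Longrightarrow> norm (u s) \<le> B" "negligible N"
    "\<And>s. s \<in> {0..T} - N \<Longrightarrow> (x has_vector_derivative u s) (at s within {0..T})"
    by (elim lip_derivE) blast
  have M: "negligible (insert T N)" using F(5) by simp
  have L0: "0 \<le> L" using F(2) lipschitz_on_nonneg by blast
  have uint: "(\<lambda>s. norm (u s)) integrable_on {0..T}"
    using lip_deriv_absolutely_integrable[OF x] by (simp add: absolutely_integrable_on_def)
  have bound: "?K \<le> (?\<Lambda> + e * T) * ?\<Lambda>" if e: "0 < e" for e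
  proof -
    define \<rho> where "\<rho> n s = norm (clamped_quotient T x n s) + e" for n s
    have c\<rho>: "continuous_on {0..T} (\<rho> n)" for n
      unfolding \<rho>_def[abs_def] by (intro continuous_intros clamped_quotient_continuous lip_deriv_continuous[OF x])
    have e\<rho>: "e \<le> \<rho> n s" for n s by (simp add: \<rho>_def)
    have \<rho>lim: "(\<lambda>n. \<rho> n s) \<longlonglongrightarrow> norm (u s) + e" if "s \<in> {0..T} - insert T N" for s
      unfolding \<rho>_def using F(6)[of s] that
      by (intro tendsto_add tendsto_norm clamped_quotient_tendsto tendsto_const) auto
    have l1: "(\<lambda>n. integral {0..T} (\<rho> n)) \<longlonglongrightarrow> integral {0..T} (\<lambda>s. norm (u s) + e)"
    proof (rule bounded_convergence_interval(2)[OF M])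
      show "norm (\<rho> n s) \<le> L + e" if "s \<in> {0..T}" for n s
        using clamped_quotient_le[OF F(2) that, of n] e by (simp add: \<rho>_def)
    qed (use \<rho>lim integrable_continuous_real[OF c\<rho>] in auto)
    have wint: "(\<lambda>s. (norm (u s))\<^sup>2 / \<rho> n s) integrable_on {0..T}" for n
    proof -
      have "(\<lambda>s. (1 / \<rho> n s) * (norm (u s))\<^sup>2) absolutely_integrable_on {0..T}"
      proof (rule absolutely_integrable_bounded_measurable_product_real)
        have c: "continuous_on {0..T} (\<lambda>s. 1 / \<rho> n s)"
          by (intro continuous_intros c\<rho>) (use e e\<rho> in \<open>metis not_le\<close>)
        then show "(\<lambda>s. 1 / \<rho> n s) \<in> borel_measurable (lebesgue_on {0..T})"
          by (intro continuous_imp_measurable_on_sets_lebesgue) auto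
        show "bounded ((\<lambda>s. 1 / \<rho> n s) ` {0..T})"
          using c by (simp add: compact_continuous_image compact_imp_bounded)
        show "(\<lambda>s. (norm (u s))\<^sup>2) absolutely_integrable_on {0..T}"
          by (rule nonnegative_absolutely_integrable_1[OF square_norm_integrable(1)[OF x]]) simp
      qed simp
      from set_lebesgue_integral_eq_integral(1)[OF this] show ?thesis by simp
    qed
    note l2 = bounded_convergence_interval[OF M, where q="\<lambda>n s. (norm (u s))\<^sup>2 / \<rho> n s" and a=0 and b=T
      and v="\<lambda>s. (norm (u s))\<^sup>2 / (norm (u s) + e)" and B="B\<^sup>2 / e"]
    have bd2: "norm ((norm (u s))\<^sup>2 / \<rho> n s) \<le> B\<^sup>2 / e" if "s \<in> {0..T}" for n s
    proof -
      have "0 < \<rho> n s" using e e\<rho>[of n s] by linarith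
      then show ?thesis using F(4)[OF that] e e\<rho>[of n s]
        by (auto intro!: frac_le power_mono)
    qed
    have lim2: "(\<lambda>n. (norm (u s))\<^sup>2 / \<rho> n s) \<longlonglongrightarrow> (norm (u s))\<^sup>2 / (norm (u s) + e)" if "s \<in> {0..T} - insert T N" for s
      by (intro tendsto_divide tendsto_const \<rho>lim that) (use e norm_ge_zero[of "u s"] in linarith)
    have "?K \<le> integral {0..T} (\<rho> n) * integral {0..T} (\<lambda>s. (norm (u s))\<^sup>2 / \<rho> n s)" for n
      by (rule weighted_length_bound[OF on t12 x t closed area c\<rho>]) (use e e\<rho> in \<open>meson less_le_trans\<close>)
    then have "?K \<le> integral {0..T} (\<lambda>s. norm (u s) + e) * integral {0..T} (\<lambda>s. (norm (u s))\<^sup>2 / (norm (u s) + e))"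
      by (intro LIMSEQ_le_const[OF tendsto_mult[OF l1 l2(2)[OF wint bd2 lim2]]]) auto
    also have "integral {0..T} (\<lambda>s. norm (u s) + e) = ?\<Lambda> + e * T"
      using F(1) by (subst integral_add[OF uint]) (simp_all add: mult.commute integrable_const_ivl)
    also have "(?\<Lambda> + e * T) * integral {0..T} (\<lambda>s. (norm (u s))\<^sup>2 / (norm (u s) + e)) \<le> (?\<Lambda> + e * T) * ?\<Lambda>"
    proof (rule mult_left_mono)
      show "integral {0..T} (\<lambda>s. (norm (u s))\<^sup>2 / (norm (u s) + e)) \<le> ?\<Lambda>"
      proof (rule integral_le[OF l2(1)[OF wint bd2 lim2] uint])
        fix s
        have "0 < norm (u s) + e" using e norm_ge_zero[of "u s"] by linarith
        then show "(norm (u s))\<^sup>2 / (norm (u s) + e) \<le> norm (u s)"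
          using e by (simp add: divide_le_eq power2_eq_square distrib_left)
      qed
      show "0 \<le> ?\<Lambda> + e * T" using e F(1) integral_nonneg[OF uint] by (simp add: add_nonneg_nonneg)
    qed
    finally show ?thesis .
  qed
  have "((\<lambda>e. (?\<Lambda> + e * T) * ?\<Lambda>) \<longlongrightarrow> (?\<Lambda> + 0 * T) * ?\<Lambda>) (at_right 0)"
    by (intro tendsto_intros)
  then have "?K \<le> (?\<Lambda> + 0 * T) * ?\<Lambda>"
    by (rule tendsto_lowerbound) (auto intro!: eventually_mono[OF eventually_at_right_less[of 0]] bound)
  then show ?thesis by (simp add: power2_eq_square)
qed

section \<open>Extremals and minimizers over the centre\<close>

lemma full_period_integrals:
  fixes \<omega> T :: real
  assumes \<omega>: "\<omega> \<noteq> 0" and T: "0 \<le> T" and full: "sin (\<omega> * T) = 0" "cos (\<omega> * T) = 1"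
  shows "((\<lambda>s. cos (\<omega> * s)) has_integral 0) {0..T}" "((\<lambda>s. sin (\<omega> * s)) has_integral 0) {0..T}"
proof -
  have "((\<lambda>s. cos (\<omega> * s)) has_integral sin (\<omega> * T) / \<omega> - sin (\<omega> * 0) / \<omega>) {0..T}"
    by (rule fundamental_theorem_of_calculus[OF T])
      (use \<omega> in \<open>auto intro!: derivative_eq_intros simp flip: has_real_derivative_iff_has_vector_derivative\<close>)
  then show "((\<lambda>s. cos (\<omega> * s)) has_integral 0) {0..T}" using full by simp
  have "((\<lambda>s. sin (\<omega> * s)) has_integral - cos (\<omega> * T) / \<omega> - - cos (\<omega> * 0) / \<omega>) {0..T}"
    by (rule fundamental_theorem_of_calculus[OF T])
      (use \<omega> in \<open>auto intro!: derivative_eq_intros simp flip: has_real_derivative_iff_has_vector_derivative\<close>)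
  then show "((\<lambda>s. sin (\<omega> * s)) has_integral 0) {0..T}" using full by simp
qed

lemma full_period_product_integrals:
  fixes \<alpha> \<beta> T :: real
  assumes \<omega>: "\<alpha> \<noteq> \<beta>" "0 < \<alpha>" "0 < \<beta>" and T: "0 \<le> T"
    and fa: "sin (\<alpha> * T) = 0" "cos (\<alpha> * T) = 1" and fb: "sin (\<beta> * T) = 0" "cos (\<beta> * T) = 1"
  shows "((\<lambda>s. cos (\<alpha> * s) * cos (\<beta> * s)) has_integral 0) {0..T}"
    "((\<lambda>s. sin (\<alpha> * s) * sin (\<beta> * s)) has_integral 0) {0..T}"
    "((\<lambda>s. sin (\<alpha> * s) * cos (\<beta> * s)) has_integral 0) {0..T}"
    "((\<lambda>s. cos (\<alpha> * s) * sin (\<beta> * s)) has_integral 0) {0..T}"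
proof -
  have "sin ((\<alpha> + \<beta>) * T) = 0" "cos ((\<alpha> + \<beta>) * T) = 1" "\<alpha> + \<beta> \<noteq> 0"
    using assms by (simp_all add: distrib_right cos_add sin_add)
  note p = full_period_integrals[OF this(3) T this(1,2)]
  have "sin ((\<alpha> - \<beta>) * T) = 0" "cos ((\<alpha> - \<beta>) * T) = 1" "\<alpha> - \<beta> \<noteq> 0"
    using assms by (simp_all add: left_diff_distrib cos_diff sin_diff)
  note m = full_period_integrals[OF this(3) T this(1,2)]
  show "((\<lambda>s. cos (\<alpha> * s) * cos (\<beta> * s)) has_integral 0) {0..T}"
    using has_integral_divide[OF has_integral_add[OF m(1) p(1)], of 2]
    by (simp add: cos_times_cos distrib_right left_diff_distrib)
  show "((\<lambda>s. sin (\<alpha> * s) * sin (\<beta> * s)) has_integral 0) {0..T}"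
    using has_integral_divide[OF has_integral_diff[OF m(1) p(1)], of 2]
    by (simp add: sin_times_sin distrib_right left_diff_distrib)
  show "((\<lambda>s. sin (\<alpha> * s) * cos (\<beta> * s)) has_integral 0) {0..T}"
    using has_integral_divide[OF has_integral_add[OF p(2) m(2)], of 2]
    by (simp add: sin_times_cos distrib_right left_diff_distrib)
  show "((\<lambda>s. cos (\<alpha> * s) * sin (\<beta> * s)) has_integral 0) {0..T}"
    using has_integral_divide[OF has_integral_diff[OF p(2) m(2)], of 2]
    by (simp add: cos_times_sin distrib_right left_diff_distrib)
qed

text \<open>
  The primitive, vanishing at \<open>0\<close>, of the rotating vector \<open>cos (\<alpha> s) a + sin (\<alpha> s) b\<close>.
\<close>

definition circle_arc :: "real^4 \<Rightarrow> real^4 \<Rightarrow> real \<Rightarrow> real \<Rightarrow> real^4" where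
  "circle_arc a b \<alpha> s = (sin (\<alpha> * s) / \<alpha>) *\<^sub>R a + ((1 - cos (\<alpha> * s)) / \<alpha>) *\<^sub>R b"

lemma circle_arc_has_vector_derivative:
  assumes "\<alpha> \<noteq> 0"
  shows "(circle_arc a b \<alpha> has_vector_derivative cos (\<alpha> * s) *\<^sub>R a + sin (\<alpha> * s) *\<^sub>R b) (at s within S)"
  unfolding circle_arc_def[abs_def] using assms
  by (auto intro!: derivative_eq_intros simp: has_vector_derivative_def algebra_simps)

lemma extremal_position_has_vector_derivative:
  assumes "\<phi>1 \<noteq> 0" "\<phi>2 \<noteq> 0"
  shows "((\<lambda>s. circle_arc a1 b1 (2 * \<phi>1) s + circle_arc a2 b2 (2 * \<phi>2) s) has_vector_derivative
     extremal_control a1 b1 a2 b2 \<phi>1 \<phi>2 s) (at s within S)"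
  using has_vector_derivative_add[OF circle_arc_has_vector_derivative[of "2 * \<phi>1" a1 b1 s S]
      circle_arc_has_vector_derivative[of "2 * \<phi>2" a2 b2 s S]] assms
  by (simp add: extremal_control_def add.assoc)

lemma integral_extremal_control:
  assumes "\<phi>1 \<noteq> 0" "\<phi>2 \<noteq> 0" "0 \<le> s"
  shows "integral {0..s} (extremal_control a1 b1 a2 b2 \<phi>1 \<phi>2) = circle_arc a1 b1 (2 * \<phi>1) s + circle_arc a2 b2 (2 * \<phi>2) s"
proof -
  have "(extremal_control a1 b1 a2 b2 \<phi>1 \<phi>2 has_integral
     (circle_arc a1 b1 (2 * \<phi>1) s + circle_arc a2 b2 (2 * \<phi>2) s) - (circle_arc a1 b1 (2 * \<phi>1) 0 + circle_arc a2 b2 (2 * \<phi>2) 0)) {0..s}"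
    by (rule fundamental_theorem_of_calculus[OF assms(3)]) (rule extremal_position_has_vector_derivative[OF assms(1,2)])
  then show ?thesis by (simp add: integral_unique circle_arc_def)
qed

lemma continuous_on_extremal_control: "continuous_on S (extremal_control a1 b1 a2 b2 \<phi>1 \<phi>2)"
  unfolding extremal_control_def[abs_def] by (intro continuous_intros)

lemma circle_arc_area_same:
  assumes "\<alpha> \<noteq> 0"
  shows "wedge (circle_arc a b \<alpha> s) (cos (\<alpha> * s) *\<^sub>R a + sin (\<alpha> * s) *\<^sub>R b) = ((1 - cos (\<alpha> * s)) / \<alpha>) *\<^sub>R wedge a b"
proof -
  let ?c = "cos (\<alpha> * s)" and ?s = "sin (\<alpha> * s)"
  have "wedge (circle_arc a b \<alpha> s) (?c *\<^sub>R a + ?s *\<^sub>R b) = (?s / \<alpha> * ?s) *\<^sub>R wedge a b + ((1 - ?c) / \<alpha> * ?c) *\<^sub>R wedge b a"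
    by (simp add: circle_arc_def wedge.add_left wedge.add_right wedge.scaleR_left wedge.scaleR_right mult.commute)
  also have "\<dots> = (?s / \<alpha> * ?s - (1 - ?c) / \<alpha> * ?c) *\<^sub>R wedge a b"
    by (simp add: wedge_swap[of b a] scaleR_left_diff_distrib)
  also have "?s / \<alpha> * ?s - (1 - ?c) / \<alpha> * ?c = (?s * ?s - (1 - ?c) * ?c) / \<alpha>"
    unfolding diff_divide_distrib[of "?s * ?s"] times_divide_eq_left ..
  also have "?s * ?s - (1 - ?c) * ?c = 1 - ?c"
    using sin_cos_squared_add3[of "\<alpha> * s"] by (simp add: algebra_simps)
  finally show ?thesis .
qed

lemma circle_arc_area_cross:
  assumes \<omega>: "\<alpha> \<noteq> \<beta>" "0 < \<alpha>" "0 < \<beta>" and T: "0 \<le> T"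
    and fa: "sin (\<alpha> * T) = 0" "cos (\<alpha> * T) = 1" and fb: "sin (\<beta> * T) = 0" "cos (\<beta> * T) = 1"
  shows "((\<lambda>s. wedge (circle_arc a b \<alpha> s) (cos (\<beta> * s) *\<^sub>R a' + sin (\<beta> * s) *\<^sub>R b')) has_integral 0) {0..T}"
proof -
  note I = full_period_product_integrals[OF assms] full_period_integrals[of \<beta> T]
  have "((\<lambda>s. (sin (\<alpha> * s) * cos (\<beta> * s)) *\<^sub>R ((1/\<alpha>) *\<^sub>R wedge a a') + (sin (\<alpha> * s) * sin (\<beta> * s)) *\<^sub>R ((1/\<alpha>) *\<^sub>R wedge a b')
     + ((cos (\<beta> * s) - cos (\<alpha> * s) * cos (\<beta> * s)) *\<^sub>R ((1/\<alpha>) *\<^sub>R wedge b a') + (sin (\<beta> * s) - cos (\<alpha> * s) * sin (\<beta> * s)) *\<^sub>R ((1/\<alpha>) *\<^sub>R wedge b b')))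
     has_integral 0 *\<^sub>R ((1/\<alpha>) *\<^sub>R wedge a a') + 0 *\<^sub>R ((1/\<alpha>) *\<^sub>R wedge a b')
       + ((0 - 0) *\<^sub>R ((1/\<alpha>) *\<^sub>R wedge b a') + (0 - 0) *\<^sub>R ((1/\<alpha>) *\<^sub>R wedge b b'))) {0..T}"
    by (intro has_integral_add has_integral_scaleR_left has_integral_diff I T fb) (use \<omega> in auto)
  moreover have "(sin (\<alpha> * s) * cos (\<beta> * s)) *\<^sub>R ((1/\<alpha>) *\<^sub>R wedge a a') + (sin (\<alpha> * s) * sin (\<beta> * s)) *\<^sub>R ((1/\<alpha>) *\<^sub>R wedge a b')
     + ((cos (\<beta> * s) - cos (\<alpha> * s) * cos (\<beta> * s)) *\<^sub>R ((1/\<alpha>) *\<^sub>R wedge b a') + (sin (\<beta> * s) - cos (\<alpha> * s) * sin (\<beta> * s)) *\<^sub>R ((1/\<alpha>) *\<^sub>R wedge b b'))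
     = wedge (circle_arc a b \<alpha> s) (cos (\<beta> * s) *\<^sub>R a' + sin (\<beta> * s) *\<^sub>R b')" for s
    by (simp only: circle_arc_def wedge.add_left wedge.add_right wedge.scaleR_left wedge.scaleR_right)
       (simp add: algebra_simps diff_divide_distrib)
  ultimately show ?thesis by simp
qed

text \<open>
  Each circle contributes its own area, and modes of different frequency do not interact over a
  common period.
\<close>

lemma extremal_common_period:
  assumes \<phi>: "0 < \<phi>1" "0 < \<phi>2" "\<phi>1 \<noteq> \<phi>2" and T: "0 < T"
    and f1: "sin (2 * \<phi>1 * T) = 0" "cos (2 * \<phi>1 * T) = 1" and f2: "sin (2 * \<phi>2 * T) = 0" "cos (2 * \<phi>2 * T) = 1"
  shows "extremal a1 b1 a2 b2 \<phi>1 \<phi>2 T = (0, (T / (4 * \<phi>1)) *\<^sub>R wedge a1 b1 + (T / (4 * \<phi>2)) *\<^sub>R wedge a2 b2)"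
proof -
  let ?u = "extremal_control a1 b1 a2 b2 \<phi>1 \<phi>2"
  let ?P1 = "circle_arc a1 b1 (2 * \<phi>1)" and ?P2 = "circle_arc a2 b2 (2 * \<phi>2)"
  let ?U1 = "\<lambda>s. cos (2 * \<phi>1 * s) *\<^sub>R a1 + sin (2 * \<phi>1 * s) *\<^sub>R b1"
  let ?U2 = "\<lambda>s. cos (2 * \<phi>2 * s) *\<^sub>R a2 + sin (2 * \<phi>2 * s) *\<^sub>R b2"
  have u: "?u s = ?U1 s + ?U2 s" for s by (simp add: extremal_control_def add.assoc)
  have pos: "integral {0..s} ?u = ?P1 s + ?P2 s" if "0 \<le> s" for s
    by (rule integral_extremal_control) (use \<phi> that in auto)
  have own: "((\<lambda>s. wedge (circle_arc a b (2 * \<phi>) s) (cos (2 * \<phi> * s) *\<^sub>R a + sin (2 * \<phi> * s) *\<^sub>R b)) has_integral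
      (T / (2 * \<phi>)) *\<^sub>R wedge a b) {0..T}"
    if "0 < \<phi>" "sin (2 * \<phi> * T) = 0" "cos (2 * \<phi> * T) = 1" for \<phi> a b
  proof -
    have "((\<lambda>s. ((1 - cos (2 * \<phi> * s)) / (2 * \<phi>)) *\<^sub>R wedge a b) has_integral ((T - 0) / (2 * \<phi>)) *\<^sub>R wedge a b) {0..T}"
      using has_integral_const_real[of "1::real" 0 T] T that
      by (intro has_integral_scaleR_left has_integral_divide has_integral_diff full_period_integrals) auto
    then show ?thesis using circle_arc_area_same[of "2 * \<phi>"] that(1) by simp
  qed
  have "((\<lambda>s. (1/2) *\<^sub>R ((wedge (?P1 s) (?U1 s) + wedge (?P2 s) (?U2 s)) + (wedge (?P1 s) (?U2 s) + wedge (?P2 s) (?U1 s)))) has_integral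
     (1/2) *\<^sub>R (((T / (2 * \<phi>1)) *\<^sub>R wedge a1 b1 + (T / (2 * \<phi>2)) *\<^sub>R wedge a2 b2) + (0 + 0))) {0..T}"
    by (intro has_integral_cmul has_integral_add own circle_arc_area_cross) (use assms in auto)
  then have "((\<lambda>s. (1/2) *\<^sub>R wedge (?P1 s + ?P2 s) (?u s)) has_integral
     (T / (4 * \<phi>1)) *\<^sub>R wedge a1 b1 + (T / (4 * \<phi>2)) *\<^sub>R wedge a2 b2) {0..T}"
    by (simp add: u wedge.add_left wedge.add_right scaleR_right_distrib algebra_simps)
  then have "integral {0..T} (\<lambda>s. (1/2) *\<^sub>R wedge (?P1 s + ?P2 s) (?u s)) =
     (T / (4 * \<phi>1)) *\<^sub>R wedge a1 b1 + (T / (4 * \<phi>2)) *\<^sub>R wedge a2 b2" by (rule integral_unique)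
  moreover have "integral {0..T} (\<lambda>s. (1/2) *\<^sub>R wedge (integral {0..s} ?u) (?u s)) =
    integral {0..T} (\<lambda>s. (1/2) *\<^sub>R wedge (?P1 s + ?P2 s) (?u s))"
    by (rule integral_cong) (simp add: pos)
  moreover have "integral {0..T} ?u = 0" using pos[of T] T f1 f2 by (simp add: circle_arc_def)
  ultimately show ?thesis by (simp add: extremal_def curve_of_control_def)
qed

lemma extremal_control_norm:
  assumes "extremal_params a1 b1 a2 b2 \<phi>1 \<phi>2"
  shows "norm (extremal_control a1 b1 a2 b2 \<phi>1 \<phi>2 s) = sqrt ((norm a1)\<^sup>2 + (norm a2)\<^sup>2)"
proof -
  let ?x = "2 * \<phi>1 * s" and ?y = "2 * \<phi>2 * s"
  have o: "a1 \<bullet> b1 = 0" "a1 \<bullet> a2 = 0" "a1 \<bullet> b2 = 0" "b1 \<bullet> a2 = 0" "b1 \<bullet> b2 = 0" "a2 \<bullet> b2 = 0"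
    "b1 \<bullet> a1 = 0" "a2 \<bullet> a1 = 0" "b2 \<bullet> a1 = 0" "a2 \<bullet> b1 = 0" "b2 \<bullet> b1 = 0" "b2 \<bullet> a2 = 0"
    "b1 \<bullet> b1 = a1 \<bullet> a1" "b2 \<bullet> b2 = a2 \<bullet> a2"
    using assms by (auto simp: extremal_params_def orthogonal4_def orthogonal_def inner_commute norm_eq)
  have "(c1 *\<^sub>R a1 + s1 *\<^sub>R b1 + c2 *\<^sub>R a2 + s2 *\<^sub>R b2) \<bullet> (c1 *\<^sub>R a1 + s1 *\<^sub>R b1 + c2 *\<^sub>R a2 + s2 *\<^sub>R b2)
      = (c1 * c1 + s1 * s1) * (a1 \<bullet> a1) + (c2 * c2 + s2 * s2) * (a2 \<bullet> a2)" for c1 s1 c2 s2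
    by (simp add: inner_add_left inner_add_right o algebra_simps)
  from this[of "cos ?x" "sin ?x" "cos ?y" "sin ?y"]
  have "extremal_control a1 b1 a2 b2 \<phi>1 \<phi>2 s \<bullet> extremal_control a1 b1 a2 b2 \<phi>1 \<phi>2 s = a1 \<bullet> a1 + a2 \<bullet> a2"
    by (simp only: extremal_control_def sin_cos_squared_add3 mult_1_left)
  then show ?thesis by (simp add: norm_eq_sqrt_inner)
qed

lemma control_length_cong:
  assumes "horizontal_curve T \<gamma> u" "horizontal_curve T \<gamma> u'"
  shows "control_length T u = control_length T u'"
proof -
  from assms(1) obtain M where M: "negligible M" "\<And>s. s \<in> {0..T} - M \<Longrightarrow>
      ((\<lambda>r. fst (\<gamma> r)) has_vector_derivative u s) (at s within {0..T})"
    unfolding horizontal_curve_def eventually_ae_filter_negligible by blast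
  from assms(2) obtain M' where M': "negligible M'" "\<And>s. s \<in> {0..T} - M' \<Longrightarrow>
      ((\<lambda>r. fst (\<gamma> r)) has_vector_derivative u' s) (at s within {0..T})"
    unfolding horizontal_curve_def eventually_ae_filter_negligible by blast
  have T: "0 < T" using assms(1) by (simp add: horizontal_curve_def)
  show ?thesis unfolding control_length_def
  proof (rule integral_spike[of "M \<union> M'"])
    show "negligible (M \<union> M')" using M M' by simp
    fix s assume s: "s \<in> {0..T} - (M \<union> M')"
    then have "u s = u' s"
      using M(2)[of s] M'(2)[of s] T by (intro vector_derivative_unique_within[of s "{0..T}"]) (auto simp: trivial_limit_within islimpt_Icc)
    then show "norm (u' s) = norm (u s)" by simp
  qed
qed

lemma control_length_extremal:
  assumes "extremal_params a1 b1 a2 b2 \<phi>1 \<phi>2" "0 < T" "horizontal_curve T (extremal a1 b1 a2 b2 \<phi>1 \<phi>2) u"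
  shows "control_length T u = T * sqrt ((norm a1)\<^sup>2 + (norm a2)\<^sup>2)"
  using control_length_cong[OF assms(3) horizontal_curve_extremal[OF assms(2)]] assms(2)
  by (simp add: control_length_def extremal_control_norm[OF assms(1)])

lemma horizontal_length_bound:
  assumes on: "orthonormal4 x1 y1 x2 y2" and t12: "t2 \<le> t1" "0 < t2"
    and h: "horizontal_curve T \<gamma> u" and ends: "\<gamma> 0 = (0, 0)" "\<gamma> T = (0, t1 *\<^sub>R wedge x1 y1 + t2 *\<^sub>R wedge x2 y2)"
  shows "sqrt (4 * pi * t1 + 8 * pi * t2) \<le> control_length T u"
proof -
  obtain u' N where u': "lip_deriv T (\<lambda>s. fst (\<gamma> s)) u'"
    "lip_deriv T (\<lambda>s. snd (\<gamma> s)) (\<lambda>s. (1/2) *\<^sub>R wedge (fst (\<gamma> s)) (u' s))"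
    "negligible N" "\<And>s. s \<in> {0..T} - N \<Longrightarrow> u' s = u s"
    using horizontal_curve_lip_deriv[OF h] by blast
  have eq: "integral {0..T} (\<lambda>s. norm (u' s)) = control_length T u"
    unfolding control_length_def by (rule integral_spike[OF u'(3)]) (simp add: u'(4))
  have "(\<lambda>s. norm (u' s)) integrable_on {0..T}"
    using lip_deriv_absolutely_integrable[OF u'(1)] by (simp add: absolutely_integrable_on_def)
  then have "0 \<le> control_length T u" unfolding eq[symmetric] by (rule integral_nonneg) simp
  moreover have "4 * pi * t1 + 8 * pi * t2 \<le> (control_length T u)\<^sup>2"
    using length_bound[OF on t12 u'(1,2)] ends unfolding eq by simp
  ultimately show ?thesis by (simp add: real_le_lsqrt)
qed

text \<open>
  The radii are chosen so that over unit time the first circle, run through once, has area \<open>t1\<close> and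
  the second, run through twice, has area \<open>t2\<close>. The shorter loop is obtained when the larger of
  the two areas is in the first place.
\<close>

lemma closed_extremal_exists:
  assumes on: "orthonormal4 x1 y1 x2 y2" and t12: "0 < t1" "0 < t2"
  obtains \<gamma> u where "horizontal_curve 1 \<gamma> u" "\<gamma> 0 = (0, 0)" "\<gamma> 1 = (0, t1 *\<^sub>R wedge x1 y1 + t2 *\<^sub>R wedge x2 y2)"
    "control_length 1 u = sqrt (4 * pi * t1 + 8 * pi * t2)"
proof -
  let ?r = "sqrt (4 * pi * t1)" and ?q = "sqrt (8 * pi * t2)"
  let ?\<gamma> = "extremal (?r *\<^sub>R x1) (?r *\<^sub>R y1) (?q *\<^sub>R x2) (?q *\<^sub>R y2) pi (2 * pi)"
  let ?u = "extremal_control (?r *\<^sub>R x1) (?r *\<^sub>R y1) (?q *\<^sub>R x2) (?q *\<^sub>R y2) pi (2 * pi)"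
  have p: "extremal_params (?r *\<^sub>R x1) (?r *\<^sub>R y1) (?q *\<^sub>R x2) (?q *\<^sub>R y2) pi (2 * pi)"
    using on by (simp add: extremal_params_def orthonormal4_def orthogonal4_def orthogonal_def)
  have h: "horizontal_curve 1 ?\<gamma> ?u" by (rule horizontal_curve_extremal) simp
  have "?\<gamma> 1 = (0, (1 / (4 * pi)) *\<^sub>R wedge (?r *\<^sub>R x1) (?r *\<^sub>R y1) + (1 / (4 * (2 * pi))) *\<^sub>R wedge (?q *\<^sub>R x2) (?q *\<^sub>R y2))"
    using sin_npi[of 4] cos_npi[of 4] by (intro extremal_common_period) (simp_all add: mult.commute)
  moreover have "(1 / (4 * pi)) *\<^sub>R wedge (?r *\<^sub>R x1) (?r *\<^sub>R y1) = t1 *\<^sub>R wedge x1 y1"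
    using t12 by (simp add: wedge.scaleR_left wedge.scaleR_right)
  moreover have "(1 / (4 * (2 * pi))) *\<^sub>R wedge (?q *\<^sub>R x2) (?q *\<^sub>R y2) = t2 *\<^sub>R wedge x2 y2"
    using t12 by (simp add: wedge.scaleR_left wedge.scaleR_right)
  ultimately have e: "?\<gamma> 1 = (0, t1 *\<^sub>R wedge x1 y1 + t2 *\<^sub>R wedge x2 y2)" by simp
  have "norm x1 = 1" "norm x2 = 1" using on by (simp_all add: orthonormal4_def)
  then have "control_length 1 ?u = sqrt (4 * pi * t1 + 8 * pi * t2)"
    using control_length_extremal[OF p _ h] t12 by simp
  then show thesis using that[OF h _ e] by (simp add: extremal_def curve_of_control_0)
qed

theorem cc_dist_center:
  assumes on: "orthonormal4 x1 y1 x2 y2" and t12: "t2 \<le> t1" "0 < t2"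
  shows "cc_dist (0, 0) (0, t1 *\<^sub>R wedge x1 y1 + t2 *\<^sub>R wedge x2 y2) = sqrt (4 * pi * t1 + 8 * pi * t2)"
proof (rule antisym)
  obtain \<gamma> u where \<gamma>: "horizontal_curve 1 \<gamma> u" "\<gamma> 0 = (0, 0)" "\<gamma> 1 = (0, t1 *\<^sub>R wedge x1 y1 + t2 *\<^sub>R wedge x2 y2)"
    "control_length 1 u = sqrt (4 * pi * t1 + 8 * pi * t2)"
    using closed_extremal_exists[OF on _ t12(2), of t1] t12 by auto
  show "cc_dist (0, 0) (0, t1 *\<^sub>R wedge x1 y1 + t2 *\<^sub>R wedge x2 y2) \<le> sqrt (4 * pi * t1 + 8 * pi * t2)"
    using cc_dist_le[OF \<gamma>(1-3)] \<gamma>(4) by simp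
  show "sqrt (4 * pi * t1 + 8 * pi * t2) \<le> cc_dist (0, 0) (0, t1 *\<^sub>R wedge x1 y1 + t2 *\<^sub>R wedge x2 y2)"
    unfolding cc_dist_def
  proof (rule cInf_greatest)
    show "{control_length T u |T \<gamma> u. horizontal_curve T \<gamma> u \<and> \<gamma> 0 = (0, 0) \<and>
        \<gamma> T = (0, t1 *\<^sub>R wedge x1 y1 + t2 *\<^sub>R wedge x2 y2)} \<noteq> {}" using \<gamma> by blast
  qed (use horizontal_length_bound[OF on t12] in blast)
qed

text \<open>
  At constant speed the square of the length is the energy times the duration, so a minimizer attains
  equality in the energy inequality after an affine change of time.
\<close>

theorem center_minimizers_are_extremals:
  assumes on: "orthonormal4 x1 y1 x2 y2" and t12: "t2 \<le> t1" "0 < t2"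
    and m: "length_minimizer T \<gamma> u" and cs: "constant_speed T u"
    and ends: "\<gamma> 0 = (0, 0)" "\<gamma> T = (0, t1 *\<^sub>R wedge x1 y1 + t2 *\<^sub>R wedge x2 y2)"
  shows "\<exists>a1 b1 a2 b2 \<phi>1 \<phi>2. extremal_params a1 b1 a2 b2 \<phi>1 \<phi>2 \<and> \<phi>2 = 2 * \<phi>1 \<and>
     (\<forall>s\<in>{0..T}. \<gamma> s = extremal a1 b1 a2 b2 \<phi>1 \<phi>2 s)"
proof -
  let ?K = "4 * pi * t1 + 8 * pi * t2"
  have h: "horizontal_curve T \<gamma> u" using m by (simp add: length_minimizer_def)
  then have T: "0 < T" by (simp add: horizontal_curve_def)
  obtain u' N where u': "lip_deriv T (\<lambda>s. fst (\<gamma> s)) u'"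
    "lip_deriv T (\<lambda>s. snd (\<gamma> s)) (\<lambda>s. (1/2) *\<^sub>R wedge (fst (\<gamma> s)) (u' s))"
    "negligible N" "\<And>s. s \<in> {0..T} - N \<Longrightarrow> u' s = u s"
    using horizontal_curve_lip_deriv[OF h] by blast
  obtain c N' where c: "negligible N'" "\<And>s. s \<in> {0..T} - N' \<Longrightarrow> norm (u s) = c"
    using cs unfolding constant_speed_def eventually_ae_filter_negligible by blast
  have L: "control_length T u = sqrt ?K"
    using m ends cc_dist_center[OF on t12] by (simp add: length_minimizer_def)
  have "control_length T u = integral {0..T} (\<lambda>s. c)"
    unfolding control_length_def by (rule integral_spike[OF c(1)]) (simp add: c(2))
  then have cT: "c * T = sqrt ?K" using L T by (simp add: mult.commute)
  have NN: "negligible (N \<union> N')" using u' c by simp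
  have "integral {0..T} (\<lambda>s. (norm (u' s))\<^sup>2 / 1) = integral {0..T} (\<lambda>s. c\<^sup>2)"
    by (rule integral_spike[OF NN]) (simp add: c(2) u'(4))
  then have en: "integral {0..T} (\<lambda>s. (norm (u' s))\<^sup>2 / 1) = c\<^sup>2 * T" using T by (simp add: mult.commute)
  have ST: "T = integral {0..T} (\<lambda>s. 1)" using T by simp
  obtain X v where X: "lip_deriv (2*pi) X v"
    "\<And>s. s \<in> {0..T} \<Longrightarrow> fst (\<gamma> s) = X ((2*pi/T) * integral {0..s} (\<lambda>s. 1))" "0 < T"
    "integral {0..2*pi} (\<lambda>r. (1/2) *\<^sub>R wedge (X r) (v r)) = snd (\<gamma> T) - snd (\<gamma> 0)"
    "integral {0..2*pi} (\<lambda>r. (norm (v r))\<^sup>2) = T / (2*pi) * integral {0..T} (\<lambda>s. (norm (u' s))\<^sup>2 / 1)"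
    by (rule reparam_to_circle[OF u'(1,2) continuous_on_const zero_less_one ST]) (rule that; assumption)
  have X2: "fst (\<gamma> s) = X (2*pi/T * s)" if "s \<in> {0..T}" for s using X(2)[OF that] that by simp
  have Xper: "X 0 = X (2*pi)" using X2[of 0] X2[of T] T ends by simp
  have area: "integral {0..2*pi} (\<lambda>r. (1/2) *\<^sub>R wedge (X r) (v r)) = t1 *\<^sub>R wedge x1 y1 + t2 *\<^sub>R wedge x2 y2"
    using X(4) ends by simp
  have "T / (2*pi) * (c\<^sup>2 * T) = (c * T)\<^sup>2 / (2*pi)" by (simp add: power2_eq_square)
  also have "\<dots> = 2 * t1 + 4 * t2" unfolding cT using t12 by (simp add: field_simps)
  finally have "integral {0..2*pi} (\<lambda>r. (norm (v r))\<^sup>2) = 2 * t1 + 4 * t2" unfolding X(5) en .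
  from energy_equality[OF on t12 X(1) Xper area this]
  obtain \<alpha> C D C2 D2 where E: "orthogonal4 C D C2 D2" "norm C = norm D" "norm C2 = norm D2"
    "\<And>r. r \<in> {0..2*pi} \<Longrightarrow> X r = \<alpha> + (cos r *\<^sub>R C + sin r *\<^sub>R D) + (cos (2 * r) *\<^sub>R C2 + sin (2 * r) *\<^sub>R D2)"
    by blast
  let ?\<phi> = "pi / T"
  let ?k = "2 * pi / T"
  define a1 b1 a2 b2 where "a1 = ?k *\<^sub>R D" and "b1 = - ?k *\<^sub>R C" and "a2 = (2 * ?k) *\<^sub>R D2" and "b2 = - (2 * ?k) *\<^sub>R C2"
  let ?w = "extremal_control a1 b1 a2 b2 ?\<phi> (2 * ?\<phi>)"
  have par: "extremal_params a1 b1 a2 b2 ?\<phi> (2 * ?\<phi>)"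
    using E(1-3) T by (simp add: extremal_params_def orthogonal4_def orthogonal_def a1_def b1_def a2_def b2_def inner_commute)
  have x: "fst (\<gamma> s) = integral {0..s} ?w" if s: "s \<in> {0..T}" for s
  proof -
    have r: "?k * s \<in> {0..2*pi}" using s T by (auto simp: field_simps)
    have "fst (\<gamma> s) = \<alpha> + (cos (?k * s) *\<^sub>R C + sin (?k * s) *\<^sub>R D) + (cos (2 * (?k * s)) *\<^sub>R C2 + sin (2 * (?k * s)) *\<^sub>R D2)"
      using X2[OF s] E(4)[OF r] by simp
    moreover have "\<alpha> = - C - C2"
    proof -
      have "\<alpha> + C + C2 = 0" using X2[of 0] E(4)[of 0] ends T by simp
      moreover have "\<alpha> = (\<alpha> + C + C2) - C - C2" by simp
      ultimately show ?thesis by simp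
    qed
    ultimately have "fst (\<gamma> s) = (cos (?k * s) *\<^sub>R C + sin (?k * s) *\<^sub>R D) + (cos (2 * (?k * s)) *\<^sub>R C2 + sin (2 * (?k * s)) *\<^sub>R D2) - C - C2"
      by simp
    also have "\<dots> = circle_arc a1 b1 ?k s + circle_arc a2 b2 (2 * ?k) s"
    proof -
      have arc: "circle_arc (k *\<^sub>R d) (- k *\<^sub>R c) k s = sin (k * s) *\<^sub>R d - (1 - cos (k * s)) *\<^sub>R c" if "k \<noteq> 0" for k c d
        using that by (simp add: circle_arc_def)
      have "?k \<noteq> 0" "2 * ?k \<noteq> 0" using T by simp_all
      from arc[OF this(1), of D C] arc[OF this(2), of D2 C2] show ?thesis
        unfolding a1_def b1_def a2_def b2_def mult.assoc by (simp add: scaleR_left_diff_distrib)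
    qed
    also have "\<dots> = circle_arc a1 b1 (2 * ?\<phi>) s + circle_arc a2 b2 (2 * (2 * ?\<phi>)) s" by simp
    also have "\<dots> = integral {0..s} ?w" using T s by (subst integral_extremal_control) auto
    finally show ?thesis .
  qed
  have dx: "((\<lambda>r. integral {0..r} ?w) has_vector_derivative ?w s) (at s within {0..T})" if "s \<in> {0..T}" for s
    by (rule integral_has_vector_derivative[OF continuous_on_extremal_control that])
  from u'(1) obtain M where M: "negligible M" "\<And>s. s \<in> {0..T} - M \<Longrightarrow>
      ((\<lambda>s. fst (\<gamma> s)) has_vector_derivative u' s) (at s within {0..T})"
    by (elim lip_derivE) blast
  have uw: "u' s = ?w s" if s: "s \<in> {0..T} - M" for s
  proof (rule vector_derivative_unique_within[of s "{0..T}"])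
    show "at s within {0..T} \<noteq> bot" using s T by (auto simp: trivial_limit_within islimpt_Icc)
    show "((\<lambda>s. fst (\<gamma> s)) has_vector_derivative u' s) (at s within {0..T})" by (rule M(2)[OF s])
    show "((\<lambda>s. fst (\<gamma> s)) has_vector_derivative ?w s) (at s within {0..T})"
      by (rule has_vector_derivative_transform[OF _ x dx]) (use s in auto)
  qed
  have "snd (\<gamma> s) = integral {0..s} (\<lambda>r. (1/2) *\<^sub>R wedge (integral {0..r} ?w) (?w r))" if s: "s \<in> {0..T}" for s
  proof (cases "s = 0")
    case True then show ?thesis using ends by simp
  next
    case False
    have "integral {0..s} (\<lambda>r. (1/2) *\<^sub>R wedge (fst (\<gamma> r)) (u' r)) = snd (\<gamma> s) - snd (\<gamma> 0)"
      by (rule integral_unique[OF lip_deriv_has_integral[OF lip_deriv_restrict[OF u'(2)]]]) (use s False in auto)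
    moreover have "integral {0..s} (\<lambda>r. (1/2) *\<^sub>R wedge (fst (\<gamma> r)) (u' r)) = integral {0..s} (\<lambda>r. (1/2) *\<^sub>R wedge (integral {0..r} ?w) (?w r))"
      by (rule integral_spike[OF M(1)]) (use s x uw in auto)
    ultimately show ?thesis using ends by simp
  qed
  then have "\<gamma> s = extremal a1 b1 a2 b2 ?\<phi> (2 * ?\<phi>) s" if "s \<in> {0..T}" for s
    using x that by (simp add: extremal_def curve_of_control_def prod_eq_iff)
  then show ?thesis using par by blast
qed

section \<open>Variations and corners\<close>

lemma square_integral_le:
  assumes T: "0 < T" and f: "f integrable_on {0..T}" and f2: "(\<lambda>s. (f s)\<^sup>2) integrable_on {0..T}"
  shows "(integral {0..T} f)\<^sup>2 \<le> T * integral {0..T} (\<lambda>s. (f s :: real)\<^sup>2)"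
proof -
  define m where "m = integral {0..T} f / T"
  have "((\<lambda>s. (f s)\<^sup>2 - 2 * m * f s + m\<^sup>2) has_integral
     integral {0..T} (\<lambda>s. (f s)\<^sup>2) - 2 * m * integral {0..T} f + m\<^sup>2 * T) {0..T}"
    using has_integral_const_real[of "m\<^sup>2" 0 T] T
    by (intro has_integral_add has_integral_diff has_integral_mult_right integrable_integral f f2)
       (simp add: mult.commute)
  then have "0 \<le> integral {0..T} (\<lambda>s. (f s)\<^sup>2) - 2 * m * integral {0..T} f + m\<^sup>2 * T"
  proof (rule has_integral_nonneg)
    fix s
    have "(f s)\<^sup>2 - 2 * m * f s + m\<^sup>2 = (f s - m)\<^sup>2" by (simp add: power2_eq_square algebra_simps)
    then show "0 \<le> (f s)\<^sup>2 - 2 * m * f s + m\<^sup>2" by simp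
  qed
  also have "\<dots> = integral {0..T} (\<lambda>s. (f s)\<^sup>2) - (integral {0..T} f)\<^sup>2 / T"
    using T by (simp add: m_def power2_eq_square field_simps)
  finally show ?thesis using T by (simp add: field_simps)
qed

text \<open>
  The curve \<open>x\<close> is moved in the fixed direction \<open>e\<close> by \<open>g e\<close>, where \<open>g\<close> is the primitive of \<open>h\<close>. As
  \<open>e \<and> e = 0\<close>, the vertical component changes linearly in \<open>h\<close>, namely by
  \<open>1/2 g x \<and> e - (\<integral> g u) \<and> e\<close>. So the end point is kept fixed exactly, and not just to
  first order, by linear conditions on \<open>h\<close>.
\<close>

lemma horizontal_variation:
  fixes x u :: "real \<Rightarrow> real^4"
  assumes x: "lip_deriv T x u" and t: "lip_deriv T t (\<lambda>s. (1/2) *\<^sub>R wedge (x s) (u s))"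
    and L: "\<And>s. s \<in> {0..T} \<Longrightarrow> t s \<in> Lambda2"
    and h: "continuous_on {0..T} h" and h0: "integral {0..T} h = 0" and hx: "integral {0..T} (\<lambda>s. h s *\<^sub>R x s) = 0"
  shows "\<exists>\<gamma>. horizontal_curve T \<gamma> (\<lambda>s. u s + h s *\<^sub>R e) \<and> \<gamma> 0 = (x 0, t 0) \<and> \<gamma> T = (x T, t T)"
proof -
  have T: "0 < T" using x by (simp add: lip_deriv_def)
  have cx: "continuous_on {0..T} x" by (rule lip_deriv_continuous[OF x])
  define g where "g s = integral {0..s} h" for s
  define H where "H s = integral {0..s} (\<lambda>s. h s *\<^sub>R x s)" for s
  have lg: "lip_deriv T g h"
    unfolding g_def[abs_def]
    by (rule lip_deriv_C1[OF T integral_has_vector_derivative[OF h] h])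
  have chx: "continuous_on {0..T} (\<lambda>s. h s *\<^sub>R x s)" by (intro continuous_intros h cx)
  have lH: "lip_deriv T H (\<lambda>s. h s *\<^sub>R x s)"
    unfolding H_def[abs_def]
    by (rule lip_deriv_C1[OF T integral_has_vector_derivative[OF chx] chx])
  \<comment> \<open>\<open>G\<close> is the integral of \<open>g u\<close>, written so that its almost everywhere derivative is known from that of \<open>x\<close>\<close>
  define G where "G s = g s *\<^sub>R x s - H s" for s
  have lG: "lip_deriv T G (\<lambda>s. g s *\<^sub>R u s)"
    using lip_deriv_diff[OF lip_deriv_bilinear[OF bounded_bilinear_scaleR lg x] lH] by (simp add: G_def[abs_def])
  define y where "y s = x s + g s *\<^sub>R e" for s
  define z where "z s = t s + (1/2) *\<^sub>R (g s *\<^sub>R wedge (x s) e) - wedge (G s) e" for s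
  have ly: "lip_deriv T y (\<lambda>s. u s + h s *\<^sub>R e)"
    unfolding y_def[abs_def]
    by (intro lip_deriv_add x lip_deriv_linear[OF bounded_linear_scaleR_left lg])
  have lxe: "lip_deriv T (\<lambda>s. wedge (x s) e) (\<lambda>s. wedge (u s) e)"
    by (rule lip_deriv_linear[OF wedge.bounded_linear_left x])
  have lz: "lip_deriv T z (\<lambda>s. (1/2) *\<^sub>R wedge (x s) (u s) + (1/2) *\<^sub>R (g s *\<^sub>R wedge (u s) e + h s *\<^sub>R wedge (x s) e) - wedge (g s *\<^sub>R u s) e)"
    unfolding z_def[abs_def]
    by (intro lip_deriv_diff lip_deriv_add t lip_deriv_linear[OF bounded_linear_scaleR_right]
        lip_deriv_bilinear[OF bounded_bilinear_scaleR lg lxe] lip_deriv_linear[OF wedge.bounded_linear_left lG])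
  have eq: "(1/2) *\<^sub>R wedge (x s) (u s) + (1/2) *\<^sub>R (g s *\<^sub>R wedge (u s) e + h s *\<^sub>R wedge (x s) e) - wedge (g s *\<^sub>R u s) e
    = (1/2) *\<^sub>R wedge (y s) (u s + h s *\<^sub>R e)" for s
  proof -
    have "wedge (y s) (u s + h s *\<^sub>R e) = wedge (x s) (u s) + h s *\<^sub>R wedge (x s) e + g s *\<^sub>R wedge e (u s)"
      by (simp add: y_def wedge.add_left wedge.add_right wedge.scaleR_left wedge.scaleR_right)
    also have "wedge e (u s) = - wedge (u s) e" by (rule wedge_swap)
    finally have w: "wedge (y s) (u s + h s *\<^sub>R e) = wedge (x s) (u s) + h s *\<^sub>R wedge (x s) e - g s *\<^sub>R wedge (u s) e"
      by simp
    have "(1/2) *\<^sub>R A + (1/2) *\<^sub>R (B + C) - B = (1/2) *\<^sub>R (A + C - B)" for A B C :: "real^4^4"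
      by (simp add: vec_eq_iff)
    then show ?thesis unfolding w wedge.scaleR_left by simp
  qed
  have "horizontal_curve T (\<lambda>s. (y s, z s)) (\<lambda>s. u s + h s *\<^sub>R e)"
    by (rule lip_deriv_horizontal_curve[OF ly lz[unfolded eq]])
       (auto simp: z_def intro!: Lambda2_add Lambda2_diff Lambda2_scaleR wedge_in_Lambda2 L)
  moreover have "g 0 = 0" "G 0 = 0" "g T = 0" "G T = 0" using h0 hx by (simp_all add: g_def G_def H_def)
  ultimately show ?thesis
    by (intro exI[of _ "\<lambda>s. (y s, z s)"]) (simp add: y_def z_def wedge.zero_left)
qed

text \<open>
  In other words, the control is almost everywhere an affine function of the position. The energy of the
  varied controls \<open>u + \<epsilon> h e\<close> is a quadratic polynomial in \<open>\<epsilon>\<close> with its minimum at \<open>\<epsilon> = 0\<close>; the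
  direction \<open>e\<close> is taken to be \<open>\<integral> h u\<close> itself.
\<close>

lemma minimizer_first_order:
  fixes x u :: "real \<Rightarrow> real^4"
  assumes x: "lip_deriv T x u" and t: "lip_deriv T t (\<lambda>s. (1/2) *\<^sub>R wedge (x s) (u s))"
    and L: "\<And>s. s \<in> {0..T} \<Longrightarrow> t s \<in> Lambda2"
    and c: "0 \<le> c" "\<And>s. s \<in> {0..T} \<Longrightarrow> norm (u s) = c"
    and min: "c * T \<le> cc_dist (x 0, t 0) (x T, t T)"
    and h: "continuous_on {0..T} h" and h0: "integral {0..T} h = 0" and hx: "integral {0..T} (\<lambda>s. h s *\<^sub>R x s) = 0"
  shows "integral {0..T} (\<lambda>s. h s *\<^sub>R u s) = 0"
proof -
  have T: "0 < T" using x by (simp add: lip_deriv_def)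
  define e where "e = integral {0..T} (\<lambda>s. h s *\<^sub>R u s)"
  have hu: "((\<lambda>s. h s *\<^sub>R u s) has_integral e) {0..T}"
    unfolding e_def
    using lip_deriv_continuous_bilinear_absolutely_integrable[OF bounded_bilinear_scaleR h x]
    by (simp add: integrable_integral set_lebesgue_integral_eq_integral(1))
  from has_integral_linear[OF hu bounded_linear_inner_left[of e]]
  have hue: "((\<lambda>s. h s * (u s \<bullet> e)) has_integral e \<bullet> e) {0..T}" by (simp add: o_def)
  define Q where "Q = integral {0..T} (\<lambda>s. (h s)\<^sup>2) * (e \<bullet> e)"
  have hh: "((\<lambda>s. (h s)\<^sup>2) has_integral integral {0..T} (\<lambda>s. (h s)\<^sup>2)) {0..T}"
    by (intro integrable_integral integrable_continuous_real continuous_intros h)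
  have key: "0 \<le> 2 * \<epsilon> * (e \<bullet> e) + \<epsilon>\<^sup>2 * Q" for \<epsilon> :: real
  proof -
    have "integral {0..T} (\<lambda>s. \<epsilon> * h s) = 0" "integral {0..T} (\<lambda>s. (\<epsilon> * h s) *\<^sub>R x s) = 0"
      using h0 hx by (simp_all add: scaleR_scaleR[symmetric] del: scaleR_scaleR)
    moreover have "continuous_on {0..T} (\<lambda>s. \<epsilon> * h s)" by (intro continuous_on_mult continuous_on_const h)
    ultimately obtain \<gamma> where \<gamma>: "horizontal_curve T \<gamma> (\<lambda>s. u s + (\<epsilon> * h s) *\<^sub>R e)" "\<gamma> 0 = (x 0, t 0)" "\<gamma> T = (x T, t T)"
      using horizontal_variation[OF x t L, of "\<lambda>s. \<epsilon> * h s" e] by blast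
    let ?w = "\<lambda>s. u s + (\<epsilon> * h s) *\<^sub>R e"
    have "(norm (?w s))\<^sup>2 = (norm (u s))\<^sup>2 + (2 * \<epsilon>) * (h s * (u s \<bullet> e)) + (\<epsilon>\<^sup>2 * (e \<bullet> e)) * (h s)\<^sup>2" for s
      unfolding power2_norm_eq_inner by (simp add: inner_add_left inner_add_right inner_commute power2_eq_square algebra_simps)
    moreover have "((\<lambda>s. c\<^sup>2 + (2 * \<epsilon>) * (h s * (u s \<bullet> e)) + (\<epsilon>\<^sup>2 * (e \<bullet> e)) * (h s)\<^sup>2) has_integral
        c\<^sup>2 * T + (2 * \<epsilon>) * (e \<bullet> e) + (\<epsilon>\<^sup>2 * (e \<bullet> e)) * integral {0..T} (\<lambda>s. (h s)\<^sup>2)) {0..T}"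
      using has_integral_const_real[of "c\<^sup>2" 0 T] T
      by (intro has_integral_add has_integral_mult_right hue hh) (simp add: mult.commute)
    ultimately have w2: "((\<lambda>s. (norm (?w s))\<^sup>2) has_integral c\<^sup>2 * T + 2 * \<epsilon> * (e \<bullet> e) + \<epsilon>\<^sup>2 * Q) {0..T}"
      by (subst has_integral_cong[where g="\<lambda>s. c\<^sup>2 + (2 * \<epsilon>) * (h s * (u s \<bullet> e)) + (\<epsilon>\<^sup>2 * (e \<bullet> e)) * (h s)\<^sup>2"])
         (auto simp: c(2) Q_def mult_ac)
    have w1: "(\<lambda>s. norm (?w s)) integrable_on {0..T}"
    proof -
      have "u absolutely_integrable_on {0..T}" by (rule lip_deriv_absolutely_integrable[OF x])
      moreover have "(\<lambda>s. (\<epsilon> * h s) *\<^sub>R e) absolutely_integrable_on {0..T}"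
        by (intro absolutely_integrable_continuous_real continuous_intros h)
      ultimately have "?w absolutely_integrable_on {0..T}" by (rule set_integral_add(1))
      then show ?thesis by (simp add: absolutely_integrable_on_def)
    qed
    have "c * T \<le> integral {0..T} (\<lambda>s. norm (?w s))"
      using min cc_dist_le[OF \<gamma>] by (simp add: control_length_def)
    then have "(c * T)\<^sup>2 \<le> (integral {0..T} (\<lambda>s. norm (?w s)))\<^sup>2"
      using c T by (intro power_mono) auto
    also have "\<dots> \<le> T * integral {0..T} (\<lambda>s. (norm (?w s))\<^sup>2)"
      by (rule square_integral_le[OF T w1]) (use w2 in auto)
    also have "integral {0..T} (\<lambda>s. (norm (?w s))\<^sup>2) = c\<^sup>2 * T + 2 * \<epsilon> * (e \<bullet> e) + \<epsilon>\<^sup>2 * Q"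
      by (rule integral_unique[OF w2])
    finally have "0 \<le> T * (2 * \<epsilon> * (e \<bullet> e) + \<epsilon>\<^sup>2 * Q)" by (simp add: power2_eq_square algebra_simps)
    then show ?thesis using T by (simp add: zero_le_mult_iff)
  qed
  have Q0: "0 \<le> Q" unfolding Q_def using hh by (intro mult_nonneg_nonneg has_integral_nonneg[OF hh]) auto
  have "e \<bullet> e = 0"
  proof (rule ccontr)
    assume "e \<bullet> e \<noteq> 0"
    then have p: "0 < e \<bullet> e" by simp
    \<comment> \<open>negative and so small that the linear term dominates\<close>
    define \<epsilon> where "\<epsilon> = - (e \<bullet> e) / (Q + 1)"
    have "\<epsilon> < 0" using p Q0 by (simp add: \<epsilon>_def divide_neg_pos)
    have "\<epsilon> * (Q + 1) = - (e \<bullet> e)" using Q0 by (simp add: \<epsilon>_def)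
    then have "2 * (e \<bullet> e) + \<epsilon> * Q = (e \<bullet> e) - \<epsilon>" by (simp add: algebra_simps)
    then have "0 < 2 * (e \<bullet> e) + \<epsilon> * Q" using p \<open>\<epsilon> < 0\<close> by linarith
    then have "\<epsilon> * (2 * (e \<bullet> e) + \<epsilon> * Q) < 0" using \<open>\<epsilon> < 0\<close> by (simp add: mult_neg_pos)
    moreover have "\<epsilon> * (2 * (e \<bullet> e) + \<epsilon> * Q) = 2 * \<epsilon> * (e \<bullet> e) + \<epsilon>\<^sup>2 * Q"
      by (simp add: power2_eq_square algebra_simps)
    ultimately show False using key[of \<epsilon>] by linarith
  qed
  then show ?thesis by (simp add: e_def)
qed

lemma bump_average:
  fixes f :: "real \<Rightarrow> 'a::euclidean_space"
  assumes ab: "0 \<le> a" "a < b" "b \<le> T"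
    and int: "\<And>k. continuous_on {0..T} k \<Longrightarrow> (\<lambda>s. k s *\<^sub>R f s) integrable_on {0..T}"
    and near: "\<And>s. a < s \<Longrightarrow> s < b \<Longrightarrow> norm (f s - l) \<le> \<delta>"
  shows "\<exists>k. continuous_on {0..T} k \<and> norm (integral {0..T} (\<lambda>s. k s *\<^sub>R f s) - l) \<le> \<delta>"
proof -
  \<comment> \<open>a continuous bump supported in \<open>[a, b]\<close>, normalised below\<close>
  define B where "B s = max 0 ((s - a) * (b - s))" for s :: real
  have cB: "continuous_on S B" for S unfolding B_def[abs_def] by (intro continuous_intros)
  have B0: "0 \<le> B s" for s by (simp add: B_def)
  have Bz: "B s = 0" if "\<not> (a < s \<and> s < b)" for s
  proof -
    have "(s - a) * (b - s) \<le> 0"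
    proof (cases "a < s")
      case True
      then show ?thesis using that by (intro mult_nonneg_nonpos) auto
    next
      case False
      then show ?thesis using ab by (intro mult_nonpos_nonneg) auto
    qed
    then show ?thesis by (simp add: B_def)
  qed
  have iB: "B integrable_on {0..T}" by (rule integrable_continuous_real[OF cB])
  define I where "I = integral {0..T} B"
  have "I \<noteq> 0"
  proof
    assume "I = 0"
    then have "(B has_integral 0) (cbox 0 T)" using integrable_integral[OF iB] by (simp add: I_def)
    then have "B ((a + b) / 2) = 0"
      by (rule has_integral_0_cbox_imp_0[rotated 2]) (use cB B0 ab in \<open>auto simp: box_real\<close>)
    moreover have "0 < (a + b) / 2 - a" "0 < b - (a + b) / 2" using ab by (simp_all add: field_simps)
    from mult_pos_pos[OF this] have "0 < ((a + b) / 2 - a) * (b - (a + b) / 2)" .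
    ultimately show False by (simp add: B_def)
  qed
  moreover have "0 \<le> I" unfolding I_def by (rule integral_nonneg[OF iB]) (simp add: B0)
  ultimately have I: "0 < I" by simp
  define k where "k s = B s / I" for s
  have ck: "continuous_on {0..T} k" unfolding k_def[abs_def] using I by (intro continuous_on_divide cB continuous_on_const) auto
  have k0: "0 \<le> k s" for s using B0 I by (simp add: k_def)
  have k1: "(k has_integral 1) {0..T}"
    using has_integral_divide[OF integrable_integral[OF iB], of I] I by (simp add: k_def[abs_def] I_def[symmetric])
  have "((\<lambda>s. k s *\<^sub>R f s - k s *\<^sub>R l) has_integral integral {0..T} (\<lambda>s. k s *\<^sub>R f s) - 1 *\<^sub>R l) {0..T}"
    by (intro has_integral_diff integrable_integral[OF int[OF ck]] has_integral_scaleR_left k1)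
  then have eq: "((\<lambda>s. k s *\<^sub>R (f s - l)) has_integral integral {0..T} (\<lambda>s. k s *\<^sub>R f s) - l) {0..T}"
    by (simp add: scaleR_right_diff_distrib)
  have "((\<lambda>s. k s * \<delta>) has_integral 1 * \<delta>) {0..T}" by (rule has_integral_mult_left[OF k1])
  moreover have "norm (k s *\<^sub>R (f s - l)) \<le> k s * \<delta>" for s
  proof (cases "a < s \<and> s < b")
    case True
    then show ?thesis using near[of s] k0[of s] by (auto intro: mult_left_mono)
  next
    case False
    then show ?thesis using Bz[of s] by (simp add: k_def)
  qed
  ultimately have "norm (integral {0..T} (\<lambda>s. k s *\<^sub>R f s) - l) \<le> \<delta>"
    using integral_norm_bound_integral[of "\<lambda>s. k s *\<^sub>R (f s - l)" "{0..T}" "\<lambda>s. k s * \<delta>"] eq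
    by (auto simp: has_integral_iff)
  then show ?thesis using ck by blast
qed

text \<open>
  Averages against narrow bumps approximate both one-sided limits. The averages form
  a linear subspace of a finite-dimensional space, hence a closed set, so it contains the limits
  themselves.
\<close>

lemma one_sided_limits_in_average_space:
  fixes f :: "real \<Rightarrow> 'a::euclidean_space"
  assumes p: "0 < p" "p < T"
    and int: "\<And>k. continuous_on {0..T} k \<Longrightarrow> (\<lambda>s. k s *\<^sub>R f s) integrable_on {0..T}"
    and l: "(f \<longlongrightarrow> l) (at_left p)" and r: "(f \<longlongrightarrow> r) (at_right p)"
  shows "\<exists>h. continuous_on {0..T} h \<and> integral {0..T} (\<lambda>s. h s *\<^sub>R f s) = r - l"
proof -
  define V where "V = {integral {0..T} (\<lambda>s. h s *\<^sub>R f s) | h. continuous_on {0..T} h}"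
  have V: "subspace V"
    unfolding subspace_def
  proof (intro conjI ballI allI)
    show "0 \<in> V" unfolding V_def by (auto intro!: exI[of _ "\<lambda>s. 0"] continuous_on_const)
    fix v w assume "v \<in> V" "w \<in> V"
    then obtain h k where hk: "continuous_on {0..T} h" "v = integral {0..T} (\<lambda>s. h s *\<^sub>R f s)"
      "continuous_on {0..T} k" "w = integral {0..T} (\<lambda>s. k s *\<^sub>R f s)" unfolding V_def by blast
    have "v + w = integral {0..T} (\<lambda>s. (h s + k s) *\<^sub>R f s)"
      unfolding scaleR_left_distrib hk using int hk by (simp add: integral_add)
    moreover have "continuous_on {0..T} (\<lambda>s. h s + k s)" using hk by (intro continuous_on_add)
    ultimately show "v + w \<in> V" unfolding V_def mem_Collect_eq by (intro exI[of _ "\<lambda>s. h s + k s"] conjI)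
  next
    fix c v assume "v \<in> V"
    then obtain h where h: "continuous_on {0..T} h" "v = integral {0..T} (\<lambda>s. h s *\<^sub>R f s)" unfolding V_def by blast
    have "c *\<^sub>R v = integral {0..T} (\<lambda>s. (c * h s) *\<^sub>R f s)"
      unfolding h scaleR_scaleR[symmetric] by (rule integral_cmul[symmetric])
    moreover have "continuous_on {0..T} (\<lambda>s. c * h s)" using h by (intro continuous_on_mult continuous_on_const)
    ultimately show "c *\<^sub>R v \<in> V" unfolding V_def mem_Collect_eq by (intro exI[of _ "\<lambda>s. c * h s"] conjI)
  qed
  have cl: "closure V = V" using closed_subspace[OF V] by simp
  have "r \<in> closure V"
    unfolding closure_approachable
  proof (intro allI impI)
    fix \<delta> :: real assume \<delta>: "0 < \<delta>"
    obtain b where b: "p < b" "\<And>s. p < s \<Longrightarrow> s < b \<Longrightarrow> dist (f s) r < \<delta> / 2"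
      using tendstoD[OF r, of "\<delta>/2"] \<delta> unfolding eventually_at_right_field by auto
    have "\<exists>k. continuous_on {0..T} k \<and> norm (integral {0..T} (\<lambda>s. k s *\<^sub>R f s) - r) \<le> \<delta> / 2"
      by (rule bump_average[of p "min b T"]) (use b p int in \<open>auto simp: dist_norm intro: less_imp_le\<close>)
    then obtain k where "continuous_on {0..T} k" "norm (integral {0..T} (\<lambda>s. k s *\<^sub>R f s) - r) \<le> \<delta> / 2" by blast
    then show "\<exists>y\<in>V. dist y r < \<delta>" unfolding V_def using \<delta> by (intro bexI[of _ "integral {0..T} (\<lambda>s. k s *\<^sub>R f s)"]) (auto simp: dist_norm)
  qed
  moreover have "l \<in> closure V"
    unfolding closure_approachable
  proof (intro allI impI)
    fix \<delta> :: real assume \<delta>: "0 < \<delta>"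
    obtain b where b: "b < p" "\<And>s. b < s \<Longrightarrow> s < p \<Longrightarrow> dist (f s) l < \<delta> / 2"
      using tendstoD[OF l, of "\<delta>/2"] \<delta> unfolding eventually_at_left_field by auto
    have "\<exists>k. continuous_on {0..T} k \<and> norm (integral {0..T} (\<lambda>s. k s *\<^sub>R f s) - l) \<le> \<delta> / 2"
      by (rule bump_average[of "max b 0" p]) (use b p int in \<open>auto simp: dist_norm intro: less_imp_le\<close>)
    then obtain k where "continuous_on {0..T} k" "norm (integral {0..T} (\<lambda>s. k s *\<^sub>R f s) - l) \<le> \<delta> / 2" by blast
    then show "\<exists>y\<in>V. dist y l < \<delta>" unfolding V_def using \<delta> by (intro bexI[of _ "integral {0..T} (\<lambda>s. k s *\<^sub>R f s)"]) (auto simp: dist_norm)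
  qed
  ultimately have "r - l \<in> V" using cl subspace_diff[OF V] by auto
  then obtain h where "continuous_on {0..T} h" "r - l = integral {0..T} (\<lambda>s. h s *\<^sub>R f s)" unfolding V_def by blast
  then show ?thesis by (intro exI[of _ h]) simp
qed

lemma curve_of_control_lip_deriv:
  assumes w: "continuous_on UNIV w" and T: "0 < T"
  shows "lip_deriv T (\<lambda>s. fst (curve_of_control w s)) w"
    and "lip_deriv T (\<lambda>s. snd (curve_of_control w s)) (\<lambda>s. (1/2) *\<^sub>R wedge (fst (curve_of_control w s)) (w s))"
proof -
  have cw: "continuous_on {0..T} w" using w continuous_on_subset by blast
  have f: "fst (curve_of_control w s) = integral {0..s} w" for s by (simp add: curve_of_control_def)
  have g: "snd (curve_of_control w s) = integral {0..s} (\<lambda>s. (1/2) *\<^sub>R wedge (fst (curve_of_control w s)) (w s))" for s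
    by (simp add: curve_of_control_def)
  show lx: "lip_deriv T (\<lambda>s. fst (curve_of_control w s)) w"
    unfolding f by (rule lip_deriv_C1[OF T integral_has_vector_derivative[OF cw] cw])
  have cwd: "continuous_on {0..T} (\<lambda>s. (1/2) *\<^sub>R wedge (fst (curve_of_control w s)) (w s))"
    by (rule continuous_on_scaleR[OF continuous_on_const continuous_on_wedge[OF lip_deriv_continuous[OF lx] cw]])
  show "lip_deriv T (\<lambda>s. snd (curve_of_control w s)) (\<lambda>s. (1/2) *\<^sub>R wedge (fst (curve_of_control w s)) (w s))"
    unfolding g by (rule lip_deriv_C1[OF T integral_has_vector_derivative[OF cwd] cwd])
qed

lemma curve_of_control_in_Lambda2:
  assumes "continuous_on UNIV w" "0 \<le> s"
  shows "snd (curve_of_control w s) \<in> Lambda2"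
proof -
  have "horizontal_curve (s + 1) (curve_of_control w) w" by (rule horizontal_curve_of_control[OF assms(1)]) (use assms in simp)
  then have "curve_of_control w ` {0..s + 1} \<subseteq> UNIV \<times> Lambda2" unfolding horizontal_curve_def by blast
  moreover have "s \<in> {0..s + 1}" using assms by simp
  ultimately have "curve_of_control w s \<in> UNIV \<times> Lambda2" by blast
  then show ?thesis by (simp add: mem_Times_iff)
qed

text \<open>
  Reflecting \<open>x\<close> on \<open>[0, p]\<close> gives a curve \<open>y\<close> with control \<open>v\<close>, of the same length and with the same
  end points, whose control jumps from \<open>- w p\<close> to \<open>w p\<close> while \<open>y\<close> is continuous. Applying
  \<open>one_sided_limits_in_average_space\<close> to \<open>(1, y, v)\<close> produces an admissible \<open>h\<close> with \<open>\<integral> h v = 2 w p\<close>, against the first-order condition.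
\<close>

lemma not_minimizing_beyond_return:
  assumes w: "continuous_on UNIV w" and p: "0 < p" "p < T" and c: "0 < c" "\<And>s. norm (w s) = c"
    and ret: "fst (curve_of_control w p) = 0"
  shows "cc_dist (curve_of_control w 0) (curve_of_control w T) < c * T"
proof (rule ccontr)
  assume "\<not> ?thesis"
  then have min: "c * T \<le> cc_dist (curve_of_control w 0) (curve_of_control w T)" by simp
  have T: "0 < T" using p by simp
  define x where "x s = fst (curve_of_control w s)" for s
  define t where "t s = snd (curve_of_control w s)" for s
  have lx: "lip_deriv S x w" if "0 < S" for S
    unfolding x_def[abs_def] by (rule curve_of_control_lip_deriv(1)[OF w that])
  have lt0: "lip_deriv T t (\<lambda>s. (1/2) *\<^sub>R wedge (x s) (w s))"
    unfolding x_def[abs_def] t_def[abs_def] by (rule curve_of_control_lip_deriv(2)[OF w T])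
  have x0: "x 0 = 0" "x p = 0" using ret by (simp_all add: x_def curve_of_control_0)
  define y where "y s = (if s \<le> p then - x s else x s)" for s
  define v where "v s = (if s \<le> p then - w s else w s)" for s
  have "lip_deriv (p + (T - p)) (\<lambda>s. if s \<le> p then - x s else x (p + (s - p))) (\<lambda>s. if s \<le> p then - w s else w (p + (s - p)))"
  proof (rule lip_deriv_concat)
    show "lip_deriv p (\<lambda>s. - x s) (\<lambda>s. - w s)"
      by (rule lip_deriv_linear[OF bounded_linear_minus[OF bounded_linear_ident] lx[OF p(1)]])
    have "lip_deriv (T - p) (\<lambda>s. x (p + s)) (\<lambda>s. 1 *\<^sub>R w (p + s))"
    proof (rule lip_deriv_reparam[OF lx[OF T], where \<sigma>="\<lambda>s. s - p"])
      show "((\<lambda>s. p + s) has_real_derivative 1) (at r within {0..T - p})" for r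
        using DERIV_add[OF DERIV_const DERIV_ident] by simp
      show "(\<lambda>s. s - p) differentiable_on (\<lambda>s. p + s) ` {0..T - p}"
        by (intro differentiable_on_diff differentiable_on_ident differentiable_on_const)
    qed (use p in auto)
    then show "lip_deriv (T - p) (\<lambda>s. x (p + s)) (\<lambda>s. w (p + s))" by simp
    show "- x p = x (p + 0)" using x0 by simp
  qed
  note ly' = this
  have pp: "p + (s - p) = s" for s by (simp add: algebra_simps)
  from ly' have ly: "lip_deriv T y v" unfolding pp y_def[abs_def] v_def[abs_def] .
  have vy: "wedge (y s) (v s) = wedge (x s) (w s)" for s
    by (simp add: y_def v_def wedge.minus_left wedge.minus_right)
  have lt: "lip_deriv T t (\<lambda>s. (1/2) *\<^sub>R wedge (y s) (v s))" unfolding vy by (rule lt0)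
  have tL: "t s \<in> Lambda2" if "s \<in> {0..T}" for s
    unfolding t_def by (rule curve_of_control_in_Lambda2[OF w]) (use that in simp)
  have nv: "norm (v s) = c" for s by (simp add: v_def c(2))
  have minv: "c * T \<le> cc_dist (y 0, t 0) (y T, t T)"
  proof -
    have "y 0 = fst (curve_of_control w 0)" "y T = fst (curve_of_control w T)"
      using p x0(1) by (simp_all add: y_def x_def)
    then show ?thesis using min by (simp add: t_def)
  qed
  define f where "f s = (1::real, y s, v s)" for s
  have cy: "continuous_on {0..T} y" by (rule lip_deriv_continuous[OF ly])
  have int: "((\<lambda>s. k s *\<^sub>R f s) has_integral (integral {0..T} k, integral {0..T} (\<lambda>s. k s *\<^sub>R y s), integral {0..T} (\<lambda>s. k s *\<^sub>R v s))) {0..T}"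
    if k: "continuous_on {0..T} k" for k
  proof -
    have i3: "(\<lambda>s. k s *\<^sub>R v s) integrable_on {0..T}"
      using lip_deriv_continuous_bilinear_absolutely_integrable[OF bounded_bilinear_scaleR k ly]
      by (simp add: set_lebesgue_integral_eq_integral(1))
    have i2: "(\<lambda>s. k s *\<^sub>R y s) integrable_on {0..T}" by (intro integrable_continuous_real continuous_intros k cy)
    have i1: "k integrable_on {0..T}" by (rule integrable_continuous_real[OF k])
    have b1: "bounded_linear (\<lambda>a::real. (a, 0::real^4, 0::real^4))"
      and b2: "bounded_linear (\<lambda>a::real^4. (0::real, a, 0::real^4))"
      and b3: "bounded_linear (\<lambda>a::real^4. (0::real, 0::real^4, a))"
      by (intro bounded_linear_Pair bounded_linear_ident bounded_linear_zero)+
    from has_integral_add[OF has_integral_add[OF has_integral_linear[OF integrable_integral[OF i1] b1]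
         has_integral_linear[OF integrable_integral[OF i2] b2]] has_integral_linear[OF integrable_integral[OF i3] b3]]
    show ?thesis by (simp add: o_def f_def)
  qed
  have xlim: "(x \<longlongrightarrow> 0) (at p)"
  proof -
    have "(x \<longlongrightarrow> x p) (at p within {0..T})"
      using lip_deriv_continuous[OF lx[OF T]] p by (simp add: continuous_on_def)
    then show ?thesis using p at_within_Icc_at[of 0 p T] x0 by simp
  qed
  have wlim: "(w \<longlongrightarrow> w p) (at p)" using w by (simp add: continuous_on_def)
  note xl = tendsto_within_subset[OF xlim subset_UNIV] and wl = tendsto_within_subset[OF wlim subset_UNIV]
  have fl: "(f \<longlongrightarrow> (1, - 0, - w p)) (at_left p)"
  proof (rule Lim_transform_eventually)
    show "((\<lambda>s. (1, - x s, - w s)) \<longlongrightarrow> (1, - 0, - w p)) (at_left p)"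
      by (rule tendsto_Pair[OF tendsto_const tendsto_Pair[OF tendsto_minus[OF xl] tendsto_minus[OF wl]]])
    show "\<forall>\<^sub>F s in at_left p. (1, - x s, - w s) = f s"
      unfolding eventually_at_filter by (simp add: f_def y_def v_def)
  qed
  have fr: "(f \<longlongrightarrow> (1, 0, w p)) (at_right p)"
  proof (rule Lim_transform_eventually)
    show "((\<lambda>s. (1, x s, w s)) \<longlongrightarrow> (1, 0, w p)) (at_right p)"
      by (rule tendsto_Pair[OF tendsto_const tendsto_Pair[OF xl wl]])
    show "\<forall>\<^sub>F s in at_right p. (1, x s, w s) = f s"
      unfolding eventually_at_filter by (simp add: f_def y_def v_def)
  qed
  have fint: "(\<lambda>s. k s *\<^sub>R f s) integrable_on {0..T}" if "continuous_on {0..T} k" for k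
    using int[OF that] by (rule has_integral_integrable)
  obtain h where h: "continuous_on {0..T} h" "integral {0..T} (\<lambda>s. h s *\<^sub>R f s) = (1, 0, w p) - (1, - 0, - w p)"
    using one_sided_limits_in_average_space[OF p fint fl fr] by blast
  then have "(integral {0..T} h, integral {0..T} (\<lambda>s. h s *\<^sub>R y s), integral {0..T} (\<lambda>s. h s *\<^sub>R v s)) = (0, 0, 2 *\<^sub>R w p)"
    using integral_unique[OF int[OF h(1)]] by (simp add: scaleR_2)
  then have "integral {0..T} h = 0" "integral {0..T} (\<lambda>s. h s *\<^sub>R y s) = 0" "integral {0..T} (\<lambda>s. h s *\<^sub>R v s) = 2 *\<^sub>R w p"
    by simp_all
  with minimizer_first_order[OF ly lt tL _ _ minv h(1)] nv c(1) have "w p = 0" by simp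
  then show False using c(1) c(2)[of p] by simp
qed

section \<open>Cut times\<close>

lemma cc_dist_concat_le:
  assumes \<gamma>: "horizontal_curve S \<gamma> u" and \<eta>: "horizontal_curve S' \<eta> w" and eq: "\<gamma> S = \<eta> 0"
  shows "cc_dist (\<gamma> 0) (\<eta> S') \<le> control_length S u + control_length S' w"
proof -
  have SS: "0 < S" "0 < S'" using \<gamma> \<eta> by (auto simp: horizontal_curve_def)
  obtain u' N where u': "lip_deriv S (\<lambda>s. fst (\<gamma> s)) u'"
    "lip_deriv S (\<lambda>s. snd (\<gamma> s)) (\<lambda>s. (1/2) *\<^sub>R wedge (fst (\<gamma> s)) (u' s))"
    "negligible N" "\<And>s. s \<in> {0..S} - N \<Longrightarrow> u' s = u s"
    using horizontal_curve_lip_deriv[OF \<gamma>] by blast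
  obtain w' M where w': "lip_deriv S' (\<lambda>s. fst (\<eta> s)) w'"
    "lip_deriv S' (\<lambda>s. snd (\<eta> s)) (\<lambda>s. (1/2) *\<^sub>R wedge (fst (\<eta> s)) (w' s))"
    "negligible M" "\<And>s. s \<in> {0..S'} - M \<Longrightarrow> w' s = w s"
    using horizontal_curve_lip_deriv[OF \<eta>] by blast
  define x where "x s = (if s \<le> S then fst (\<gamma> s) else fst (\<eta> (s - S)))" for s
  define t where "t s = (if s \<le> S then snd (\<gamma> s) else snd (\<eta> (s - S)))" for s
  define v where "v s = (if s \<le> S then u' s else w' (s - S))" for s
  have lx: "lip_deriv (S + S') x v"
    unfolding x_def[abs_def] v_def[abs_def] by (rule lip_deriv_concat[OF u'(1) w'(1)]) (simp add: eq)
  have "lip_deriv (S + S') t (\<lambda>s. if s \<le> S then (1/2) *\<^sub>R wedge (fst (\<gamma> s)) (u' s)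
      else (1/2) *\<^sub>R wedge (fst (\<eta> (s - S))) (w' (s - S)))"
    unfolding t_def[abs_def] by (rule lip_deriv_concat[OF u'(2) w'(2)]) (simp add: eq)
  moreover have "(\<lambda>s. if s \<le> S then (1/2) *\<^sub>R wedge (fst (\<gamma> s)) (u' s)
      else (1/2) *\<^sub>R wedge (fst (\<eta> (s - S))) (w' (s - S))) = (\<lambda>s. (1/2) *\<^sub>R wedge (x s) (v s))"
    by (auto simp: x_def v_def)
  ultimately have lt: "lip_deriv (S + S') t (\<lambda>s. (1/2) *\<^sub>R wedge (x s) (v s))" by (simp only:)
  have tL: "t s \<in> Lambda2" if s: "s \<in> {0..S + S'}" for s
  proof (cases "s \<le> S")
    case True
    then have "\<gamma> s \<in> UNIV \<times> Lambda2" using \<gamma> s unfolding horizontal_curve_def image_subset_iff by auto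
    then show ?thesis using True by (simp add: t_def mem_Times_iff)
  next
    case False
    then have "s - S \<in> {0..S'}" using s by auto
    then have "\<eta> (s - S) \<in> UNIV \<times> Lambda2" using \<eta> unfolding horizontal_curve_def image_subset_iff by blast
    then show ?thesis using False by (simp add: t_def mem_Times_iff)
  qed
  have "horizontal_curve (S + S') (\<lambda>s. (x s, t s)) v" by (rule lip_deriv_horizontal_curve[OF lx lt tL])
  from cc_dist_le[OF this refl refl]
  have "cc_dist (x 0, t 0) (x (S + S'), t (S + S')) \<le> control_length (S + S') v" .
  moreover have "(x 0, t 0) = \<gamma> 0" "(x (S + S'), t (S + S')) = \<eta> S'"
    using SS by (simp_all add: x_def t_def)
  moreover have "control_length (S + S') v = control_length S u + control_length S' w"
  proof -
    have iv: "(\<lambda>s. norm (v s)) integrable_on {0..S + S'}"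
      using lip_deriv_absolutely_integrable[OF lx] by (simp add: absolutely_integrable_on_def)
    have "control_length (S + S') v = integral {0..S} (\<lambda>s. norm (v s)) + integral {S..S + S'} (\<lambda>s. norm (v s))"
      unfolding control_length_def using SS iv
      by (intro Henstock_Kurzweil_Integration.integral_combine[symmetric]) auto
    also have "integral {0..S} (\<lambda>s. norm (v s)) = control_length S u"
      unfolding control_length_def by (rule integral_spike[OF u'(3)]) (auto simp: v_def u'(4))
    also have "integral {S..S + S'} (\<lambda>s. norm (v s)) = integral {0..S'} ((\<lambda>s. norm (v s)) \<circ> (+) S)"
      by (simp add: integral_shift_Icc_real add.commute)
    also have "\<dots> = control_length S' w"
      unfolding control_length_def by (rule integral_spike[of "insert 0 M"]) (use w' in \<open>auto simp: v_def\<close>)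
    finally show ?thesis .
  qed
  ultimately show ?thesis by simp
qed

text \<open>
  For \<open>q < p\<close> the segment is run through backwards, whence the sign \<open>\<epsilon>\<close>.
\<close>

lemma horizontal_segment:
  assumes w: "continuous_on UNIV w" and c: "\<And>s. norm (w s) = c" and pq: "0 \<le> p" "0 \<le> q" "p \<noteq> q"
  obtains \<eta> z where "horizontal_curve \<bar>q - p\<bar> \<eta> z" "\<eta> 0 = curve_of_control w p"
    "\<eta> \<bar>q - p\<bar> = curve_of_control w q" "control_length \<bar>q - p\<bar> z = c * \<bar>q - p\<bar>"
proof -
  define T where "T = max p q"
  have T: "0 < T" using pq by (simp add: T_def max_def)
  let ?x = "\<lambda>s. fst (curve_of_control w s)" and ?t = "\<lambda>s. snd (curve_of_control w s)"
  define \<epsilon> where "\<epsilon> = sgn (q - p)"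
  have \<epsilon>: "\<epsilon> * \<epsilon> = 1" "\<bar>\<epsilon>\<bar> = 1" "\<epsilon> * \<bar>q - p\<bar> = q - p" using pq by (auto simp: \<epsilon>_def sgn_if)
  have \<tau>: "p + \<epsilon> * r \<in> {0..T}" if "r \<in> {0..\<bar>q - p\<bar>}" for r
    using that pq by (cases p q rule: linorder_cases) (auto simp: \<epsilon>_def T_def)
  have d: "((\<lambda>r. p + \<epsilon> * r) has_real_derivative \<epsilon>) (at r within A)" for r A
    by (auto intro!: derivative_eq_intros)
  have \<sigma>: "(\<lambda>s. \<epsilon> * (s - p)) differentiable_on A" for A
    by (intro differentiable_on_mult differentiable_on_diff differentiable_on_ident differentiable_on_const)
  have inv: "\<epsilon> * ((p + \<epsilon> * r) - p) = r" for r using \<epsilon>(1) by (simp add: mult.assoc[symmetric])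
  have rep: "lip_deriv \<bar>q - p\<bar> (\<lambda>r. f (p + \<epsilon> * r)) (\<lambda>r. \<epsilon> *\<^sub>R v (p + \<epsilon> * r))" if "lip_deriv T f v"
    for f v :: "real \<Rightarrow> 'a::euclidean_space"
    by (rule lip_deriv_reparam[OF that _ \<tau> d continuous_on_const \<sigma> inv]) (use pq in auto)
  let ?z = "\<lambda>r. \<epsilon> *\<^sub>R w (p + \<epsilon> * r)"
  have lx: "lip_deriv \<bar>q - p\<bar> (\<lambda>r. ?x (p + \<epsilon> * r)) ?z" by (rule rep[OF curve_of_control_lip_deriv(1)[OF w T]])
  have "lip_deriv \<bar>q - p\<bar> (\<lambda>r. ?t (p + \<epsilon> * r)) (\<lambda>r. \<epsilon> *\<^sub>R ((1/2) *\<^sub>R wedge (?x (p + \<epsilon> * r)) (w (p + \<epsilon> * r))))"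
    by (rule rep[OF curve_of_control_lip_deriv(2)[OF w T]])
  then have lt: "lip_deriv \<bar>q - p\<bar> (\<lambda>r. ?t (p + \<epsilon> * r)) (\<lambda>r. (1/2) *\<^sub>R wedge (?x (p + \<epsilon> * r)) (?z r))"
    by (simp add: wedge.scaleR_right mult.commute)
  have h: "horizontal_curve \<bar>q - p\<bar> (\<lambda>r. (?x (p + \<epsilon> * r), ?t (p + \<epsilon> * r))) ?z"
    by (rule lip_deriv_horizontal_curve[OF lx lt]) (use \<tau> curve_of_control_in_Lambda2[OF w] in auto)
  have "control_length \<bar>q - p\<bar> ?z = c * \<bar>q - p\<bar>"
    by (simp add: control_length_def \<epsilon>(2) c mult.commute)
  then show thesis using that[OF h] \<epsilon>(3) by simp
qed

context
  fixes a1 b1 a2 b2 :: "real^4" and \<phi>1 \<phi>2 \<rho> :: real and \<gamma>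
  assumes par: "extremal_params a1 b1 a2 b2 \<phi>1 \<phi>2"
    and \<rho>: "\<rho> = sqrt ((norm a1)\<^sup>2 + (norm a2)\<^sup>2)" "0 < \<rho>"
    and \<gamma>: "\<gamma> = extremal a1 b1 a2 b2 \<phi>1 \<phi>2"
begin

lemma extremal_minimizes_iff:
  assumes "0 < T"
  shows "(\<exists>u. length_minimizer T \<gamma> u) \<longleftrightarrow> cc_dist (\<gamma> 0) (\<gamma> T) = \<rho> * T"
proof
  assume "\<exists>u. length_minimizer T \<gamma> u"
  then show "cc_dist (\<gamma> 0) (\<gamma> T) = \<rho> * T"
    using control_length_extremal[OF par assms] unfolding length_minimizer_def \<gamma> \<rho>(1) by (metis mult.commute)
next
  assume "cc_dist (\<gamma> 0) (\<gamma> T) = \<rho> * T"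
  then show "\<exists>u. length_minimizer T \<gamma> u"
    using horizontal_curve_extremal[OF assms] control_length_extremal[OF par assms]
    unfolding length_minimizer_def \<gamma> \<rho>(1) by (metis mult.commute)
qed

lemma cut_time_eq_return:
  assumes p: "0 < p" "fst (\<gamma> p) = 0" and min: "cc_dist (\<gamma> 0) (\<gamma> p) = \<rho> * p"
  shows "cut_time \<gamma> = ereal p"
  unfolding cut_time_def
proof (rule antisym)
  show "Sup {ereal T |T. 0 < T \<and> (\<exists>u. length_minimizer T \<gamma> u)} \<le> ereal p"
  proof (rule Sup_least)
    fix z assume "z \<in> {ereal T |T. 0 < T \<and> (\<exists>u. length_minimizer T \<gamma> u)}"
    then obtain T where T: "z = ereal T" "0 < T" "\<exists>u. length_minimizer T \<gamma> u" by blast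
    have "\<not> p < T"
    proof
      assume "p < T"
      have "cc_dist (\<gamma> 0) (\<gamma> T) < \<rho> * T"
        unfolding \<gamma> extremal_def
        by (rule not_minimizing_beyond_return[OF continuous_on_extremal_control p(1) \<open>p < T\<close> \<rho>(2)])
          (use extremal_control_norm[OF par] \<rho>(1) p(2) in \<open>simp_all add: \<gamma> extremal_def\<close>)
      then show False using T extremal_minimizes_iff[OF T(2)] by simp
    qed
    then show "z \<le> ereal p" using T by simp
  qed
  show "ereal p \<le> Sup {ereal T |T. 0 < T \<and> (\<exists>u. length_minimizer T \<gamma> u)}"
    by (rule Sup_upper) (use p min extremal_minimizes_iff[OF p(1)] in auto)
qed

text \<open>
  If the shortcut saves \<open>2 \<rho> \<delta>\<close>, then going to \<open>\<gamma> p\<close> along it and from there along the extremal to \<open>\<gamma> T\<close>,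
  forwards or backwards, is shorter than the extremal for every \<open>T > p - \<delta>\<close>.
\<close>

lemma cut_time_less_of_shortcut:
  assumes p: "0 < p" and \<eta>: "horizontal_curve S \<eta> w" "\<eta> 0 = \<gamma> 0" "\<eta> S = \<gamma> p" and short: "control_length S w < \<rho> * p"
  shows "cut_time \<gamma> < ereal p"
proof -
  let ?l = "control_length S w"
  define \<delta> where "\<delta> = (\<rho> * p - ?l) / (2 * \<rho>)"
  have \<delta>: "0 < \<delta>" using short \<rho>(2) by (simp add: \<delta>_def)
  have "cut_time \<gamma> \<le> ereal (p - \<delta>)"
    unfolding cut_time_def
  proof (rule Sup_least)
    fix z assume "z \<in> {ereal T |T. 0 < T \<and> (\<exists>u. length_minimizer T \<gamma> u)}"
    then obtain T where T: "z = ereal T" "0 < T" "\<exists>u. length_minimizer T \<gamma> u" by blast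
    then have min: "cc_dist (\<gamma> 0) (\<gamma> T) = \<rho> * T" using extremal_minimizes_iff by blast
    have "T \<le> p - \<delta>"
    proof (rule ccontr)
      assume "\<not> T \<le> p - \<delta>"
      then have far: "p - \<delta> < T" by simp
      have "cc_dist (\<gamma> 0) (\<gamma> T) \<le> ?l + \<rho> * \<bar>T - p\<bar>"
      proof (cases "T = p")
        case True
        then show ?thesis using cc_dist_le[OF \<eta>] by simp
      next
        case False
        obtain \<zeta> y where \<zeta>: "horizontal_curve \<bar>T - p\<bar> \<zeta> y" "\<zeta> 0 = \<gamma> p" "\<zeta> \<bar>T - p\<bar> = \<gamma> T"
          "control_length \<bar>T - p\<bar> y = \<rho> * \<bar>T - p\<bar>"
        proof (rule horizontal_segment[OF continuous_on_extremal_control[of UNIV a1 b1 a2 b2 \<phi>1 \<phi>2], of \<rho> p T])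
          show "norm (extremal_control a1 b1 a2 b2 \<phi>1 \<phi>2 s) = \<rho>" for s
            unfolding \<rho>(1) by (rule extremal_control_norm[OF par])
        qed (use p T False that in \<open>auto simp: \<gamma> extremal_def\<close>)
        show ?thesis using cc_dist_concat_le[OF \<eta>(1) \<zeta>(1)] \<eta> \<zeta> by simp
      qed
      then have "\<rho> * T \<le> ?l + \<rho> * \<bar>T - p\<bar>" using min by simp
      moreover have "?l = \<rho> * p - 2 * \<rho> * \<delta>" using \<rho>(2) by (simp add: \<delta>_def)
      ultimately have "0 \<le> \<rho> * (p - 2 * \<delta> + \<bar>T - p\<bar> - T)" by (simp add: algebra_simps)
      then have "0 \<le> p - 2 * \<delta> + \<bar>T - p\<bar> - T" using \<rho>(2) by (simp add: zero_le_mult_iff)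
      then show False using far \<delta> by (simp add: abs_if split: if_splits)
    qed
    then show "z \<le> ereal (p - \<delta>)" using T by simp
  qed
  also have "\<dots> < ereal p" using \<delta> by simp
  finally show ?thesis .
qed

lemma extremal_at_common_period:
  assumes \<phi>: "0 < \<phi>2" "\<phi>2 < \<phi>1" and r: "norm a1 \<noteq> 0" "norm a2 \<noteq> 0"
    and T: "0 < T" "\<phi>1 * T = pi * real p" "\<phi>2 * T = pi * real q"
  obtains x1 y1 x2 y2 t1 t2 where "orthonormal4 x1 y1 x2 y2" "orthonormal4 x2 y2 x1 y1" "0 < t1" "0 < t2"
    "\<gamma> T = (0, t1 *\<^sub>R wedge x1 y1 + t2 *\<^sub>R wedge x2 y2)"
    "\<gamma> T = (0, (T / (4 * \<phi>1)) *\<^sub>R wedge a1 b1 + (T / (4 * \<phi>2)) *\<^sub>R wedge a2 b2)"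
    "t1 = T * (norm a1)\<^sup>2 / (4 * \<phi>1)" "t2 = T * (norm a2)\<^sup>2 / (4 * \<phi>2)"
    "(\<rho> * T)\<^sup>2 = 4 * pi * real p * t1 + 4 * pi * real q * t2"
proof -
  define x1 where "x1 = a1 /\<^sub>R norm a1"
  define y1 where "y1 = b1 /\<^sub>R norm a1"
  define x2 where "x2 = a2 /\<^sub>R norm a2"
  define y2 where "y2 = b2 /\<^sub>R norm a2"
  define t1 where "t1 = T * (norm a1)\<^sup>2 / (4 * \<phi>1)"
  define t2 where "t2 = T * (norm a2)\<^sup>2 / (4 * \<phi>2)"
  have on: "orthonormal4 x1 y1 x2 y2" "orthonormal4 x2 y2 x1 y1"
    using par r by (auto simp: extremal_params_def orthonormal4_def orthogonal4_def orthogonal_def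
        x1_def y1_def x2_def y2_def inner_commute)
  have t: "0 < t1" "0 < t2" using \<phi> T r by (simp_all add: t1_def t2_def)
  have ab: "a1 = norm a1 *\<^sub>R x1" "b1 = norm a1 *\<^sub>R y1" "a2 = norm a2 *\<^sub>R x2" "b2 = norm a2 *\<^sub>R y2"
    using r by (simp_all add: x1_def y1_def x2_def y2_def)
  have w: "wedge a1 b1 = (norm a1)\<^sup>2 *\<^sub>R wedge x1 y1" "wedge a2 b2 = (norm a2)\<^sup>2 *\<^sub>R wedge x2 y2"
    by (subst ab(1), subst ab(2), simp only: wedge.scaleR_left wedge.scaleR_right scaleR_scaleR power2_eq_square)
       (subst ab(3), subst ab(4), simp only: wedge.scaleR_left wedge.scaleR_right scaleR_scaleR power2_eq_square)
  have full: "sin (2 * \<phi>1 * T) = 0" "cos (2 * \<phi>1 * T) = 1" "sin (2 * \<phi>2 * T) = 0" "cos (2 * \<phi>2 * T) = 1"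
  proof -
    have e1: "2 * \<phi>1 * T = 2 * pi * real p" and e2: "2 * \<phi>2 * T = 2 * pi * real q" using T by simp_all
    show "sin (2 * \<phi>1 * T) = 0" "cos (2 * \<phi>1 * T) = 1" "sin (2 * \<phi>2 * T) = 0" "cos (2 * \<phi>2 * T) = 1"
      unfolding e1 e2 using sin_int_2pin[of "int p"] cos_int_2pin[of "int p"] sin_int_2pin[of "int q"] cos_int_2pin[of "int q"]
      by (simp_all add: mult_ac)
  qed
  have e: "\<gamma> T = (0, (T / (4 * \<phi>1)) *\<^sub>R wedge a1 b1 + (T / (4 * \<phi>2)) *\<^sub>R wedge a2 b2)"
    unfolding \<gamma> by (rule extremal_common_period) (use \<phi> T full in auto)
  have e': "\<gamma> T = (0, t1 *\<^sub>R wedge x1 y1 + t2 *\<^sub>R wedge x2 y2)"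
    unfolding e w by (simp add: t1_def t2_def)
  have "(\<rho> * T)\<^sup>2 = ((norm a1)\<^sup>2 + (norm a2)\<^sup>2) * T\<^sup>2"
    unfolding \<rho>(1) power_mult_distrib by (simp add: sum_power2_ge_zero)
  also have "\<dots> = 4 * (\<phi>1 * T) * t1 + 4 * (\<phi>2 * T) * t2"
    using \<phi> by (simp add: t1_def t2_def power2_eq_square field_simps)
  finally have "(\<rho> * T)\<^sup>2 = 4 * pi * real p * t1 + 4 * pi * real q * t2" unfolding T by simp
  then show thesis using that[OF on t e' e t1_def t2_def] by blast
qed

end

text \<open>
  If \<open>s \<phi>1 = n \<pi>\<close> and \<open>s \<phi>2 = m \<pi>\<close>, then \<open>n q = m p\<close>, so the positive integer \<open>m\<close> is a multiple of \<open>q\<close>.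
\<close>

lemma common_period_least:
  fixes \<phi>1 \<phi>2 :: real and p q :: nat
  assumes \<phi>: "0 < \<phi>1" "0 < \<phi>2" and pq: "0 < p" "0 < q" "coprime p q" and r: "\<phi>1 / \<phi>2 = real p / real q"
  shows "let S = {s :: real. s > 0 \<and> [s * \<phi>1 = 0] (rmod pi) \<and> [s * \<phi>2 = 0] (rmod pi)}
     in pi * real q / \<phi>2 \<in> S \<and> (\<forall>s\<in>S. pi * real q / \<phi>2 \<le> s)"
proof -
  have cong: "[s = 0] (rmod pi) \<longleftrightarrow> (\<exists>n::int. s = of_int n * pi)" for s
    using rcong_altdef[of 0 s pi] by (simp add: rcong_sym_iff)
  have r': "\<phi>1 * real q = \<phi>2 * real p" using r \<phi> pq by (simp add: field_simps)
  have "pi * real q / \<phi>2 * \<phi>1 = of_int (int p) * pi" using r' \<phi> by (simp add: field_simps)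
  moreover have "pi * real q / \<phi>2 * \<phi>2 = of_int (int q) * pi" using \<phi> by simp
  ultimately have "pi * real q / \<phi>2 \<in> {s. s > 0 \<and> [s * \<phi>1 = 0] (rmod pi) \<and> [s * \<phi>2 = 0] (rmod pi)}"
    using \<phi> pq unfolding cong by (intro CollectI conjI exI[of _ "int p"] exI[of _ "int q"]) simp_all
  moreover have "pi * real q / \<phi>2 \<le> s" if s: "s > 0" "[s * \<phi>1 = 0] (rmod pi)" "[s * \<phi>2 = 0] (rmod pi)" for s
  proof -
    obtain n m :: int where nm: "s * \<phi>1 = of_int n * pi" "s * \<phi>2 = of_int m * pi" using s unfolding cong by blast
    have "pi * (of_int n * real q) = s * (\<phi>1 * real q)" using nm(1) by (simp add: algebra_simps)
    also have "\<dots> = pi * (of_int m * real p)" unfolding r' using nm(2) by (simp add: algebra_simps)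
    finally have "real_of_int (n * int q) = real_of_int (m * int p)" by simp
    then have "n * int q = m * int p" by linarith
    then have "int q dvd m * int p" by (metis dvd_triv_right)
    moreover have "coprime (int q) (int p)" using pq by (simp add: coprime_commute)
    ultimately have "int q dvd m" by (simp add: coprime_dvd_mult_left_iff)
    moreover have "0 < m"
    proof -
      have "0 < of_int m * pi" using nm(2) s \<phi> by (metis mult_pos_pos)
      then show ?thesis by (simp add: zero_less_mult_iff)
    qed
    ultimately have "int q \<le> m" by (simp add: zdvd_imp_le)
    then have "real q \<le> of_int m" by linarith
    then have "pi * real q \<le> s * \<phi>2" using nm(2) by (simp add: mult.commute)
    then show ?thesis using \<phi> by (simp add: divide_le_eq)
  qed
  ultimately show ?thesis by (auto simp: Let_def)
qed

theorem proposition5p1: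
  shows
    "(\<forall>(t1::real) (t2::real) (x1::real^4) (y1::real^4) (x2::real^4) (y2::real^4).
        t1 \<ge> t2 \<and> t2 > 0 \<and> orthonormal4 x1 y1 x2 y2 \<longrightarrow>
          (\<forall>T \<gamma> u.
             length_minimizer T \<gamma> u \<and> constant_speed T u \<and>
             \<gamma> 0 = (0, 0) \<and> \<gamma> T = (0, t1 *\<^sub>R wedge x1 y1 + t2 *\<^sub>R wedge x2 y2) \<longrightarrow>
             (\<exists>a1 b1 a2 b2 \<phi>1 \<phi>2.
                extremal_params a1 b1 a2 b2 \<phi>1 \<phi>2 \<and>
                (\<phi>2 = 2 * \<phi>1 \<or> \<phi>1 = 2 * \<phi>2) \<and>
                (\<forall>s\<in>{0..T}. \<gamma> s = extremal a1 b1 a2 b2 \<phi>1 \<phi>2 s)))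
          \<and> cc_dist (0, 0) (0, t1 *\<^sub>R wedge x1 y1 + t2 *\<^sub>R wedge x2 y2)
              = sqrt (4 * pi * t1 + 8 * pi * t2)
          \<and> sqrt (4 * pi * t1 + 8 * pi * t2)
              = sqrt (4 * pi * max \<bar>t1\<bar> \<bar>t2\<bar> + 8 * pi * min \<bar>t1\<bar> \<bar>t2\<bar>))
     \<and>
     (\<forall>(a1::real^4) (b1::real^4) (a2::real^4) (b2::real^4) (\<phi>1::real) (\<phi>2::real)
        (r1::real) (r2::real) (\<gamma> :: real \<Rightarrow> (real^4) \<times> (real^4^4)).
        0 < \<phi>2 \<and> \<phi>2 < \<phi>1 \<and> \<phi>1 / \<phi>2 \<in> \<rat> \<and> 0 < r1 \<and> 0 < r2 \<and>
        extremal_params a1 b1 a2 b2 \<phi>1 \<phi>2 \<and>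
        norm a1 = r1 \<and> norm b1 = r1 \<and> norm a2 = r2 \<and> norm b2 = r2 \<and>
        \<gamma> = extremal a1 b1 a2 b2 \<phi>1 \<phi>2 \<longrightarrow>
          (\<phi>1 = 2 * \<phi>2 \<and> r2\<^sup>2 \<ge> r1\<^sup>2 / 2 \<longrightarrow>
             cut_time \<gamma> = ereal (pi / \<phi>2) \<and>
             \<gamma> (real_of_ereal (cut_time \<gamma>)) =
               (0, (pi / (8 * \<phi>2\<^sup>2)) *\<^sub>R wedge a1 b1 + (pi / (4 * \<phi>2\<^sup>2)) *\<^sub>R wedge a2 b2))
          \<and> (\<phi>1 = 2 * \<phi>2 \<and> r2\<^sup>2 < r1\<^sup>2 / 2 \<longrightarrow> cut_time \<gamma> < ereal (pi / \<phi>2))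
          \<and> (\<forall>p q :: nat.
               0 < p \<and> 0 < q \<and> coprime p q \<and> \<phi>1 / \<phi>2 = real p / real q \<and>
               real p / real q > 1 \<and> real p / real q \<noteq> 2 \<longrightarrow>
               cut_time \<gamma> < ereal (pi * real q / \<phi>2) \<and>
               (let S = {s :: real. s > 0 \<and> [s * \<phi>1 = 0] (rmod pi) \<and> [s * \<phi>2 = 0] (rmod pi)}
                in pi * real q / \<phi>2 \<in> S \<and> (\<forall>s\<in>S. pi * real q / \<phi>2 \<le> s))))"
proof (intro conjI allI impI)
  fix t1 t2 :: real and x1 y1 x2 y2 :: "real^4"
  assume A: "t1 \<ge> t2 \<and> t2 > 0 \<and> orthonormal4 x1 y1 x2 y2"
  show "cc_dist (0, 0) (0, t1 *\<^sub>R wedge x1 y1 + t2 *\<^sub>R wedge x2 y2) = sqrt (4 * pi * t1 + 8 * pi * t2)"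
    using cc_dist_center A by blast
  show "sqrt (4 * pi * t1 + 8 * pi * t2) = sqrt (4 * pi * max \<bar>t1\<bar> \<bar>t2\<bar> + 8 * pi * min \<bar>t1\<bar> \<bar>t2\<bar>)"
    using A by simp
  fix T \<gamma> u
  assume "length_minimizer T \<gamma> u \<and> constant_speed T u \<and> \<gamma> 0 = (0, 0) \<and>
    \<gamma> T = (0, t1 *\<^sub>R wedge x1 y1 + t2 *\<^sub>R wedge x2 y2)"
  then show "\<exists>a1 b1 a2 b2 \<phi>1 \<phi>2. extremal_params a1 b1 a2 b2 \<phi>1 \<phi>2 \<and> (\<phi>2 = 2 * \<phi>1 \<or> \<phi>1 = 2 * \<phi>2) \<and>
      (\<forall>s\<in>{0..T}. \<gamma> s = extremal a1 b1 a2 b2 \<phi>1 \<phi>2 s)"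
    using center_minimizers_are_extremals[of x1 y1 x2 y2 t2 t1 T \<gamma> u] A by blast
next
  fix a1 b1 a2 b2 :: "real^4" and \<phi>1 \<phi>2 r1 r2 :: real and \<gamma> :: "real \<Rightarrow> (real^4) \<times> (real^4^4)"
  assume A: "0 < \<phi>2 \<and> \<phi>2 < \<phi>1 \<and> \<phi>1 / \<phi>2 \<in> \<rat> \<and> 0 < r1 \<and> 0 < r2 \<and> extremal_params a1 b1 a2 b2 \<phi>1 \<phi>2 \<and>
    norm a1 = r1 \<and> norm b1 = r1 \<and> norm a2 = r2 \<and> norm b2 = r2 \<and> \<gamma> = extremal a1 b1 a2 b2 \<phi>1 \<phi>2"
  then have \<phi>: "0 < \<phi>2" "\<phi>2 < \<phi>1" and par: "extremal_params a1 b1 a2 b2 \<phi>1 \<phi>2"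
    and \<gamma>: "\<gamma> = extremal a1 b1 a2 b2 \<phi>1 \<phi>2" and r: "norm a1 = r1" "norm a2 = r2" "0 < r1" "0 < r2" by auto
  define \<rho> where "\<rho> = sqrt ((norm a1)\<^sup>2 + (norm a2)\<^sup>2)"
  have \<rho>: "0 < \<rho>" using r by (simp add: \<rho>_def add_pos_pos)
  have \<gamma>0: "\<gamma> 0 = (0, 0)" by (simp add: \<gamma> extremal_def curve_of_control_0)
  have nz: "norm a1 \<noteq> 0" "norm a2 \<noteq> 0" using r by auto
  have shortcut: "cut_time \<gamma> < ereal T"
    if T: "0 < T" and on: "orthonormal4 x1 y1 x2 y2" and t: "0 < t1" "0 < t2"
      and e: "\<gamma> T = (0, t1 *\<^sub>R wedge x1 y1 + t2 *\<^sub>R wedge x2 y2)"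
      and less: "4 * pi * t1 + 8 * pi * t2 < (\<rho> * T)\<^sup>2" for T t1 t2 x1 y1 x2 y2
  proof -
    obtain \<eta> w where \<eta>: "horizontal_curve 1 \<eta> w" "\<eta> 0 = (0, 0)" "\<eta> 1 = (0, t1 *\<^sub>R wedge x1 y1 + t2 *\<^sub>R wedge x2 y2)"
      "control_length 1 w = sqrt (4 * pi * t1 + 8 * pi * t2)"
      using closed_extremal_exists[OF on t] by blast
    have "control_length 1 w < \<rho> * T"
      unfolding \<eta>(4) using less \<rho> T by (intro real_less_lsqrt) auto
    then show ?thesis
      using cut_time_less_of_shortcut[OF par \<rho>_def \<rho> \<gamma> T \<eta>(1)] \<eta>(2,3) \<gamma>0 e by simp
  qed
  have period2: "0 < pi / \<phi>2" "\<phi>1 * (pi / \<phi>2) = pi * real 2" "\<phi>2 * (pi / \<phi>2) = pi * real 1" if "\<phi>1 = 2 * \<phi>2"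
    using that \<phi> by simp_all
  {
    assume B: "\<phi>1 = 2 * \<phi>2 \<and> r2\<^sup>2 \<ge> r1\<^sup>2 / 2"
    then have \<phi>12: "\<phi>1 = 2 * \<phi>2" by simp
    let ?T = "pi / \<phi>2"
    obtain x1 y1 x2 y2 t1 t2 where E: "orthonormal4 x1 y1 x2 y2" "orthonormal4 x2 y2 x1 y1" "0 < t1" "0 < t2"
      "\<gamma> ?T = (0, t1 *\<^sub>R wedge x1 y1 + t2 *\<^sub>R wedge x2 y2)"
      "\<gamma> ?T = (0, (?T / (4 * \<phi>1)) *\<^sub>R wedge a1 b1 + (?T / (4 * \<phi>2)) *\<^sub>R wedge a2 b2)"
      "t1 = ?T * (norm a1)\<^sup>2 / (4 * \<phi>1)" "t2 = ?T * (norm a2)\<^sup>2 / (4 * \<phi>2)"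
      "(\<rho> * ?T)\<^sup>2 = 4 * pi * real 2 * t1 + 4 * pi * real 1 * t2"
      by (rule extremal_at_common_period[OF par \<rho>_def \<rho> \<gamma> \<phi> nz period2[OF \<phi>12]]) (rule that; assumption)
    have "t1 \<le> t2"
    proof -
      have "t1 = (?T / (4 * \<phi>2)) * (r1\<^sup>2 / 2)" unfolding E(7) \<phi>12 r by simp
      also have "\<dots> \<le> (?T / (4 * \<phi>2)) * r2\<^sup>2" using B \<phi> by (intro mult_left_mono) auto
      also have "\<dots> = t2" unfolding E(8) r by simp
      finally show ?thesis .
    qed
    then have "cc_dist (0, 0) (0, t2 *\<^sub>R wedge x2 y2 + t1 *\<^sub>R wedge x1 y1) = sqrt (4 * pi * t2 + 8 * pi * t1)"
      by (rule cc_dist_center[OF E(2) _ E(3)])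
    then have "cc_dist (\<gamma> 0) (\<gamma> ?T) = sqrt ((\<rho> * ?T)\<^sup>2)"
      unfolding \<gamma>0 E(5) E(9) by (simp add: add.commute)
    then have min: "cc_dist (\<gamma> 0) (\<gamma> ?T) = \<rho> * ?T" using \<rho> \<phi> by simp
    have cut: "cut_time \<gamma> = ereal ?T"
      by (rule cut_time_eq_return[OF par \<rho>_def \<rho> \<gamma> period2(1)[OF \<phi>12] _ min]) (simp add: E(5))
    show "cut_time \<gamma> = ereal (pi / \<phi>2)" by (rule cut)
    show "\<gamma> (real_of_ereal (cut_time \<gamma>)) =
        (0, (pi / (8 * \<phi>2\<^sup>2)) *\<^sub>R wedge a1 b1 + (pi / (4 * \<phi>2\<^sup>2)) *\<^sub>R wedge a2 b2)"
      unfolding cut real_of_ereal.simps E(6) \<phi>12 by (simp add: power2_eq_square mult_ac)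
  next
    assume B: "\<phi>1 = 2 * \<phi>2 \<and> r2\<^sup>2 < r1\<^sup>2 / 2"
    then have \<phi>12: "\<phi>1 = 2 * \<phi>2" by simp
    let ?T = "pi / \<phi>2"
    obtain x1 y1 x2 y2 t1 t2 where E: "orthonormal4 x1 y1 x2 y2" "orthonormal4 x2 y2 x1 y1" "0 < t1" "0 < t2"
      "\<gamma> ?T = (0, t1 *\<^sub>R wedge x1 y1 + t2 *\<^sub>R wedge x2 y2)"
      "\<gamma> ?T = (0, (?T / (4 * \<phi>1)) *\<^sub>R wedge a1 b1 + (?T / (4 * \<phi>2)) *\<^sub>R wedge a2 b2)"
      "t1 = ?T * (norm a1)\<^sup>2 / (4 * \<phi>1)" "t2 = ?T * (norm a2)\<^sup>2 / (4 * \<phi>2)"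
      "(\<rho> * ?T)\<^sup>2 = 4 * pi * real 2 * t1 + 4 * pi * real 1 * t2"
      by (rule extremal_at_common_period[OF par \<rho>_def \<rho> \<gamma> \<phi> nz period2[OF \<phi>12]]) (rule that; assumption)
    have "t2 < t1"
    proof -
      have "t2 = (?T / (4 * \<phi>2)) * r2\<^sup>2" unfolding E(8) r by simp
      also have "\<dots> < (?T / (4 * \<phi>2)) * (r1\<^sup>2 / 2)" using B \<phi> by (intro mult_strict_left_mono) auto
      also have "\<dots> = t1" unfolding E(7) \<phi>12 r by simp
      finally show ?thesis .
    qed
    then have "pi * t2 < pi * t1" by simp
    then have "4 * pi * t1 + 8 * pi * t2 < (\<rho> * ?T)\<^sup>2" unfolding E(9) by simp
    then show "cut_time \<gamma> < ereal (pi / \<phi>2)"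
      by (rule shortcut[OF period2(1)[OF \<phi>12] E(1,3,4,5)])
  next
    fix p q :: nat
    assume B: "0 < p \<and> 0 < q \<and> coprime p q \<and> \<phi>1 / \<phi>2 = real p / real q \<and> real p / real q > 1 \<and> real p / real q \<noteq> 2"
    then have pq: "0 < p" "0 < q" "coprime p q" "\<phi>1 / \<phi>2 = real p / real q" by auto
    show "let S = {s. s > 0 \<and> [s * \<phi>1 = 0] (rmod pi) \<and> [s * \<phi>2 = 0] (rmod pi)}
       in pi * real q / \<phi>2 \<in> S \<and> (\<forall>s\<in>S. pi * real q / \<phi>2 \<le> s)"
      by (rule common_period_least) (use \<phi> pq in auto)
    let ?T = "pi * real q / \<phi>2"
    have T: "0 < ?T" "\<phi>1 * ?T = pi * real p" "\<phi>2 * ?T = pi * real q"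
      using \<phi> pq(1,2,4) by (simp_all add: field_simps)
    obtain x1 y1 x2 y2 t1 t2 where E: "orthonormal4 x1 y1 x2 y2" "orthonormal4 x2 y2 x1 y1" "0 < t1" "0 < t2"
      "\<gamma> ?T = (0, t1 *\<^sub>R wedge x1 y1 + t2 *\<^sub>R wedge x2 y2)"
      "\<gamma> ?T = (0, (?T / (4 * \<phi>1)) *\<^sub>R wedge a1 b1 + (?T / (4 * \<phi>2)) *\<^sub>R wedge a2 b2)"
      "t1 = ?T * (norm a1)\<^sup>2 / (4 * \<phi>1)" "t2 = ?T * (norm a2)\<^sup>2 / (4 * \<phi>2)"
      "(\<rho> * ?T)\<^sup>2 = 4 * pi * real p * t1 + 4 * pi * real q * t2"
      by (rule extremal_at_common_period[OF par \<rho>_def \<rho> \<gamma> \<phi> nz T]) (rule that; assumption)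
    \<comment> \<open>Since \<open>p \<ge> 3\<close>, sweeping out \<open>t1\<close> in two turns and \<open>t2\<close> in one is shorter.\<close>
    have "3 \<le> p"
    proof -
      have "1 < real p / real q" using B by blast
      then have "q < p" using pq(2) by (simp add: less_divide_eq)
      moreover have "p \<noteq> 2"
      proof
        assume "p = 2"
        then have "q = 1" using \<open>q < p\<close> pq(2) by simp
        then show False using B \<open>p = 2\<close> by simp
      qed
      ultimately show ?thesis using pq(2) by linarith
    qed
    then have "3 * t1 + 1 * t2 \<le> real p * t1 + real q * t2"
      using pq(2) E(3,4) by (intro add_mono mult_right_mono) auto
    then have "2 * t1 + t2 < real p * t1 + real q * t2" using E(3) by linarith
    then have "(4 * pi) * (2 * t1 + t2) < (4 * pi) * (real p * t1 + real q * t2)" by simp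
    then have "4 * pi * t2 + 8 * pi * t1 < (\<rho> * ?T)\<^sup>2" unfolding E(9) by (simp add: algebra_simps)
    moreover have "\<gamma> ?T = (0, t2 *\<^sub>R wedge x2 y2 + t1 *\<^sub>R wedge x1 y1)" unfolding E(5) by (simp add: add.commute)
    ultimately show "cut_time \<gamma> < ereal (pi * real q / \<phi>2)"
      using shortcut[OF T(1) E(2,4,3)] by blast
  }
qed

end
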